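(* Let $A=\mathbb{K}[x_1,\dots,x_n]$ be the polynomial ring in $n$ variables over a field $\mathbb{K}$, let $I$ be a monomial ideal of $A$, and let $\ell,j\ge0$ be integers. Suppose that $A/I$ satisfies $(S_\ell^j)$. Then $A/\sqrt{I}$ satisfies $(S_\ell^j)$.
   Context: A commutative Noetherian ring $B$ satisfies $(S_\ell^j)$ if $\operatorname{depth}B_{\mathfrak{p}}\ge\min\{\ell,\dim B_{\mathfrak{p}}-j\}$ for all $\mathfrak{p}\in\operatorname{Spec}B$. *)

theory Defs
  imports
    "HOL-Algebra.QuotRing"
    "HOL-Library.Poly_Mapping"
    "HOL-Library.Extended_Real"
begin

section \<open>Localization\<close>

text \<open>The usual relation on \<open>R \<times> S\<close>: \<open>a/s = b/t\<close> iff \<open>u (t a - s b) = 0\<close> for some \<open>u \<in> S\<close>.\<close>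

definition frac_rel :: "('a, 'm) ring_scheme \<Rightarrow> 'a set \<Rightarrow> (('a \<times> 'a) \<times> ('a \<times> 'a)) set" where
  "frac_rel R S =
     {((a, s), (b, t)). a \<in> carrier R \<and> s \<in> S \<and> b \<in> carrier R \<and> t \<in> S \<and>
        (\<exists>u\<in>S. u \<otimes>\<^bsub>R\<^esub> (t \<otimes>\<^bsub>R\<^esub> a \<ominus>\<^bsub>R\<^esub> s \<otimes>\<^bsub>R\<^esub> b) = \<zero>\<^bsub>R\<^esub>)}"

definition localization :: "('a, 'm) ring_scheme \<Rightarrow> 'a set \<Rightarrow> ('a \<times> 'a) set ring" where
  "localization R S =
     \<lparr>carrier = (carrier R \<times> S) // frac_rel R S,
      monoid.mult = (\<lambda>X Y. \<Union>(a, s)\<in>X. \<Union>(b, t)\<in>Y. frac_rel R S `` {(a \<otimes>\<^bsub>R\<^esub> b, s \<otimes>\<^bsub>R\<^esub> t)}),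
      one = frac_rel R S `` {(\<one>\<^bsub>R\<^esub>, \<one>\<^bsub>R\<^esub>)},
      zero = frac_rel R S `` {(\<zero>\<^bsub>R\<^esub>, \<one>\<^bsub>R\<^esub>)},
      add = (\<lambda>X Y. \<Union>(a, s)\<in>X. \<Union>(b, t)\<in>Y.
               frac_rel R S `` {(a \<otimes>\<^bsub>R\<^esub> t \<oplus>\<^bsub>R\<^esub> b \<otimes>\<^bsub>R\<^esub> s, s \<otimes>\<^bsub>R\<^esub> t)})\<rparr>"

abbreviation localization_at :: "('a, 'm) ring_scheme \<Rightarrow> 'a set \<Rightarrow> ('a \<times> 'a) set ring" where
  "localization_at R \<pp> \<equiv> localization R (carrier R - \<pp>)"


section \<open>Krull dimension and depth\<close>

definition Spec :: "('a, 'm) ring_scheme \<Rightarrow> 'a set set" where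
  "Spec R = {\<pp>. primeideal \<pp> R}"

text \<open>The supremum of an empty set of \<^typ>\<open>enat\<close> is \<open>0\<close>, so the zero ring gets dimension \<open>0\<close>;
  localizations at primes are never zero.\<close>

definition krull_dim :: "('a, 'm) ring_scheme \<Rightarrow> enat" where
  "krull_dim R =
     Sup {enat k | k. \<exists>P. (\<forall>i\<le>k. P i \<in> Spec R) \<and> (\<forall>i<k. P i \<subset> P (Suc i))}"

definition nonzerodivisor :: "('a, 'm) ring_scheme \<Rightarrow> 'a \<Rightarrow> bool" where
  "nonzerodivisor R x \<longleftrightarrow>
     x \<in> carrier R \<and> (\<forall>a\<in>carrier R. x \<otimes>\<^bsub>R\<^esub> a = \<zero>\<^bsub>R\<^esub> \<longrightarrow> a = \<zero>\<^bsub>R\<^esub>)"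

definition regular_sequence :: "('a, 'm) ring_scheme \<Rightarrow> 'a list \<Rightarrow> bool" where
  "regular_sequence R xs \<longleftrightarrow>
     set xs \<subseteq> carrier R \<and>
     (\<forall>i<length xs. let J = Idl\<^bsub>R\<^esub> (set (take i xs)) in
        nonzerodivisor (R Quot J) (J +>\<^bsub>R\<^esub> xs ! i)) \<and>
     Idl\<^bsub>R\<^esub> (set xs) \<noteq> carrier R"

definition max_ideal :: "('a, 'm) ring_scheme \<Rightarrow> 'a set" where
  "max_ideal R = (THE \<mm>. maximalideal \<mm> R)"

text \<open>Only meaningful when \<open>R\<close> is local.\<close>

definition depth :: "('a, 'm) ring_scheme \<Rightarrow> enat" where
  "depth R = Sup {enat (length xs) | xs. regular_sequence R xs \<and> set xs \<subseteq> max_ideal R}"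


section \<open>The condition \<open>(S\<^sub>l\<^sup>j)\<close>\<close>

text \<open>Intended for commutative Noetherian \<open>B\<close>. The inequality is stated in the extended reals
  because \<open>dim B\<^sub>\<pp> - j\<close> may be negative.\<close>

definition serre_cond :: "nat \<Rightarrow> nat \<Rightarrow> ('a, 'm) ring_scheme \<Rightarrow> bool" where
  "serre_cond l j B \<longleftrightarrow>
     (\<forall>\<pp>\<in>Spec B.
        ereal_of_enat (depth (localization_at B \<pp>)) \<ge>
          min (ereal (real l)) (ereal_of_enat (krull_dim (localization_at B \<pp>)) - ereal (real j)))"


section \<open>Polynomial rings, monomial ideals and radicals\<close>

text \<open>A polynomial is a finitely supported map from exponent vectors to coefficients; the
  variables are indexed by \<open>{..<n}\<close>.\<close>

definition exponents :: "nat \<Rightarrow> (nat \<Rightarrow>\<^sub>0 nat) set" where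
  "exponents n = {e. Poly_Mapping.keys e \<subseteq> {..<n}}"

definition poly_ring :: "nat \<Rightarrow> ((nat \<Rightarrow>\<^sub>0 nat) \<Rightarrow>\<^sub>0 'k::field) ring" where
  "poly_ring n =
     \<lparr>carrier = {f. Poly_Mapping.keys f \<subseteq> exponents n},
      monoid.mult = (*), one = 1, zero = 0, add = (+)\<rparr>"

definition monomials :: "nat \<Rightarrow> ((nat \<Rightarrow>\<^sub>0 nat) \<Rightarrow>\<^sub>0 'k::field) set" where
  "monomials n = {Poly_Mapping.single e 1 | e. e \<in> exponents n}"

definition monomial_ideal :: "nat \<Rightarrow> ((nat \<Rightarrow>\<^sub>0 nat) \<Rightarrow>\<^sub>0 'k::field) set \<Rightarrow> bool" where
  "monomial_ideal n I \<longleftrightarrow> (\<exists>M\<subseteq>monomials n. I = Idl\<^bsub>poly_ring n\<^esub> M)"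

definition radical :: "('a, 'm) ring_scheme \<Rightarrow> 'a set \<Rightarrow> 'a set" where
  "radical R I = {a \<in> carrier R. \<exists>k::nat. a [^]\<^bsub>R\<^esub> k \<in> I}"

end

(*
  Let phi_i be the substitution x_i |-> x_i^2. It makes A free over itself with basis 1, x_i. Since I is
  monomial, taking the coefficient of 1 exhibits A/phi_i^{-1}(I) as a direct summand of its finite
  extension A/I. A prime q and a chain of primes below it lift along this extension, by going up. If Q lies
  over q, regular sequences descend from (A/I)_Q to (A/phi_i^{-1}(I))_q: when the depth of (A/I)_Q is
  positive, incomparability shows that phi_i(q) lies in no associated prime of (A/I)_Q, so by prime
  avoidance some phi_i(y) with y in q is regular, and the depth drops by only one modulo phi_i(y). Hence
  (S_l^j) passes from I to phi_i^{-1}(I), which lies between I and its radical. A maximal monomial ideal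
  between I and its radical with (S_l^j) is therefore fixed by all phi_i^{-1}, hence equal to the radical.
*)
theory Submission
  imports Defs
begin


section \<open>Local depth over a Noetherian ring\<close>

text \<open>The substitution plays the role of Frobenius but is an algebra map over K in every
  characteristic. Treating one variable at a time keeps the extension of rank 2, where integrality
  is visible in a trace and a norm. The obstacle is local. Two primes may lie over q, so (A/I)_Q
  need not be finite over the localization of A/phi_i^{-1}(I) at q, and the splitting does not
  localize by itself; \<open>sat_contract\<close> repairs this by hand. Moreover, a regular sequence
  found in (A/I)_Q has no reason to come from q, so its first element must be exchanged for some
  phi_i(y). That the remaining depth survives the exchange rests on the comparison of socles in
  \<open>assoc_at_swap\<close>, in place of Ext or Koszul homology. To keep quotients and fractions
  out of these arguments, they are carried out with ideals of A alone: passing from A/K to its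
  quotient by x becomes passing to K + xA, and vanishing in the localization at q becomes membership
  in \<open>sat q K\<close>. Chains of primes replace the dimension, because all that is used is
  that the dimension does not drop from the contracted ring at q to (A/I)_Q.\<close>

locale subring_in =
  fixes A :: "'a::comm_ring_1 set"
  assumes zero_in [simp, intro]: "0 \<in> A" and one_in [simp, intro]: "1 \<in> A"
    and add_in [simp, intro]: "\<And>a b. a \<in> A \<Longrightarrow> b \<in> A \<Longrightarrow> a + b \<in> A"
    and mult_in [simp, intro]: "\<And>a b. a \<in> A \<Longrightarrow> b \<in> A \<Longrightarrow> a * b \<in> A"
    and uminus_in [simp, intro]: "\<And>a. a \<in> A \<Longrightarrow> - a \<in> A"
begin

lemma diff_in [simp, intro]: "a \<in> A \<Longrightarrow> b \<in> A \<Longrightarrow> a - b \<in> A"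
  using add_in[of a "- b"] uminus_in by simp

lemma power_in [simp, intro]: "a \<in> A \<Longrightarrow> a ^ k \<in> A"
  by (induction k) auto

section \<open>Ideals and primes inside a fixed subring\<close>

definition ideal_in :: "'a set \<Rightarrow> bool" where
  "ideal_in K \<longleftrightarrow> K \<subseteq> A \<and> 0 \<in> K \<and> (\<forall>a\<in>K. \<forall>b\<in>K. a + b \<in> K) \<and> (\<forall>r\<in>A. \<forall>a\<in>K. r * a \<in> K)"

lemma ideal_inI:
  assumes "K \<subseteq> A" "0 \<in> K" "\<And>a b. a \<in> K \<Longrightarrow> b \<in> K \<Longrightarrow> a + b \<in> K"
    and "\<And>r a. r \<in> A \<Longrightarrow> a \<in> K \<Longrightarrow> r * a \<in> K"
  shows "ideal_in K"
  using assms by (auto simp: ideal_in_def)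

lemma
  assumes "ideal_in K"
  shows ideal_in_sub: "K \<subseteq> A" and ideal_in_zero: "0 \<in> K"
    and ideal_in_add: "a \<in> K \<Longrightarrow> b \<in> K \<Longrightarrow> a + b \<in> K"
    and ideal_in_mult: "r \<in> A \<Longrightarrow> a \<in> K \<Longrightarrow> r * a \<in> K"
  using assms by (auto simp: ideal_in_def)

lemma ideal_in_mult2: "ideal_in K \<Longrightarrow> r \<in> A \<Longrightarrow> a \<in> K \<Longrightarrow> a * r \<in> K"
  using ideal_in_mult[of K r a] by (simp add: mult.commute)

lemma ideal_in_uminus: "ideal_in K \<Longrightarrow> a \<in> K \<Longrightarrow> - a \<in> K"
  using ideal_in_mult[of K "- 1" a] by simp

lemma ideal_in_diff: "ideal_in K \<Longrightarrow> a \<in> K \<Longrightarrow> b \<in> K \<Longrightarrow> a - b \<in> K"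
  using ideal_in_add[of K a "- b"] ideal_in_uminus by simp

definition prime_in :: "'a set \<Rightarrow> bool" where
  "prime_in P \<longleftrightarrow> ideal_in P \<and> 1 \<notin> P \<and> (\<forall>a\<in>A. \<forall>b\<in>A. a * b \<in> P \<longrightarrow> a \<in> P \<or> b \<in> P)"

lemma
  assumes "prime_in P"
  shows prime_in_ideal: "ideal_in P" and prime_in_one: "1 \<notin> P"
    and prime_in_mult: "a \<in> A \<Longrightarrow> b \<in> A \<Longrightarrow> a * b \<in> P \<Longrightarrow> a \<in> P \<or> b \<in> P"
  using assms by (auto simp: prime_in_def)

lemma prime_in_compl_mult: "prime_in P \<Longrightarrow> a \<in> A - P \<Longrightarrow> b \<in> A - P \<Longrightarrow> a * b \<in> A - P"
  using prime_in_mult[of P a b] by auto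

text \<open>Stands for the quotient of A/K by x: regular sequences are followed by enlarging the
  ideal instead of changing the ring.\<close>

definition plus_principal :: "'a set \<Rightarrow> 'a \<Rightarrow> 'a set" where
  "plus_principal K x = {k + x * a | k a. k \<in> K \<and> a \<in> A}"

lemma plus_principalI: "k \<in> K \<Longrightarrow> a \<in> A \<Longrightarrow> k + x * a \<in> plus_principal K x"
  by (auto simp: plus_principal_def)

lemma plus_principalE:
  assumes "f \<in> plus_principal K x"
  obtains k a where "k \<in> K" "a \<in> A" "f = k + x * a"
  using assms by (auto simp: plus_principal_def)

lemma plus_principal_sup: "K \<subseteq> plus_principal K x"
  using plus_principalI[of _ K 0 x] by auto

lemma plus_principal_gen: "ideal_in K \<Longrightarrow> x \<in> plus_principal K x"
  using plus_principalI[of 0 K 1 x] by (auto simp: ideal_in_zero)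

lemma plus_principal_ideal:
  assumes K: "ideal_in K" and x: "x \<in> A"
  shows "ideal_in (plus_principal K x)"
proof (rule ideal_inI)
  show "plus_principal K x \<subseteq> A"
    using ideal_in_sub[OF K] x by (auto simp: plus_principal_def)
  show "0 \<in> plus_principal K x"
    using ideal_in_zero[OF K] plus_principal_sup by blast
  fix a b assume "a \<in> plus_principal K x" "b \<in> plus_principal K x"
  then obtain k c k' c' where *: "k \<in> K" "c \<in> A" "a = k + x * c" "k' \<in> K" "c' \<in> A" "b = k' + x * c'"
    by (auto elim!: plus_principalE)
  then have "a + b = (k + k') + x * (c + c')" by (simp add: algebra_simps)
  then show "a + b \<in> plus_principal K x"
    using * ideal_in_add[OF K] by (metis plus_principalI add_in)
next
  fix r a assume r: "r \<in> A" and "a \<in> plus_principal K x"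
  then obtain k c where *: "k \<in> K" "c \<in> A" "a = k + x * c"
    by (auto elim!: plus_principalE)
  have "r * a = r * k + x * (r * c)" using * by (simp add: algebra_simps)
  then show "r * a \<in> plus_principal K x"
    using * r ideal_in_mult[OF K] plus_principalI by auto
qed

lemma plus_principal_commute:
  "plus_principal (plus_principal K x) y = plus_principal (plus_principal K y) x"
proof -
  have "plus_principal (plus_principal K x) y \<subseteq> plus_principal (plus_principal K y) x" for x y
  proof
    fix f assume "f \<in> plus_principal (plus_principal K x) y"
    then obtain k a b where *: "k \<in> K" "a \<in> A" "b \<in> A" "f = k + x * a + y * b"
      by (auto elim!: plus_principalE)
    then have "f = (k + y * b) + x * a" by (simp add: algebra_simps)
    then show "f \<in> plus_principal (plus_principal K y) x" using * by (metis plus_principalI)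
  qed
  then show ?thesis by blast
qed

text \<open>The preimage in \<open>A\<close> of the ideal generated by \<open>K\<close> in the localization at \<open>q\<close>.\<close>

definition sat :: "'a set \<Rightarrow> 'a set \<Rightarrow> 'a set" where
  "sat q K = {f \<in> A. \<exists>s\<in>A - q. s * f \<in> K}"

lemma satI: "f \<in> A \<Longrightarrow> s \<in> A - q \<Longrightarrow> s * f \<in> K \<Longrightarrow> f \<in> sat q K"
  by (auto simp: sat_def)

lemma satE:
  assumes "f \<in> sat q K" obtains s where "s \<in> A - q" "s * f \<in> K" "f \<in> A"
  using assms by (auto simp: sat_def)

lemma sat_sup: "prime_in q \<Longrightarrow> ideal_in K \<Longrightarrow> K \<subseteq> sat q K"
  using prime_in_one[of q] ideal_in_sub[of K] by (auto intro!: satI[of _ 1])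

lemma sat_cancel:
  assumes q: "prime_in q" and "s \<in> A - q" "f \<in> A" "s * f \<in> sat q K"
  shows "f \<in> sat q K"
proof -
  obtain u where "u \<in> A - q" "u * (s * f) \<in> K" using assms by (auto elim!: satE)
  then show ?thesis
    using prime_in_compl_mult[OF q, of u s] assms by (auto intro!: satI[of _ "u * s"] simp: mult.assoc)
qed

lemma sat_ideal:
  assumes q: "prime_in q" and K: "ideal_in K"
  shows "ideal_in (sat q K)"
proof (rule ideal_inI)
  show "sat q K \<subseteq> A" by (auto simp: sat_def)
  show "0 \<in> sat q K" using sat_sup[OF q K] ideal_in_zero[OF K] by auto
next
  fix a b assume "a \<in> sat q K" "b \<in> sat q K"
  then obtain s u where *: "a \<in> A" "b \<in> A" "s \<in> A - q" "u \<in> A - q" "s * a \<in> K" "u * b \<in> K"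
    by (auto elim!: satE)
  have "(s * u) * (a + b) = u * (s * a) + s * (u * b)" by (simp add: algebra_simps)
  then have "(s * u) * (a + b) \<in> K"
    using * ideal_in_add[OF K] ideal_in_mult[OF K] by auto
  then show "a + b \<in> sat q K"
    using * prime_in_compl_mult[OF q, of s u] by (intro satI[of _ "s * u"]) auto
next
  fix r a assume r: "r \<in> A" and "a \<in> sat q K"
  then obtain s where *: "a \<in> A" "s \<in> A - q" "s * a \<in> K" by (auto elim!: satE)
  then have "s * (r * a) \<in> K"
    using ideal_in_mult[OF K r, of "s * a"] by (simp add: mult.left_commute)
  then show "r * a \<in> sat q K" using * r by (intro satI[of _ s]) auto
qed

lemma sat_plus_principalI:
  assumes "f \<in> A" "s \<in> A - q" "k \<in> K" "a \<in> A" "s * f = k + x * a"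
  shows "f \<in> sat q (plus_principal K x)"
  using satI[OF assms(1,2)] plus_principalI[OF assms(3,4)] assms(5) by simp

lemma sat_plus_principalE:
  assumes "f \<in> sat q (plus_principal K x)"
  obtains s k a where "f \<in> A" "s \<in> A - q" "k \<in> K" "a \<in> A" "s * f = k + x * a"
  using assms by (auto elim!: satE plus_principalE)

lemma sat_plus_principal_satI:
  assumes q: "prime_in q" and f: "f \<in> A" and s: "s \<in> A - q" and a: "a \<in> A"
    and "s * f - x * a \<in> sat q K"
  shows "f \<in> sat q (plus_principal K x)"
proof -
  obtain v where v: "v \<in> A - q" "v * (s * f - x * a) \<in> K" using assms by (auto elim!: satE)
  have "(v * s) * f = v * (s * f - x * a) + x * (v * a)" by (simp add: algebra_simps)
  then show ?thesis
    using v f a prime_in_compl_mult[OF q v(1) s] by (intro sat_plus_principalI) auto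
qed

text \<open>Multiplication by x is injective on the localization of A/K at q. Properness is not part
  of the notion: if an ideal K meets A - q, then \<open>sat q K\<close> is all of A and every x
  qualifies.\<close>

definition regular_at :: "'a set \<Rightarrow> 'a set \<Rightarrow> 'a \<Rightarrow> bool" where
  "regular_at q K x \<longleftrightarrow> (\<forall>f\<in>A. x * f \<in> sat q K \<longrightarrow> f \<in> sat q K)"

lemma regular_atD: "regular_at q K x \<Longrightarrow> f \<in> A \<Longrightarrow> x * f \<in> sat q K \<Longrightarrow> f \<in> sat q K"
  by (auto simp: regular_at_def)

text \<open>This is the half of the permutability of a regular sequence y, z that holds without
  Nakayama's lemma: y stays regular modulo z. The other half, regularity of z on K itself, is
  arranged later by the choice of z.\<close>

lemma regular_at_swap:
  assumes q: "prime_in q" and K: "ideal_in K" and y: "y \<in> A" and z: "z \<in> A"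
    and ry: "regular_at q K y" and rz: "regular_at q (plus_principal K y) z"
  shows "regular_at q (plus_principal K z) y"
  unfolding regular_at_def
proof safe
  fix f assume f: "f \<in> A" and "y * f \<in> sat q (plus_principal K z)"
  then obtain s k b where 1: "s \<in> A - q" "k \<in> K" "b \<in> A" "s * (y * f) = k + z * b"
    by (elim sat_plus_principalE)
  have "z * b = - k + y * (s * f)" using 1(4) by (simp add: algebra_simps)
  then have "z * b \<in> plus_principal K y"
    using 1(1,2) f ideal_in_uminus[OF K] plus_principalI[of "- k" K "s * f" y] by auto
  then have "b \<in> sat q (plus_principal K y)"
    using sat_sup[OF q plus_principal_ideal[OF K y]] 1(3) by (intro regular_atD[OF rz, of b]) auto
  then obtain u k' c where 2: "u \<in> A - q" "k' \<in> K" "c \<in> A" "u * b = k' + y * c"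
    by (elim sat_plus_principalE)
  \<comment> \<open>Up to the denominators s and u, b = y c modulo K, hence y f = z b = y z c, so y
    kills f - z c.\<close>
  have "y * (s * u * f - z * c) = u * (s * (y * f)) - z * (y * c)" by (simp add: algebra_simps)
  also have "\<dots> = u * (k + z * b) - z * (y * c)" using 1 by simp
  also have "\<dots> = u * k + z * (u * b) - z * (y * c)" by (simp add: algebra_simps)
  also have "\<dots> = u * k + z * k'" using 2 by (simp add: algebra_simps)
  finally have "y * (s * u * f - z * c) \<in> sat q K"
    using 1(1,2,3) 2(1,2,3) f z sat_sup[OF q K] ideal_in_add[OF K] ideal_in_mult[OF K] by auto
  then have "s * u * f - z * c \<in> sat q K"
    by (rule regular_atD[OF ry, rotated]) (use 1(1,3) 2(1,3) f z in auto)
  then show "f \<in> sat q (plus_principal K z)"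
    using 1(1,3) 2(1,3) f prime_in_compl_mult[OF q 1(1) 2(1)] by (intro sat_plus_principal_satI[OF q]) auto
qed

text \<open>The socle of the localization of A/K at q is nonzero, that is, this local ring has depth
  zero. Over a Noetherian ring the negation yields a regular element in q, see
  \<open>exists_regular_prime\<close>.\<close>

definition assoc_at :: "'a set \<Rightarrow> 'a set \<Rightarrow> bool" where
  "assoc_at q K \<longleftrightarrow> (\<exists>f\<in>A - sat q K. \<forall>w\<in>q. w * f \<in> sat q K)"

lemma assoc_at_not_regular: "assoc_at q K \<Longrightarrow> x \<in> q \<Longrightarrow> \<not> regular_at q K x"
  by (auto simp: assoc_at_def regular_at_def)

text \<open>For regular \<open>x\<close> the socle modulo \<open>x\<close> is \<open>Ext\<^sup>1\<close> of the residue field with the local ring, so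
  it does not depend on \<open>x\<close>; explicitly, \<open>f\<close> is sent to \<open>g = y f / x\<close>.\<close>

lemma assoc_at_swap:
  assumes q: "prime_in q" and K: "ideal_in K" and xq: "x \<in> q" and yq: "y \<in> q"
    and rx: "regular_at q K x" and ry: "regular_at q K y"
    and "assoc_at q (plus_principal K x)"
  shows "assoc_at q (plus_principal K y)"
proof -
  have qA: "q \<subseteq> A" using q prime_in_ideal ideal_in_sub by blast
  have x: "x \<in> A" and y: "y \<in> A" using xq yq qA by auto
  obtain f where f: "f \<in> A" "f \<notin> sat q (plus_principal K x)"
    and fw: "\<And>w. w \<in> q \<Longrightarrow> w * f \<in> sat q (plus_principal K x)"
    using assms(7) by (auto simp: assoc_at_def)
  obtain s k g where 1: "s \<in> A - q" "k \<in> K" "g \<in> A" "s * (y * f) = k + x * g"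
    using fw[OF yq] by (elim sat_plus_principalE)
  \<comment> \<open>If g were y h modulo K, then y f = x g = x y h, and cancelling y would put f
    into the ideal generated by K and x.\<close>
  have "g \<notin> sat q (plus_principal K y)"
  proof
    assume "g \<in> sat q (plus_principal K y)"
    then obtain u k' h where 2: "u \<in> A - q" "k' \<in> K" "h \<in> A" "u * g = k' + y * h"
      by (elim sat_plus_principalE)
    have "y * (s * u * f - x * h) = u * (s * (y * f)) - x * (y * h)" by (simp add: algebra_simps)
    also have "\<dots> = u * k + x * (u * g) - x * (y * h)" using 1 by (simp add: algebra_simps)
    also have "\<dots> = u * k + x * k'" using 2 by (simp add: algebra_simps)
    finally have "y * (s * u * f - x * h) \<in> sat q K"
      using 1(1,2,3) 2(1,2,3) f x sat_sup[OF q K] ideal_in_add[OF K] ideal_in_mult[OF K] by auto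
    then have "s * u * f - x * h \<in> sat q K"
      by (rule regular_atD[OF ry, rotated]) (use 1(1,3) 2(1,3) f x in auto)
    then have "f \<in> sat q (plus_principal K x)"
      using 1(1,3) 2(1,3) f prime_in_compl_mult[OF q 1(1) 2(1)] by (intro sat_plus_principal_satI[OF q]) auto
    then show False using f by simp
  qed
  moreover have "w * g \<in> sat q (plus_principal K y)" if w: "w \<in> q" for w
  proof -
    have wA: "w \<in> A" using w qA by auto
    obtain r k' h where 2: "r \<in> A - q" "k' \<in> K" "h \<in> A" "r * (w * f) = k' + x * h"
      using fw[OF w] by (elim sat_plus_principalE)
    \<comment> \<open>With w f = x h and y f = x g modulo K, both x w g and x y h equal w y f; then
      x cancels.\<close>
    have "x * (r * (w * g) - y * (s * h)) = r * w * (x * g) - s * y * (x * h)" by (simp add: algebra_simps)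
    also have "\<dots> = r * w * (s * (y * f) - k) - s * y * (r * (w * f) - k')" using 1 2 by simp
    also have "\<dots> = s * y * k' - r * w * k" by (simp add: algebra_simps)
    finally have "x * (r * (w * g) - y * (s * h)) \<in> sat q K"
      using 1(1,2,3) 2(1,2,3) f y wA sat_sup[OF q K] ideal_in_diff[OF K] ideal_in_mult[OF K] by auto
    then have "r * (w * g) - y * (s * h) \<in> sat q K"
      by (rule regular_atD[OF rx, rotated]) (use 1(1,3) 2(1,3) wA y in auto)
    then show ?thesis
      using 1(1,3) 2(1,3) wA y by (intro sat_plus_principal_satI[OF q, of _ r "s * h"]) auto
  qed
  ultimately show ?thesis using 1 by (auto simp: assoc_at_def)
qed

text \<open>A regular sequence of length t in q on the localization of A/K, unfolded from its first
  element. The freedom in choosing that first element is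
  \<open>depth_ge_Suc_plus_principal\<close>.\<close>

primrec depth_ge :: "nat \<Rightarrow> 'a set \<Rightarrow> 'a set \<Rightarrow> bool" where
  "depth_ge 0 q K \<longleftrightarrow> True"
| "depth_ge (Suc t) q K \<longleftrightarrow> (\<exists>x\<in>q. regular_at q K x \<and> depth_ge t q (plus_principal K x))"

lemma prime_avoidance:
  assumes "finite \<P>" "\<And>P. P \<in> \<P> \<Longrightarrow> prime_in P" "S \<noteq> {}" "S \<subseteq> A"
    and add: "\<And>a b. a \<in> S \<Longrightarrow> b \<in> S \<Longrightarrow> a + b \<in> S"
    and mult: "\<And>a b. a \<in> S \<Longrightarrow> b \<in> S \<Longrightarrow> a * b \<in> S"
    and "S \<subseteq> \<Union>\<P>"
  shows "\<exists>P\<in>\<P>. S \<subseteq> P"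
  using assms(1,2,7)
proof (induction "card \<P>" arbitrary: \<P> rule: less_induct)
  case less
  show ?case
  proof (cases "\<exists>P\<in>\<P>. S \<subseteq> \<Union>(\<P> - {P})")
    case True
    then obtain P where P: "P \<in> \<P>" "S \<subseteq> \<Union>(\<P> - {P})" by auto
    have "card (\<P> - {P}) < card \<P>" using P less.prems(1) by (intro card_Diff1_less)
    from less.hyps[OF this] show ?thesis using P less.prems by auto
  next
    case False
    then have "\<forall>P\<in>\<P>. \<exists>a\<in>S. a \<notin> \<Union>(\<P> - {P})" by auto
    then obtain a where a: "\<And>P. P \<in> \<P> \<Longrightarrow> a P \<in> S" "\<And>P P'. P \<in> \<P> \<Longrightarrow> P' \<in> \<P> \<Longrightarrow> P' \<noteq> P \<Longrightarrow> a P \<notin> P'"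
      by (metis (no_types, lifting) Diff_iff UnionI empty_iff insert_iff)
    have aP: "a P \<in> P" if "P \<in> \<P>" for P
      using a[OF that] less.prems(3) that by blast
    obtain P0 where P0: "P0 \<in> \<P>" using \<open>S \<noteq> {}\<close> less.prems(3) by auto
    show ?thesis
    proof (cases "\<P> = {P0}")
      case True then show ?thesis using less.prems(3) by auto
    next
      case False
      have prodS: "finite Q \<Longrightarrow> Q \<noteq> {} \<Longrightarrow> Q \<subseteq> \<P> \<Longrightarrow> (\<Prod>P\<in>Q. a P) \<in> S" for Q
        by (induction Q rule: finite_ne_induct) (auto intro: a mult)
      have prodA: "finite Q \<Longrightarrow> Q \<subseteq> \<P> \<Longrightarrow> (\<Prod>P\<in>Q. a P) \<in> A" for Q
        by (induction Q rule: finite_induct) (use \<open>S \<subseteq> A\<close> a(1) in auto)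
      have prodnot: "(\<Prod>P\<in>Q. a P) \<notin> P0" if "finite Q" "Q \<subseteq> \<P> - {P0}" for Q
        using that
      proof (induction Q rule: finite_induct)
        case empty show ?case using prime_in_one less.prems P0 by auto
      next
        case (insert P Q)
        have "a P \<notin> P0" "a P \<in> A" using a P0 insert \<open>S \<subseteq> A\<close> by auto
        moreover have "(\<Prod>P\<in>Q. a P) \<in> A" using prodA[of Q] insert by auto
        moreover have "(\<Prod>P\<in>Q. a P) \<notin> P0" using insert by simp
        ultimately have "a P * (\<Prod>P\<in>Q. a P) \<notin> P0"
          using prime_in_mult[OF less.prems(2)[OF P0]] by metis
        then show ?case using insert.hyps by simp
      qed
      let ?Q = "\<P> - {P0}"
      let ?b = "\<Prod>P\<in>?Q. a P"
      have Q: "finite ?Q" "?Q \<noteq> {}" using less.prems False P0 by auto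
      have bS: "?b \<in> S" using prodS[of ?Q] Q by auto
      have bP: "?b \<in> P" if P: "P \<in> ?Q" for P
      proof -
        have "?b = a P * (\<Prod>P\<in>?Q - {P}. a P)" using Q P by (simp add: prod.remove)
        moreover have "(\<Prod>P\<in>?Q - {P}. a P) \<in> A" using prodA[of "?Q - {P}"] Q by auto
        ultimately show ?thesis using P aP[of P] less.prems(2)[of P] ideal_in_mult2 prime_in_ideal by auto
      qed
      \<comment> \<open>The first summand lies in P0 only, the second in every member except P0, so
        the sum lies in no member of the cover.\<close>
      have "a P0 + ?b \<in> S" using add a P0 bS by auto
      then obtain P where P: "P \<in> \<P>" "a P0 + ?b \<in> P" using less.prems(3) by auto
      have id: "ideal_in P" using P less.prems(2) prime_in_ideal by auto
      have False
      proof (cases "P = P0")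
        case True
        then have "?b \<in> P0" using ideal_in_diff[OF id P(2), of "a P0"] aP[OF P0] by simp
        then show False using prodnot[of ?Q] Q by auto
      next
        case False
        then have "a P0 \<in> P" using ideal_in_diff[OF id P(2) bP[of P]] P by simp
        then show False using a(2)[OF P0 P(1) False] by simp
      qed
      then show ?thesis ..
    qed
  qed
qed

end

text \<open>The maximal condition is the form in which the hypothesis is applied: to annihilators,
  to primes lying over a given one, and to the family of monomial ideals at the end.\<close>

locale noetherian_in = subring_in +
  assumes noetherian: "\<And>F. F \<noteq> {} \<Longrightarrow> (\<And>K. K \<in> F \<Longrightarrow> ideal_in K) \<Longrightarrow> \<exists>M\<in>F. \<forall>K\<in>F. M \<subseteq> K \<longrightarrow> K = M"
begin

lemma noetherian_image:
  assumes "S \<noteq> {}" "\<And>i. i \<in> S \<Longrightarrow> ideal_in (G i)"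
  shows "\<exists>i\<in>S. \<forall>j\<in>S. G i \<subseteq> G j \<longrightarrow> G j = G i"
proof -
  have "G ` S \<noteq> {}" "\<And>K. K \<in> G ` S \<Longrightarrow> ideal_in K" using assms by auto
  from noetherian[OF this] obtain M where M: "M \<in> G ` S" "\<forall>K\<in>G ` S. M \<subseteq> K \<longrightarrow> K = M" by auto
  from M(1) obtain i where "i \<in> S" "M = G i" by auto
  with M(2) show ?thesis by auto
qed

section \<open>Associated primes and the existence of regular elements\<close>

definition colon :: "'a set \<Rightarrow> 'a \<Rightarrow> 'a set" where
  "colon M f = {a \<in> A. a * f \<in> M}"

lemma colon_ideal: "ideal_in M \<Longrightarrow> f \<in> A \<Longrightarrow> ideal_in (colon M f)"
  by (rule ideal_inI)
    (auto simp: colon_def distrib_right mult.assoc ideal_in_zero intro: ideal_in_add ideal_in_mult)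

text \<open>Maximal annihilators of nonzero elements of A/M are prime, and each zero divisor lies in
  one of them. Finiteness comes from a second use of the maximal condition, applied to double
  annihilators, so that no filtration of A/M is built.\<close>

lemma finite_assoc_primes:
  assumes M: "ideal_in M"
  shows "\<exists>\<Lambda>. finite \<Lambda> \<and> \<Lambda> \<subseteq> A - M \<and> (\<forall>f\<in>\<Lambda>. prime_in (colon M f)) \<and>
    (\<forall>z\<in>A. \<forall>f\<in>A - M. z * f \<in> M \<longrightarrow> (\<exists>g\<in>\<Lambda>. z \<in> colon M g))"
proof -
  define \<L> where "\<L> = {f \<in> A - M. \<forall>g\<in>A - M. colon M f \<subseteq> colon M g \<longrightarrow> colon M g = colon M f}"
  have prime: "prime_in (colon M f)" if f: "f \<in> \<L>" for f
    unfolding prime_in_def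
  proof (intro conjI ballI impI)
    have fA: "f \<in> A" "f \<notin> M" and fm: "\<And>g. g \<in> A - M \<Longrightarrow> colon M f \<subseteq> colon M g \<Longrightarrow> colon M g = colon M f"
      using f by (auto simp: \<L>_def)
    show "ideal_in (colon M f)" using fA M colon_ideal by auto
    show "1 \<notin> colon M f" using fA by (auto simp: colon_def)
    fix a b assume ab: "a \<in> A" "b \<in> A" "a * b \<in> colon M f"
    show "a \<in> colon M f \<or> b \<in> colon M f"
    proof (cases "b * f \<in> M")
      case True then show ?thesis using ab by (auto simp: colon_def)
    next
      case False
      have "colon M f \<subseteq> colon M (b * f)"
      proof
        fix c assume "c \<in> colon M f"
        then show "c \<in> colon M (b * f)"
          using ab ideal_in_mult[OF M, of b "c * f"] by (simp add: colon_def mult.left_commute)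
      qed
      then have "colon M (b * f) = colon M f" using fm[of "b * f"] False ab fA by auto
      moreover have "a \<in> colon M (b * f)" using ab by (auto simp: colon_def mult.assoc)
      ultimately show ?thesis by auto
    qed
  qed
  have dominated: "\<exists>g\<in>\<L>. colon M f \<subseteq> colon M g" if f: "f \<in> A - M" for f
  proof -
    let ?S = "{g \<in> A - M. colon M f \<subseteq> colon M g}"
    have "?S \<noteq> {}" using f by auto
    moreover have "\<And>g. g \<in> ?S \<Longrightarrow> ideal_in (colon M g)" using colon_ideal[OF M] by auto
    ultimately have "\<exists>g\<in>?S. \<forall>h\<in>?S. colon M g \<subseteq> colon M h \<longrightarrow> colon M h = colon M g"
      by (rule noetherian_image)
    then obtain g where g: "g \<in> ?S" "\<forall>h\<in>?S. colon M g \<subseteq> colon M h \<longrightarrow> colon M h = colon M g"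
      by (rule bexE)
    have "colon M h = colon M g" if "h \<in> A - M" "colon M g \<subseteq> colon M h" for h
      using that g(1) by (intro g(2)[rule_format]) auto
    then have "g \<in> \<L>" using g(1) by (simp add: \<L>_def)
    then show ?thesis using g by auto
  qed
  \<comment> \<open>\<open>C F\<close> is the double annihilator of F in A/M: the elements killed by
    everything that kills F.\<close>
  define C where "C F = {g \<in> A. \<forall>a\<in>A. (\<forall>f\<in>F. a * f \<in> M) \<longrightarrow> a * g \<in> M}" for F
  have C_ideal: "ideal_in (C F)" for F
    by (rule ideal_inI) (auto simp: C_def distrib_left mult.left_commute ideal_in_zero[OF M]
        intro: ideal_in_add[OF M] ideal_in_mult[OF M])
  obtain F where F: "finite F" "F \<subseteq> \<L>" and Fmax: "\<And>G. finite G \<Longrightarrow> G \<subseteq> \<L> \<Longrightarrow> C F \<subseteq> C G \<Longrightarrow> C G = C F"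
  proof -
    have "{F. finite F \<and> F \<subseteq> \<L>} \<noteq> {}" by auto
    then have "\<exists>F\<in>{F. finite F \<and> F \<subseteq> \<L>}. \<forall>G\<in>{F. finite F \<and> F \<subseteq> \<L>}. C F \<subseteq> C G \<longrightarrow> C G = C F"
      using C_ideal by (rule noetherian_image)
    then obtain F where "F \<in> {F. finite F \<and> F \<subseteq> \<L>}"
      "\<forall>G\<in>{F. finite F \<and> F \<subseteq> \<L>}. C F \<subseteq> C G \<longrightarrow> C G = C F"
      by (rule bexE)
    then show ?thesis using that[of F] by (metis (mono_tags, lifting) mem_Collect_eq)
  qed
  have colonF: "\<exists>f\<in>F. colon M f = colon M g" if g: "g \<in> \<L>" for g
  proof -
    \<comment> \<open>By the choice of F, adding g does not enlarge the double annihilator. Hence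
      the intersection of the annihilators of F is contained in the prime \<open>colon M g\<close>,
      which then contains one of them and equals it by maximality.\<close>
    have "C F \<subseteq> C (insert g F)" by (auto simp: C_def)
    then have "C (insert g F) = C F" using Fmax[of "insert g F"] F g by auto
    moreover have "g \<in> C (insert g F)" using g by (auto simp: C_def \<L>_def)
    ultimately have gC: "\<And>a. a \<in> A \<Longrightarrow> (\<forall>f\<in>F. a * f \<in> M) \<Longrightarrow> a * g \<in> M" by (auto simp: C_def)
    have pg: "prime_in (colon M g)" using prime g by auto
    have "\<exists>f\<in>F. colon M f \<subseteq> colon M g"
    proof (rule ccontr)
      assume "\<not> ?thesis"
      then have "\<forall>f\<in>F. \<exists>a. a \<in> colon M f \<and> a \<notin> colon M g" by auto
      then obtain a where a: "\<And>f. f \<in> F \<Longrightarrow> a f \<in> colon M f" "\<And>f. f \<in> F \<Longrightarrow> a f \<notin> colon M g" by metis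
      have aA: "f \<in> F \<Longrightarrow> a f \<in> A" for f using a(1)[of f] by (auto simp: colon_def)
      have pA: "(\<Prod>f\<in>G. a f) \<in> A" if "G \<subseteq> F" for G
        using finite_subset[OF that F(1)] that by (induction G rule: finite_induct) (auto intro: aA)
      have "(\<Prod>f\<in>G. a f) \<notin> colon M g" if "G \<subseteq> F" for G
        using finite_subset[OF that F(1)] that
      proof (induction G rule: finite_induct)
        case empty show ?case using prime_in_one[OF pg] by simp
      next
        case (insert f G)
        then show ?case using prime_in_mult[OF pg, of "a f" "\<Prod>f\<in>G. a f"] aA a pA[of G] by auto
      qed
      from this[of F] have "(\<Prod>f\<in>F. a f) * g \<notin> M" using pA[of F] by (auto simp: colon_def)
      moreover have "(\<Prod>f\<in>F. a f) * f \<in> M" if "f \<in> F" for f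
      proof -
        have "(\<Prod>f\<in>F. a f) * f = (\<Prod>f\<in>F - {f}. a f) * (a f * f)"
          using F that by (simp add: prod.remove mult_ac)
        then show ?thesis using a(1)[OF that] pA[of "F - {f}"] ideal_in_mult[OF M] by (auto simp: colon_def)
      qed
      ultimately show False using gC pA[of F] by auto
    qed
    then obtain f where f: "f \<in> F" "colon M f \<subseteq> colon M g" by auto
    then have "colon M g = colon M f" using F(2) g unfolding \<L>_def by auto
    then show ?thesis using f by auto
  qed
  show ?thesis
  proof (intro exI[of _ F] conjI ballI impI)
    show "finite F" "F \<subseteq> A - M" using F by (auto simp: \<L>_def)
    show "\<And>f. f \<in> F \<Longrightarrow> prime_in (colon M f)" using prime F by auto
    fix z f assume z: "z \<in> A" "f \<in> A - M" "z * f \<in> M"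
    obtain g where g: "g \<in> \<L>" "colon M f \<subseteq> colon M g" using dominated[OF z(2)] by auto
    obtain h where "h \<in> F" "colon M h = colon M g" using colonF[OF g(1)] by auto
    moreover have "z \<in> colon M f" using z by (simp add: colon_def)
    ultimately show "\<exists>g\<in>F. z \<in> colon M g" using g(2) by auto
  qed
qed

text \<open>The non-regular elements for the finitely many K fill a finite union of associated
  primes. None of these contains S, so S is not covered. Several K are treated at once because the
  exchange argument needs one element that is regular on three quotients.\<close>

lemma exists_regular:
  assumes q: "prime_in q" and \<K>: "finite \<K>" "\<And>K. K \<in> \<K> \<Longrightarrow> ideal_in K"
    and S: "S \<noteq> {}" "S \<subseteq> A"
    and add: "\<And>a b. a \<in> S \<Longrightarrow> b \<in> S \<Longrightarrow> a + b \<in> S"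
    and mult: "\<And>a b. a \<in> S \<Longrightarrow> b \<in> S \<Longrightarrow> a * b \<in> S"
    and notS: "\<And>K f. K \<in> \<K> \<Longrightarrow> f \<in> A - sat q K \<Longrightarrow> prime_in (colon (sat q K) f)
      \<Longrightarrow> \<not> S \<subseteq> colon (sat q K) f"
  shows "\<exists>z\<in>S. \<forall>K\<in>\<K>. regular_at q K z"
proof (rule ccontr)
  assume "\<not> ?thesis"
  then have no: "\<And>z. z \<in> S \<Longrightarrow> \<exists>K\<in>\<K>. \<not> regular_at q K z" by auto
  have "\<forall>K\<in>\<K>. \<exists>\<Lambda>. finite \<Lambda> \<and> \<Lambda> \<subseteq> A - sat q K \<and> (\<forall>f\<in>\<Lambda>. prime_in (colon (sat q K) f)) \<and>
    (\<forall>z\<in>A. \<forall>f\<in>A - sat q K. z * f \<in> sat q K \<longrightarrow> (\<exists>g\<in>\<Lambda>. z \<in> colon (sat q K) g))"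
    by (intro ballI finite_assoc_primes sat_ideal[OF q] \<K>(2))
  from bchoice[OF this] obtain \<Lambda> where \<Lambda>': "\<forall>K\<in>\<K>. finite (\<Lambda> K) \<and> \<Lambda> K \<subseteq> A - sat q K \<and> (\<forall>f\<in>\<Lambda> K. prime_in (colon (sat q K) f)) \<and>
    (\<forall>z\<in>A. \<forall>f\<in>A - sat q K. z * f \<in> sat q K \<longrightarrow> (\<exists>g\<in>\<Lambda> K. z \<in> colon (sat q K) g))"
    ..
  have \<Lambda>: "finite (\<Lambda> K)" "\<Lambda> K \<subseteq> A - sat q K" "\<forall>f\<in>\<Lambda> K. prime_in (colon (sat q K) f)"
    "\<forall>z\<in>A. \<forall>f\<in>A - sat q K. z * f \<in> sat q K \<longrightarrow> (\<exists>g\<in>\<Lambda> K. z \<in> colon (sat q K) g)" if "K \<in> \<K>" for K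
    using bspec[OF \<Lambda>' that] by simp_all
  let ?P = "\<Union>K\<in>\<K>. colon (sat q K) ` \<Lambda> K"
  have "\<exists>P\<in>?P. S \<subseteq> P"
  proof (rule prime_avoidance[OF _ _ S add mult])
    show "finite ?P" using \<K> \<Lambda>(1) by auto
    show "\<And>P. P \<in> ?P \<Longrightarrow> prime_in P" using \<Lambda>(3) by auto
    show "S \<subseteq> \<Union>?P"
    proof
      fix z assume z: "z \<in> S"
      then obtain K where K: "K \<in> \<K>" "\<not> regular_at q K z" using no by blast
      then obtain f where f: "f \<in> A - sat q K" "z * f \<in> sat q K" by (auto simp: regular_at_def)
      have "z \<in> A" using z S by auto
      from \<Lambda>(4)[OF K(1), rule_format, OF this f] obtain g where "g \<in> \<Lambda> K" "z \<in> colon (sat q K) g" ..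
      then show "z \<in> \<Union>?P" using K(1) by blast
    qed
  qed
  then obtain K f where Kf: "K \<in> \<K>" "f \<in> \<Lambda> K" "S \<subseteq> colon (sat q K) f" by auto
  then have "f \<in> A - sat q K" "prime_in (colon (sat q K) f)" using \<Lambda>(2,3)[OF Kf(1)] by auto
  then show False using notS[OF Kf(1)] Kf(3) by metis
qed

lemma exists_regular_prime:
  assumes q: "prime_in q" and \<K>: "finite \<K>" "\<And>K. K \<in> \<K> \<Longrightarrow> ideal_in K"
    and na: "\<And>K. K \<in> \<K> \<Longrightarrow> \<not> assoc_at q K"
  shows "\<exists>z\<in>q. \<forall>K\<in>\<K>. regular_at q K z"
proof -
  have qi: "ideal_in q" using q prime_in_ideal by auto
  show ?thesis
  proof (rule exists_regular[OF q \<K>])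
    show "q \<noteq> {}" "q \<subseteq> A" using ideal_in_zero[OF qi] ideal_in_sub[OF qi] by auto
    show "\<And>a b. a \<in> q \<Longrightarrow> b \<in> q \<Longrightarrow> a + b \<in> q" using ideal_in_add[OF qi] by auto
    show "\<And>a b. a \<in> q \<Longrightarrow> b \<in> q \<Longrightarrow> a * b \<in> q" using ideal_in_mult[OF qi] ideal_in_sub[OF qi] by auto
    show "\<not> q \<subseteq> colon (sat q K) f" if "K \<in> \<K>" "f \<in> A - sat q K" for K f
      using na[OF that(1)] that(2) by (auto simp: assoc_at_def colon_def subset_iff)
  qed auto
qed

text \<open>The depth drops by at most one modulo any regular x in q, not only modulo the first
  element y of the given sequence. The two are linked by an auxiliary z that is regular on K, K + xA
  and K + yA: the bound travels from K + yA to K + yA + zA, then to K + zA, then to K + zA + xA,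
  where z serves as the next element after x.\<close>

lemma depth_ge_Suc_plus_principal:
  assumes q: "prime_in q" and "ideal_in K" and "x \<in> q" and "regular_at q K x" and "depth_ge (Suc t) q K"
  shows "depth_ge t q (plus_principal K x)"
  using assms(2-)
proof (induction t arbitrary: K x)
  case 0 then show ?case by simp
next
  case (Suc t)
  note K = \<open>ideal_in K\<close>
  have qA: "q \<subseteq> A" using q prime_in_ideal ideal_in_sub by blast
  obtain y where y: "y \<in> q" "regular_at q K y" "depth_ge (Suc t) q (plus_principal K y)"
    using Suc.prems(4) by auto
  then obtain y' where y': "y' \<in> q" "regular_at q (plus_principal K y) y'" by auto
  have xA: "x \<in> A" "y \<in> A" using Suc.prems y qA by auto
  note ideals = plus_principal_ideal[OF K xA(1)] plus_principal_ideal[OF K xA(2)]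
  have na: "\<not> assoc_at q K" "\<not> assoc_at q (plus_principal K y)"
    using assoc_at_not_regular y y' by blast+
  \<comment> \<open>This is the only place where information moves from y to x: if the socle modulo
    x were nonzero, so would be the one modulo y, which contains the regular element y' in its
    way.\<close>
  then have "\<not> assoc_at q (plus_principal K x)"
    using assoc_at_swap[OF q K _ _ _ _ ] Suc.prems y by blast
  then obtain z where z: "z \<in> q" "regular_at q K z" "regular_at q (plus_principal K x) z"
    "regular_at q (plus_principal K y) z"
    using exists_regular_prime[OF q, of "{K, plus_principal K x, plus_principal K y}"] na K ideals by auto
  have zA: "z \<in> A" using z qA by auto
  have "depth_ge t q (plus_principal (plus_principal K y) z)"
    using Suc.IH[OF ideals(2) z(1) z(4)] y by auto
  moreover have "regular_at q (plus_principal K z) y"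
    using regular_at_swap[OF q K xA(2) zA y(2) z(4)] .
  ultimately have "depth_ge (Suc t) q (plus_principal K z)"
    using y(1) by (auto simp: plus_principal_commute[of K z y])
  moreover have "regular_at q (plus_principal K z) x"
    using regular_at_swap[OF q K xA(1) zA Suc.prems(3) z(3)] .
  ultimately have "depth_ge t q (plus_principal (plus_principal K z) x)"
    using Suc.IH[OF plus_principal_ideal[OF K zA] Suc.prems(2)] by auto
  then show ?case using z by (auto simp: plus_principal_commute[of K x z])
qed

end


section \<open>Descent along the adjunction of a square root\<close>

context subring_in
begin

definition prime_chain :: "'a set \<Rightarrow> nat \<Rightarrow> (nat \<Rightarrow> 'a set) \<Rightarrow> 'a set \<Rightarrow> bool" where
  "prime_chain I k P q \<longleftrightarrow>
     (\<forall>i\<le>k. prime_in (P i)) \<and> I \<subseteq> P 0 \<and> (\<forall>i<k. P i \<subset> P (Suc i)) \<and> P k \<subseteq> q"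

text \<open>Asking for the bound for every chain of length k replaces the dimension, which is the
  supremum of these lengths. The chain forces I to lie in q. Truncated subtraction turns a negative
  dim - j into the empty demand 0.\<close>

definition serre_in :: "nat \<Rightarrow> nat \<Rightarrow> 'a set \<Rightarrow> bool" where
  "serre_in l j I \<longleftrightarrow>
     (\<forall>q k P. prime_in q \<longrightarrow> prime_chain I k P q \<longrightarrow> depth_ge (min l (k - j)) q I)"

end

text \<open>\<open>\<phi>\<close> makes the subring \<open>A\<close> free over itself with basis \<open>1, x\<close>, and \<open>E\<close> is the coefficient
  of \<open>1\<close>.\<close>

locale square_extension = noetherian_in A for A :: "'a::comm_ring_1 set" +
  fixes \<phi> E :: "'a \<Rightarrow> 'a" and x :: 'a
  assumes phi_in [simp]: "a \<in> A \<Longrightarrow> \<phi> a \<in> A" and E_in [simp]: "a \<in> A \<Longrightarrow> E a \<in> A" and x_in [simp]: "x \<in> A"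
    and phi_add: "a \<in> A \<Longrightarrow> b \<in> A \<Longrightarrow> \<phi> (a + b) = \<phi> a + \<phi> b"
    and phi_mult: "a \<in> A \<Longrightarrow> b \<in> A \<Longrightarrow> \<phi> (a * b) = \<phi> a * \<phi> b"
    and phi_one: "\<phi> 1 = 1" and phi_x: "\<phi> x = x * x"
    and E_add: "a \<in> A \<Longrightarrow> b \<in> A \<Longrightarrow> E (a + b) = E a + E b"
    and E_phi_mult: "b \<in> A \<Longrightarrow> a \<in> A \<Longrightarrow> E (\<phi> b * a) = b * E a"
    and E_one: "E 1 = 1" and E_x: "E x = 0"
    and decompose: "a \<in> A \<Longrightarrow> \<exists>b\<in>A. \<exists>c\<in>A. a = \<phi> b + x * \<phi> c"
begin

lemma E_phi: "b \<in> A \<Longrightarrow> E (\<phi> b) = b"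
  using E_phi_mult[of b 1] E_one by simp

lemma phi_zero: "\<phi> 0 = 0"
  using phi_add[of 0 0] by simp

lemma phi_uminus: "a \<in> A \<Longrightarrow> \<phi> (- a) = - \<phi> a"
  using phi_add[of a "- a"] phi_zero by (simp add: eq_neg_iff_add_eq_0 add.commute)

lemma phi_diff: "a \<in> A \<Longrightarrow> b \<in> A \<Longrightarrow> \<phi> (a - b) = \<phi> a - \<phi> b"
  using phi_add[of a "- b"] phi_uminus by simp

section \<open>Integrality: lying over, going up, incomparability\<close>

definition contract :: "'a set \<Rightarrow> 'a set" where
  "contract K = {a \<in> A. \<phi> a \<in> K}"

lemma contract_ideal: "ideal_in K \<Longrightarrow> ideal_in (contract K)"
  by (rule ideal_inI)
    (auto simp: contract_def phi_zero phi_add phi_mult ideal_in_zero intro: ideal_in_add ideal_in_mult)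

lemma contract_prime: "prime_in P \<Longrightarrow> prime_in (contract P)"
  unfolding prime_in_def using contract_ideal by (auto simp: contract_def phi_one phi_mult)

text \<open>Here c is the conjugate of a under x |-> -x, so t and n are the preimages of its trace
  and norm. The norm b b - x d d contains x and not x x because \<phi> sends x to x x.\<close>

lemma quadratic:
  assumes "a \<in> A"
  obtains t n c where "t \<in> A" "n \<in> A" "c \<in> A" "a + c = \<phi> t" "a * c = \<phi> n"
proof -
  obtain b d where bd: "b \<in> A" "d \<in> A" "a = \<phi> b + x * \<phi> d" using decompose[OF assms] by auto
  show thesis
  proof (rule that[of "b + b" "b * b - x * (d * d)" "\<phi> b - x * \<phi> d"])
    show "a + (\<phi> b - x * \<phi> d) = \<phi> (b + b)" using phi_add[OF bd(1) bd(1)] bd by simp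
    show "a * (\<phi> b - x * \<phi> d) = \<phi> (b * b - x * (d * d))"
      using bd by (simp add: phi_diff phi_mult phi_x algebra_simps)
    show "b + b \<in> A" using bd(1) by (intro add_in)
  qed (use bd in auto)
qed

text \<open>An ideal M that is maximal among those containing K and missing the image of A - Q is
  prime. That it contains all of \<phi> Q is where integrality enters.\<close>

lemma lying_over:
  assumes K: "ideal_in K" and Q: "prime_in Q" and KQ: "contract K \<subseteq> Q"
  shows "\<exists>Q'. prime_in Q' \<and> K \<subseteq> Q' \<and> contract Q' = Q"
proof -
  let ?F = "{M. ideal_in M \<and> K \<subseteq> M \<and> contract M \<subseteq> Q}"
  have "?F \<noteq> {}" using K KQ by auto
  then have "\<exists>M\<in>?F. \<forall>L\<in>?F. M \<subseteq> L \<longrightarrow> L = M" by (rule noetherian) simp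
  then obtain M where MF: "M \<in> ?F" and "\<forall>L\<in>?F. M \<subseteq> L \<longrightarrow> L = M" by (rule bexE)
  then have max: "\<And>L. ideal_in L \<Longrightarrow> K \<subseteq> L \<Longrightarrow> contract L \<subseteq> Q \<Longrightarrow> M \<subseteq> L \<Longrightarrow> L = M" by simp
  have M: "ideal_in M" "K \<subseteq> M" "contract M \<subseteq> Q" using MF by auto
  have meet: "\<exists>s\<in>A - Q. \<exists>m\<in>M. \<exists>c\<in>A. \<phi> s = m + a * c" if a: "a \<in> A" "a \<notin> M" for a
  proof -
    have id: "ideal_in (plus_principal M a)" using plus_principal_ideal M a by auto
    have "plus_principal M a \<noteq> M" using plus_principal_gen[OF M(1)] a by auto
    then have "\<not> contract (plus_principal M a) \<subseteq> Q"
      using max[OF id] plus_principal_sup[of M a] M(2) by auto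
    then obtain s where "s \<in> A - Q" "\<phi> s \<in> plus_principal M a" by (auto simp: contract_def)
    then show ?thesis by (auto elim!: plus_principalE)
  qed
  have notM: "\<phi> s \<notin> M" if "s \<in> A - Q" for s using that M(3) by (auto simp: contract_def)
  have "prime_in M"
    unfolding prime_in_def
  proof (intro conjI ballI impI)
    show "1 \<notin> M" using notM[of 1] prime_in_one[OF Q] by (auto simp: phi_one)
    fix a b assume ab: "a \<in> A" "b \<in> A" "a * b \<in> M"
    show "a \<in> M \<or> b \<in> M"
    proof (rule ccontr)
      assume "\<not> ?thesis"
      then obtain s m c s' m' c' where 1: "s \<in> A - Q" "m \<in> M" "c \<in> A" "\<phi> s = m + a * c"
        and 2: "s' \<in> A - Q" "m' \<in> M" "c' \<in> A" "\<phi> s' = m' + b * c'"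
        using meet ab(1,2) by metis
      have A: "m \<in> A" "m' \<in> A" using 1(2) 2(2) ideal_in_sub[OF M(1)] by auto
      have "\<phi> (s * s') = (m' + b * c') * m + a * c * m' + c * c' * (a * b)"
        using 1(1,4) 2(1,4) by (simp add: phi_mult algebra_simps)
      also have "\<dots> \<in> M"
      proof (intro ideal_in_add[OF M(1)])
        show "(m' + b * c') * m \<in> M" "a * c * m' \<in> M" "c * c' * (a * b) \<in> M"
          using 1(2,3) 2(2,3) ab A by (simp_all add: ideal_in_mult[OF M(1)])
      qed
      finally show False using notM prime_in_compl_mult[OF Q 1(1) 2(1)] by auto
    qed
  qed (fact M(1))
  moreover have "Q \<subseteq> contract M"
  proof
    fix p assume p: "p \<in> Q"
    have pA: "p \<in> A" using p Q prime_in_ideal ideal_in_sub by blast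
    have "\<phi> p \<in> M"
    proof (rule ccontr)
      assume "\<phi> p \<notin> M"
      then obtain s m a where 1: "s \<in> A - Q" "m \<in> M" "a \<in> A" "\<phi> s = m + \<phi> p * a"
        using meet[of "\<phi> p"] pA by auto
      obtain t n c where 2: "t \<in> A" "n \<in> A" "c \<in> A" "a + c = \<phi> t" "a * c = \<phi> n"
        using quadratic[OF 1(3)] by blast
      have sA: "s \<in> A" using 1(1) by simp
      \<comment> \<open>The norm of \<phi> s - \<phi> p a, written in terms of the trace t and the
        norm n of a. It is a multiple of m, hence in M, and modulo p it is the square of s; so s
        would belong to Q.\<close>
      have "\<phi> (s * s - p * (s * t - p * n)) = \<phi> s * \<phi> s - \<phi> p * (\<phi> s * \<phi> t - \<phi> p * \<phi> n)"
        using sA pA 2(1,2) by (simp only: phi_diff phi_mult mult_in diff_in)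
      also have "\<dots> = (\<phi> s - \<phi> p * c) * (\<phi> s - \<phi> p * a)"
        unfolding 2(4,5)[symmetric] by (simp add: algebra_simps)
      also have "\<dots> = (\<phi> s - \<phi> p * c) * m" unfolding 1(4) by simp
      also have "\<dots> \<in> M" by (rule ideal_in_mult[OF M(1)]) (use sA pA 1(2) 2(3) in auto)
      finally have "\<phi> (s * s - p * (s * t - p * n)) \<in> M" .
      moreover have "s * s - p * (s * t - p * n) \<in> A" using sA pA 2(1,2) by auto
      ultimately have "s * s - p * (s * t - p * n) \<in> Q" using notM by blast
      moreover have "p * (s * t - p * n) \<in> Q"
        using p sA pA 2(1,2) by (intro ideal_in_mult2[OF prime_in_ideal[OF Q]]) auto
      ultimately have "s * s \<in> Q" using ideal_in_add[OF prime_in_ideal[OF Q]] by (metis diff_add_cancel)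
      then show False using prime_in_mult[OF Q sA sA] 1(1) by auto
    qed
    then show "p \<in> contract M" using pA by (simp add: contract_def)
  qed
  ultimately show ?thesis using M by auto
qed

lemma going_up:
  assumes I: "ideal_in I" and "\<forall>i\<le>k. prime_in (P i)" "contract I \<subseteq> P 0" "\<forall>i<k. P i \<subset> P (Suc i)"
  shows "\<exists>P'. (\<forall>i\<le>k. prime_in (P' i) \<and> contract (P' i) = P i) \<and> I \<subseteq> P' 0 \<and> (\<forall>i<k. P' i \<subset> P' (Suc i))"
  using assms(2,4)
proof (induction k)
  case 0
  obtain Q where "prime_in Q" "I \<subseteq> Q" "contract Q = P 0" using lying_over[OF I, of "P 0"] 0 assms(3) by auto
  then show ?case by (intro exI[of _ "\<lambda>_. Q"]) auto
next
  case (Suc k)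
  obtain P' where P': "\<forall>i\<le>k. prime_in (P' i) \<and> contract (P' i) = P i" "I \<subseteq> P' 0" "\<forall>i<k. P' i \<subset> P' (Suc i)"
    using Suc.IH Suc.prems by auto
  have "contract (P' k) \<subseteq> P (Suc k)" using P'(1) Suc.prems(2) by auto
  then obtain Q where Q: "prime_in Q" "P' k \<subseteq> Q" "contract Q = P (Suc k)"
    using lying_over[of "P' k" "P (Suc k)"] P'(1) Suc.prems(1) prime_in_ideal by auto
  \<comment> \<open>Strict inclusions come for free, since primes with different contractions
    differ.\<close>
  have "P' k \<noteq> Q" using Q(3) P'(1) Suc.prems(2) by auto
  then show ?case
    using P' Q by (intro exI[of _ "P'(Suc k := Q)"]) (auto simp: le_Suc_eq less_Suc_eq)
qed

text \<open>For a in Q but not in P, the norm of a lies in Q, hence in P, so the conjugate c lies in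
  P. Then the trace a + c lies in Q, hence in P, and so does a.\<close>

lemma incomparable:
  assumes P: "prime_in P" and Q: "prime_in Q" and "P \<subseteq> Q" and sub: "contract Q \<subseteq> contract P"
  shows "P = Q"
proof (rule ccontr)
  assume "P \<noteq> Q"
  then obtain a where a: "a \<in> Q" "a \<notin> P" using assms(3) by auto
  have down: "\<phi> b \<in> P" if "b \<in> A" "\<phi> b \<in> Q" for b using that sub by (auto simp: contract_def)
  note idQ = prime_in_ideal[OF Q] and idP = prime_in_ideal[OF P]
  have aA: "a \<in> A" using a(1) ideal_in_sub[OF idQ] by auto
  obtain t n c where 2: "t \<in> A" "n \<in> A" "c \<in> A" "a + c = \<phi> t" "a * c = \<phi> n"
    using quadratic[OF aA] by blast
  have "a * c \<in> Q" using ideal_in_mult2[OF idQ 2(3) a(1)] .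
  then have "a * c \<in> P" using down[OF 2(2)] 2(5) by simp
  then have c: "c \<in> P" using prime_in_mult[OF P aA 2(3)] a by auto
  then have "a + c \<in> Q" using ideal_in_add[OF idQ a(1)] assms(3) by auto
  then have "a + c \<in> P" using down[OF 2(1)] 2(4) by simp
  then show False using ideal_in_diff[OF idP _ c, of "a + c"] a by simp
qed

text \<open>The localization of the contracted ring at q embeds into that of A/I at Q, although the
  denominators outside Q are more than the images of those outside q. The assumption
  \<open>EI\<close> says that \<open>E\<close> descends to a splitting of A/contract I into
  A/I.\<close>

lemma sat_contract:
  assumes Q: "prime_in Q" and EI: "\<And>a. a \<in> I \<Longrightarrow> \<phi> (E a) \<in> I" and I: "ideal_in I" and f: "f \<in> A"
  shows "f \<in> sat (contract Q) (contract I) \<longleftrightarrow> \<phi> f \<in> sat Q I"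
proof
  assume "f \<in> sat (contract Q) (contract I)"
  then obtain s where "s \<in> A - contract Q" "s * f \<in> contract I" by (auto elim!: satE)
  then show "\<phi> f \<in> sat Q I" using f by (intro satI[of _ "\<phi> s"]) (auto simp: contract_def phi_mult)
next
  assume "\<phi> f \<in> sat Q I"
  then obtain u where u: "u \<in> A - Q" "u * \<phi> f \<in> I" by (auto elim!: satE)
  have uA: "u \<in> A" using u(1) by simp
  obtain b c where bc: "b \<in> A" "c \<in> A" "u = \<phi> b + x * \<phi> c" using decompose[OF uA] by auto
  have E: "E (v * \<phi> f) = E v * f" if "v \<in> A" for v
    using E_phi_mult[OF f that] by (simp add: mult.commute)
  have in_contract: "E v * f \<in> contract I" if "v \<in> A" "v * \<phi> f \<in> I" for v
    using EI[OF that(2)] that f by (simp add: E contract_def)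
  have Eu: "E u = b" using bc by (simp add: E_add E_phi mult.commute[of x] E_phi_mult E_x)
  have "x * u = x * \<phi> b + \<phi> (x * c)" using bc by (simp add: phi_mult phi_x algebra_simps)
  then have Exu: "E (x * u) = x * c"
    using bc by (simp add: E_add E_phi mult.commute[of x "\<phi> b"] E_phi_mult E_x)
  \<comment> \<open>A denominator u outside Q yields two candidates in A, \<open>E u\<close> = b and
    \<open>E (x * u)\<close> = x c, both of which carry f into the contraction. They cannot both lie
    in the contraction of Q: that would put \<phi> b and x \<phi> c, and therefore u, into
    Q.\<close>
  have *: "b \<notin> contract Q \<or> x * c \<notin> contract Q"
  proof (rule ccontr)
    assume "\<not> ?thesis"
    then have b: "\<phi> b \<in> Q" and "x * (x * \<phi> c) \<in> Q"
      using bc by (auto simp: contract_def phi_mult phi_x mult.assoc)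
    then have "x * \<phi> c \<in> Q"
      using prime_in_mult[OF Q, of x "x * \<phi> c"] bc ideal_in_mult2[OF prime_in_ideal[OF Q], of "\<phi> c" x] by auto
    then have "u \<in> Q" unfolding bc(3) using ideal_in_add[OF prime_in_ideal[OF Q] b] by blast
    then show False using u(1) by simp
  qed
  have "x * u * \<phi> f \<in> I" using ideal_in_mult[OF I x_in u(2)] by (simp add: mult.assoc)
  then have "x * c * f \<in> contract I" using in_contract[of "x * u"] uA Exu by simp
  moreover have "b * f \<in> contract I" using in_contract[OF uA u(2)] Eu by simp
  ultimately show "f \<in> sat (contract Q) (contract I)"
    using * bc(1,2) f by (auto intro: satI[of _ b] satI[of _ "x * c"])
qed

text \<open>Applying \<open>E\<close> to \<phi> f = i + \<phi> y a gives f = E i + y E a, and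
  \<open>EI\<close> puts E i into the contraction. This is the purity of a direct summand: no new
  elements appear modulo y.\<close>

lemma contract_plus_principal:
  assumes I: "ideal_in I" and EI: "\<And>a. a \<in> I \<Longrightarrow> \<phi> (E a) \<in> I" and y: "y \<in> A"
  shows "contract (plus_principal I (\<phi> y)) = plus_principal (contract I) y"
proof
  show "contract (plus_principal I (\<phi> y)) \<subseteq> plus_principal (contract I) y"
  proof
    fix f assume "f \<in> contract (plus_principal I (\<phi> y))"
    then obtain i a where 1: "f \<in> A" "i \<in> I" "a \<in> A" "\<phi> f = i + \<phi> y * a"
      by (auto simp: contract_def elim!: plus_principalE)
    have iA: "i \<in> A" using ideal_in_sub[OF I] 1 by auto
    have "f = E (\<phi> f)" using 1(1) E_phi by simp
    also have "\<dots> = E i + y * E a" unfolding 1(4) using 1(3) iA y by (simp add: E_add E_phi_mult)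
    finally have "f = E i + y * E a" .
    moreover have "E i \<in> contract I" using EI 1 iA by (simp add: contract_def)
    ultimately show "f \<in> plus_principal (contract I) y" using 1 plus_principalI by simp
  qed
  show "plus_principal (contract I) y \<subseteq> contract (plus_principal I (\<phi> y))"
  proof
    fix f assume "f \<in> plus_principal (contract I) y"
    then obtain k a where 1: "k \<in> contract I" "a \<in> A" "f = k + y * a" by (auto elim!: plus_principalE)
    then show "f \<in> contract (plus_principal I (\<phi> y))"
      using y plus_principalI[of "\<phi> k" I "\<phi> a" "\<phi> y"] by (auto simp: contract_def phi_add phi_mult)
  qed
qed

text \<open>The first element upstairs is replaced by the image of some y in q; the step then
  repeats modulo \<phi> y because the splitting is linear over the image of \<phi> and so
  survives.\<close>

lemma depth_ge_contract:
  assumes Q: "prime_in Q"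
    and "ideal_in I" "\<And>a. a \<in> I \<Longrightarrow> \<phi> (E a) \<in> I" "depth_ge t Q I"
  shows "depth_ge t (contract Q) (contract I)"
  using assms(2-)
proof (induction t arbitrary: I)
  case 0 show ?case by simp
next
  case (Suc t)
  note I = Suc.prems(1) and EI = Suc.prems(2)
  let ?q = "contract Q"
  have q: "prime_in ?q" using contract_prime[OF Q] .
  note idq = prime_in_ideal[OF q]
  have qA: "?q \<subseteq> A" by (auto simp: contract_def)
  obtain z where z: "z \<in> Q" "regular_at Q I z" using Suc.prems by auto
  have "\<exists>w\<in>\<phi> ` ?q. \<forall>K\<in>{I}. regular_at Q K w"
  proof (rule exists_regular[OF Q])
    show "\<phi> ` ?q \<noteq> {}" using ideal_in_zero[OF idq] by auto
    show "\<phi> ` ?q \<subseteq> A" using qA by auto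
    show "a + b \<in> \<phi> ` ?q" if ab: "a \<in> \<phi> ` ?q" "b \<in> \<phi> ` ?q" for a b
    proof -
      obtain a' b' where "a' \<in> ?q" "b' \<in> ?q" "a = \<phi> a'" "b = \<phi> b'" using ab by auto
      moreover from this have "a' \<in> A" "b' \<in> A" using qA by auto
      ultimately have "a + b = \<phi> (a' + b')" "a' + b' \<in> ?q" using phi_add[of a' b'] ideal_in_add[OF idq, of a' b'] by auto
      then show ?thesis by simp
    qed
    show "a * b \<in> \<phi> ` ?q" if ab: "a \<in> \<phi> ` ?q" "b \<in> \<phi> ` ?q" for a b
    proof -
      obtain a' b' where "a' \<in> ?q" "b' \<in> ?q" "a = \<phi> a'" "b = \<phi> b'" using ab by auto
      moreover from this have "a' \<in> A" "b' \<in> A" using qA by auto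
      ultimately have "a * b = \<phi> (a' * b')" "a' * b' \<in> ?q"
        using phi_mult[of a' b'] ideal_in_mult[OF idq, of a' b'] by auto
      then show ?thesis by simp
    qed
    fix K f assume "K \<in> {I}" and f: "f \<in> A - sat Q K" and pr: "prime_in (colon (sat Q K) f)"
    then have K: "K = I" by simp
    let ?P = "colon (sat Q I) f"
    have "?P \<subseteq> Q" using f sat_cancel[OF Q] by (auto simp: colon_def K)
    moreover have "contract Q \<subseteq> contract ?P" if "\<phi> ` ?q \<subseteq> ?P"
      using that by (auto simp: contract_def)
    \<comment> \<open>The given regular z in Q cannot annihilate f. By incomparability an
      annihilator containing the whole image of q would have to be Q.\<close>
    moreover have "?P \<noteq> Q"
      using z f regular_atD[OF z(2), of f] by (auto simp: colon_def K)
    ultimately show "\<not> \<phi> ` ?q \<subseteq> colon (sat Q K) f"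
      using incomparable[OF pr[unfolded K] Q] by (auto simp: K)
  qed (use I in auto)
  then obtain y where y: "y \<in> ?q" "regular_at Q I (\<phi> y)" by auto
  have yA: "y \<in> A" and yQ: "\<phi> y \<in> Q" using y by (auto simp: contract_def)
  let ?I = "plus_principal I (\<phi> y)"
  have I': "ideal_in ?I" using plus_principal_ideal[OF I] yA by simp
  \<comment> \<open>The splitting hypothesis has to be carried through the induction; it persists
    only because the new generator lies in the image of \<phi>.\<close>
  have EI': "\<phi> (E a) \<in> ?I" if a: "a \<in> ?I" for a
  proof -
    obtain i c where 1: "i \<in> I" "c \<in> A" "a = i + \<phi> y * c" using a by (auto elim!: plus_principalE)
    have iA: "i \<in> A" using ideal_in_sub[OF I] 1 by auto
    have "\<phi> (E a) = \<phi> (E i) + \<phi> y * \<phi> (E c)"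
      using 1 iA yA by (simp add: E_add E_phi_mult phi_add phi_mult)
    then show ?thesis using EI 1 plus_principalI by simp
  qed
  have "depth_ge t Q ?I" using depth_ge_Suc_plus_principal[OF Q I yQ y(2) Suc.prems(3)] .
  then have "depth_ge t ?q (contract ?I)" using Suc.IH[OF I' EI'] by simp
  then have "depth_ge t ?q (plus_principal (contract I) y)"
    using contract_plus_principal[OF I EI yA] by simp
  moreover have "regular_at ?q (contract I) y"
    unfolding regular_at_def
  proof safe
    fix f assume f: "f \<in> A" "y * f \<in> sat ?q (contract I)"
    then have "\<phi> y * \<phi> f \<in> sat Q I" using sat_contract[OF Q EI I, of "y * f"] yA by (simp add: phi_mult)
    then have "\<phi> f \<in> sat Q I" using regular_atD[OF y(2)] f by simp
    then show "f \<in> sat ?q (contract I)" using sat_contract[OF Q EI I f(1)] by simp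
  qed
  ultimately show ?case using y(1) by auto
qed

text \<open>A chain of length k below q lifts to one of length k below some Q over q, so the
  hypothesis at Q gives at least the depth demanded at q. One such Q suffices.\<close>

lemma serre_in_contract:
  assumes I: "ideal_in I" and EI: "\<And>a. a \<in> I \<Longrightarrow> \<phi> (E a) \<in> I" and S: "serre_in l j I"
  shows "serre_in l j (contract I)"
  unfolding serre_in_def
proof (intro allI impI)
  fix q k P assume q: "prime_in q" and ch: "prime_chain (contract I) k P q"
  obtain P' where P': "\<forall>i\<le>k. prime_in (P' i) \<and> contract (P' i) = P i" "I \<subseteq> P' 0" "\<forall>i<k. P' i \<subset> P' (Suc i)"
    using going_up[OF I, of k P] ch by (auto simp: prime_chain_def)
  have "contract (P' k) \<subseteq> q" using P'(1) ch by (auto simp: prime_chain_def)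
  then obtain Q where Q: "prime_in Q" "P' k \<subseteq> Q" "contract Q = q"
    using lying_over[OF _ q, of "P' k"] P'(1) prime_in_ideal by auto
  have "prime_chain I k P' Q" using P' Q by (auto simp: prime_chain_def)
  then have "depth_ge (min l (k - j)) Q I" using S Q(1) by (auto simp: serre_in_def)
  then show "depth_ge (min l (k - j)) q (contract I)" using depth_ge_contract[OF Q(1) I EI] Q(3) by simp
qed

end


section \<open>Polynomial rings are Noetherian\<close>

context subring_in
begin

text \<open>Expressions in X of degree less than d. X is an element of the ambient ring, so an
  element of \<open>adjoin X\<close> may have several such expressions.\<close>

primrec polys_below :: "'a \<Rightarrow> nat \<Rightarrow> 'a set" where
  "polys_below X 0 = {0}"
| "polys_below X (Suc d) = {c * X ^ d + g | c g. c \<in> A \<and> g \<in> polys_below X d}"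

definition adjoin :: "'a \<Rightarrow> 'a set" where
  "adjoin X = (\<Union>d. polys_below X d)"

lemma polys_below_SucI: "c \<in> A \<Longrightarrow> g \<in> polys_below X d \<Longrightarrow> c * X ^ d + g \<in> polys_below X (Suc d)"
  by auto

lemma polys_below_SucE:
  assumes "f \<in> polys_below X (Suc d)"
  obtains c g where "c \<in> A" "g \<in> polys_below X d" "f = c * X ^ d + g"
  using assms by auto

lemma polys_below_zero: "0 \<in> polys_below X d"
  by (induction d) (auto intro: exI[of _ 0])

lemma polys_below_Suc: "polys_below X d \<subseteq> polys_below X (Suc d)"
  using polys_below_SucI[of 0 _ X d] by auto

lemma polys_below_mono: "d \<le> e \<Longrightarrow> polys_below X d \<subseteq> polys_below X e"
  using lift_Suc_mono_le[of "polys_below X"] polys_below_Suc by blast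

lemma polys_below_add: "f \<in> polys_below X d \<Longrightarrow> g \<in> polys_below X d \<Longrightarrow> f + g \<in> polys_below X d"
proof (induction d arbitrary: f g)
  case (Suc d)
  obtain c f' where f: "c \<in> A" "f' \<in> polys_below X d" "f = c * X ^ d + f'"
    using Suc.prems(1) by (rule polys_below_SucE)
  obtain c' g' where g: "c' \<in> A" "g' \<in> polys_below X d" "g = c' * X ^ d + g'"
    using Suc.prems(2) by (rule polys_below_SucE)
  have "f + g = (c + c') * X ^ d + (f' + g')" using f g by (simp add: algebra_simps)
  then show ?case using polys_below_SucI[OF add_in[OF f(1) g(1)] Suc.IH[OF f(2) g(2)]] by metis
qed simp

lemma polys_below_scale: "a \<in> A \<Longrightarrow> f \<in> polys_below X d \<Longrightarrow> a * f \<in> polys_below X d"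
proof (induction d arbitrary: f)
  case (Suc d)
  obtain c f' where f: "c \<in> A" "f' \<in> polys_below X d" "f = c * X ^ d + f'"
    using Suc.prems(2) by (rule polys_below_SucE)
  have "a * f = (a * c) * X ^ d + a * f'" using f by (simp add: algebra_simps)
  then show ?case
    using polys_below_SucI[OF mult_in[OF Suc.prems(1) f(1)] Suc.IH[OF Suc.prems(1) f(2)]] by metis
qed simp

lemma polys_below_times: "f \<in> polys_below X d \<Longrightarrow> X * f \<in> polys_below X (Suc d)"
proof (induction d arbitrary: f)
  case 0 then show ?case using polys_below_zero[of X 1] by simp
next
  case (Suc d)
  obtain c f' where f: "c \<in> A" "f' \<in> polys_below X d" "f = c * X ^ d + f'"
    using Suc.prems by (rule polys_below_SucE)
  have "X * f = c * X ^ Suc d + X * f'" using f by (simp add: algebra_simps)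
  then show ?case using polys_below_SucI[OF f(1) Suc.IH[OF f(2)]] by metis
qed

lemma polys_below_times_power: "f \<in> polys_below X d \<Longrightarrow> X ^ k * f \<in> polys_below X (k + d)"
  using polys_below_times[of "X ^ k' * f" X "k' + d" for k'] by (induction k) (auto simp: mult.assoc)

lemma adjoin_add: "f \<in> adjoin X \<Longrightarrow> g \<in> adjoin X \<Longrightarrow> f + g \<in> adjoin X"
proof -
  assume "f \<in> adjoin X" "g \<in> adjoin X"
  then obtain d e where "f \<in> polys_below X d" "g \<in> polys_below X e" by (auto simp: adjoin_def)
  then have "f \<in> polys_below X (max d e)" "g \<in> polys_below X (max d e)"
    using polys_below_mono[of d "max d e" X] polys_below_mono[of e "max d e" X] by auto
  then have "f + g \<in> polys_below X (max d e)" by (rule polys_below_add)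
  then show ?thesis unfolding adjoin_def by blast
qed

lemma adjoin_mult:
  assumes "g \<in> adjoin X" "f \<in> polys_below X d"
  shows "f * g \<in> adjoin X"
  using assms(2)
proof (induction d arbitrary: f)
  case 0 then show ?case by (auto simp: adjoin_def intro: polys_below_zero)
next
  case (Suc d)
  obtain e where e: "g \<in> polys_below X e" using assms(1) by (auto simp: adjoin_def)
  obtain c f' where f: "c \<in> A" "f' \<in> polys_below X d" "f = c * X ^ d + f'"
    using Suc.prems by (rule polys_below_SucE)
  have "X ^ d * (c * g) \<in> adjoin X"
    using polys_below_times_power[OF polys_below_scale[OF f(1) e], of d] unfolding adjoin_def by blast
  then have "X ^ d * (c * g) + f' * g \<in> adjoin X" using adjoin_add Suc.IH[OF f(2)] by blast
  then show ?case using f(3) by (simp add: algebra_simps)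
qed

lemma adjoin_base: "a \<in> A \<Longrightarrow> a \<in> adjoin X"
  using polys_below_SucI[of a 0 X 0] unfolding adjoin_def by (auto intro!: exI[of _ "1::nat"])

lemma adjoin_power: "a \<in> A \<Longrightarrow> a * X ^ d \<in> adjoin X"
  using polys_below_SucI[OF _ polys_below_zero[of X d], of a] unfolding adjoin_def
  by (metis UN_I UNIV_I add.right_neutral)

lemma adjoin_subring: "subring_in (adjoin X)"
proof
  show "0 \<in> adjoin X" "1 \<in> adjoin X" by (auto intro: adjoin_base)
  show "a + b \<in> adjoin X" if "a \<in> adjoin X" "b \<in> adjoin X" for a b using that adjoin_add by blast
  show mult: "a * b \<in> adjoin X" if "a \<in> adjoin X" "b \<in> adjoin X" for a b
    using that adjoin_mult unfolding adjoin_def by blast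
  show "- a \<in> adjoin X" if "a \<in> adjoin X" for a
    using mult[of "- 1" a] that adjoin_base[of "- 1"] by simp
qed

end

context noetherian_in
begin

lemma chain_stabilizes:
  assumes "\<And>i. ideal_in (G i)" "\<And>i j. i \<le> j \<Longrightarrow> G i \<subseteq> G j"
  shows "\<exists>N::nat. \<forall>i\<ge>N. G i = G N"
proof -
  have "\<exists>N\<in>UNIV. \<forall>i\<in>UNIV. G N \<subseteq> G i \<longrightarrow> G i = G N"
    by (rule noetherian_image) (use assms in auto)
  then obtain N where "\<forall>i. G N \<subseteq> G i \<longrightarrow> G i = G N" by (elim bexE) simp
  then have "\<forall>i\<ge>N. G i = G N" by (intro allI impI) (simp add: assms(2))
  then show ?thesis ..
qed

text \<open>A maximal member at (d0, i0) settles all degrees from d0 on; the finitely many smaller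
  degrees stabilize one by one. A bound uniform in d is required, since comparing two ideals uses
  their leading coefficients in all degrees at once.\<close>

lemma double_chain_stabilizes:
  assumes id: "\<And>d i. ideal_in (G d i)" and mono: "\<And>d e i j. d \<le> e \<Longrightarrow> i \<le> j \<Longrightarrow> G d i \<subseteq> G e j"
  shows "\<exists>N::nat. \<forall>i\<ge>N. \<forall>d::nat. G d i = G d N"
proof -
  let ?H = "\<lambda>p. G (fst p) (snd p)"
  have "\<exists>p\<in>UNIV. \<forall>r\<in>UNIV. ?H p \<subseteq> ?H r \<longrightarrow> ?H r = ?H p"
    by (rule noetherian_image) (use id in auto)
  then obtain d0 i0 where "\<forall>r. G d0 i0 \<subseteq> ?H r \<longrightarrow> ?H r = G d0 i0" by auto
  then have "G d0 i0 \<subseteq> G d i \<longrightarrow> G d i = G d0 i0" for d i by (metis fst_conv snd_conv)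
  then have *: "G d i = G d0 i0" if "d \<ge> d0" "i \<ge> i0" for d i using mono[OF that] by blast
  have "\<exists>M. \<forall>i\<ge>M. G d i = G d M" for d
    by (rule chain_stabilizes) (use id mono in auto)
  then have "\<forall>d. \<exists>M. \<forall>i\<ge>M. G d i = G d M" ..
  from choice[OF this] obtain M where M: "\<forall>d. \<forall>i\<ge>M d. G d i = G d (M d)" ..
  let ?N = "Max (insert i0 (M ` {..<d0}))"
  have N: "i0 \<le> ?N" "d < d0 \<Longrightarrow> M d \<le> ?N" for d by auto
  have "G d i = G d ?N" if "i \<ge> ?N" for i d
  proof (cases "d < d0")
    case True
    then have Md: "M d \<le> ?N" by (rule N(2))
    then have "M d \<le> i" using that by (rule le_trans)
    then show ?thesis
      by (rule trans[OF M[rule_format] M[rule_format, OF Md, symmetric]])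
  next
    case False
    then have d: "d0 \<le> d" by simp
    show ?thesis by (rule trans[OF *[OF d le_trans[OF N(1) that]] *[OF d N(1), symmetric]])
  qed
  then show ?thesis by blast
qed

text \<open>Hilbert's basis theorem, by comparing the ideals of leading coefficients in each degree.\<close>

lemma noetherian_adjoin: "noetherian_in (adjoin X)"
proof -
  interpret B: subring_in "adjoin X" by (rule adjoin_subring)
  \<comment> \<open>Coefficients of X ^ d in elements of K of degree at most d. As expressions are
    not unique, a coefficient counts as soon as one expression carries it.\<close>
  define L where "L d K = {c \<in> A. \<exists>g\<in>polys_below X d. c * X ^ d + g \<in> K}" for d K
  have L_ideal: "ideal_in (L d K)" if K: "B.ideal_in K" for d K
  proof (rule ideal_inI)
    show "L d K \<subseteq> A" by (auto simp: L_def)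
    have "0 * X ^ d + 0 \<in> K" using B.ideal_in_zero[OF K] by simp
    then show "0 \<in> L d K" using polys_below_zero[of X d] unfolding L_def by blast
  next
    fix a b assume "a \<in> L d K" "b \<in> L d K"
    then obtain f g where *: "a \<in> A" "b \<in> A" "f \<in> polys_below X d" "g \<in> polys_below X d"
      "a * X ^ d + f \<in> K" "b * X ^ d + g \<in> K" by (auto simp: L_def)
    have "(a + b) * X ^ d + (f + g) = (a * X ^ d + f) + (b * X ^ d + g)" by (simp add: algebra_simps)
    also have "\<dots> \<in> K" using * B.ideal_in_add[OF K] by blast
    finally show "a + b \<in> L d K" using * polys_below_add unfolding L_def by blast
  next
    fix r a assume r: "r \<in> A" and "a \<in> L d K"
    then obtain f where *: "a \<in> A" "f \<in> polys_below X d" "a * X ^ d + f \<in> K" by (auto simp: L_def)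
    have "r * a * X ^ d + r * f = r * (a * X ^ d + f)" by (simp add: algebra_simps)
    also have "\<dots> \<in> K" using * r B.ideal_in_mult[OF K] adjoin_base by blast
    finally show "r * a \<in> L d K" using r * polys_below_scale unfolding L_def by blast
  qed
  have L_Suc: "L d K \<subseteq> L (Suc d) K" if K: "B.ideal_in K" for d K
  proof
    fix a assume "a \<in> L d K"
    then obtain f where *: "a \<in> A" "f \<in> polys_below X d" "a * X ^ d + f \<in> K" by (auto simp: L_def)
    have "a * X ^ Suc d + X * f = X * (a * X ^ d + f)" by (simp add: algebra_simps)
    also have "\<dots> \<in> K" using * B.ideal_in_mult[OF K] adjoin_power[of 1 X 1] by simp
    finally show "a \<in> L (Suc d) K" using * polys_below_times unfolding L_def by blast
  qed
  have L_mono: "L d K \<subseteq> L e K'" if "B.ideal_in K" "K \<subseteq> K'" "d \<le> e" for d e K K'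
  proof -
    have "L d K \<subseteq> L e K"
      using lift_Suc_mono_le[of "\<lambda>d. L d K"] L_Suc[OF that(1)] that(3) by blast
    then show ?thesis using that(2) unfolding L_def by blast
  qed
  \<comment> \<open>Subtracting from an element of K' an element of K with the same top coefficient
    lowers the degree, so induction on the degree applies.\<close>
  have L_eq: "K' \<subseteq> K" if K: "B.ideal_in K" "B.ideal_in K'" and sub: "K \<subseteq> K'" and L: "\<And>d. L d K' = L d K" for K K'
  proof -
    have "f \<in> K" if "f \<in> polys_below X d" "f \<in> K'" for d f
      using that
    proof (induction d arbitrary: f)
      case 0 then show ?case using B.ideal_in_zero[OF K(1)] by simp
    next
      case (Suc d)
      obtain c g where f: "c \<in> A" "g \<in> polys_below X d" "f = c * X ^ d + g"
        using Suc.prems(1) by (rule polys_below_SucE)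
      have "c \<in> L d K'" using f Suc.prems(2) unfolding L_def by blast
      then obtain h where h: "h \<in> polys_below X d" "c * X ^ d + h \<in> K" using L unfolding L_def by blast
      have "(c * X ^ d + g) - (c * X ^ d + h) \<in> K'"
        using B.ideal_in_diff[OF K(2)] Suc.prems(2) h(2) sub f(3) by blast
      then have "g + - 1 * h \<in> K'" by simp
      moreover have "g + - 1 * h \<in> polys_below X d"
        using polys_below_add[OF f(2) polys_below_scale[OF _ h(1), of "- 1"]] by simp
      ultimately have "g + - 1 * h \<in> K" by (intro Suc.IH)
      then have "(c * X ^ d + h) + (g + - 1 * h) \<in> K" using B.ideal_in_add[OF K(1) h(2)] by blast
      then show ?case using f(3) by (simp add: algebra_simps)
    qed
    then show ?thesis using B.ideal_in_sub[OF K(2)] unfolding adjoin_def by blast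
  qed
  show ?thesis
  proof
    fix F assume F: "F \<noteq> {}" "\<And>K. K \<in> F \<Longrightarrow> B.ideal_in K"
    show "\<exists>M\<in>F. \<forall>K\<in>F. M \<subseteq> K \<longrightarrow> K = M"
    proof (rule ccontr)
      assume no: "\<not> ?thesis"
      have "\<exists>K. \<forall>n. K n \<in> F \<and> K n \<subset> K (Suc n)"
        by (rule dependent_nat_choice) (use F(1) no in auto)
      then obtain K where "\<forall>n. K n \<in> F \<and> K n \<subset> K (Suc n)" ..
      then have K: "K n \<in> F" "K n \<subset> K (Suc n)" for n by blast+
      have Kid: "B.ideal_in (K n)" for n using F(2)[OF K(1)] .
      have "K n \<subseteq> K (Suc n)" for n using K(2)[of n] by blast
      then have Kmono: "n \<le> m \<Longrightarrow> K n \<subseteq> K m" for n m using lift_Suc_mono_le[of K] by blast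
      have "\<exists>N. \<forall>i\<ge>N. \<forall>d. L d (K i) = L d (K N)"
        by (rule double_chain_stabilizes) (intro L_ideal Kid L_mono Kmono; assumption)+
      then obtain N where N: "\<forall>i\<ge>N. \<forall>d. L d (K i) = L d (K N)" ..
      have "K (Suc N) \<subseteq> K N"
        by (rule L_eq[OF Kid Kid Kmono N[rule_format]]) simp_all
      then show False using K(2)[of N] by blast
    qed
  qed
qed

end

section \<open>Polynomials in finitely many variables\<close>

abbreviation polys :: "nat \<Rightarrow> ((nat \<Rightarrow>\<^sub>0 nat) \<Rightarrow>\<^sub>0 'k::field) set" where
  "polys n \<equiv> carrier (poly_ring n)"

lemma polys_iff: "f \<in> polys n \<longleftrightarrow> Poly_Mapping.keys f \<subseteq> exponents n"
  by (simp add: poly_ring_def)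

lemma single_in_polys: "m \<in> exponents n \<Longrightarrow> Poly_Mapping.single m c \<in> polys n"
  by (simp add: polys_iff)

lemma exponents_zero: "0 \<in> exponents n"
  by (simp add: exponents_def)

lemma exponents_add: "a \<in> exponents n \<Longrightarrow> b \<in> exponents n \<Longrightarrow> a + b \<in> exponents n"
  using keys_add[of a b] by (auto simp: exponents_def)

lemma polys_subring: "subring_in (polys n :: ((nat \<Rightarrow>\<^sub>0 nat) \<Rightarrow>\<^sub>0 'k::field) set)"
proof
  fix a b :: "(nat \<Rightarrow>\<^sub>0 nat) \<Rightarrow>\<^sub>0 'k"
  assume a: "a \<in> polys n"
  then show "- a \<in> polys n" by (auto simp: polys_iff in_keys_iff)
  assume b: "b \<in> polys n"
  show "a + b \<in> polys n" using keys_add[of a b] a b by (auto simp: polys_iff)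
  show "a * b \<in> polys n" using keys_mult[of a b] a b exponents_add by (fastforce simp: polys_iff)
qed (auto simp: polys_iff exponents_zero)

lemma sum_single: "(\<Sum>k\<in>Poly_Mapping.keys f. Poly_Mapping.single k (Poly_Mapping.lookup f k)) = f"
  by (rule poly_mapping_eqI) (simp add: lookup_sum lookup_single when_def in_keys_iff)

lemma polys_induct [consumes 1, case_names zero single_add]:
  assumes "f \<in> polys n" "P 0"
    and "\<And>m c f. m \<in> exponents n \<Longrightarrow> f \<in> polys n \<Longrightarrow> P f \<Longrightarrow> P (Poly_Mapping.single m c + f)"
  shows "P f"
proof -
  interpret subring_in "polys n :: ((nat \<Rightarrow>\<^sub>0 nat) \<Rightarrow>\<^sub>0 'a) set" by (rule polys_subring)
  let ?s = "\<lambda>F. \<Sum>k\<in>F. Poly_Mapping.single k (Poly_Mapping.lookup f k)"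
  have "?s F \<in> polys n \<and> P (?s F)" if "finite F" "F \<subseteq> Poly_Mapping.keys f" for F
    using that
  proof (induction F)
    case (insert k F)
    then have k: "k \<in> exponents n" using assms(1) by (auto simp: polys_iff)
    then show ?case
      using insert assms(3)[OF k, of "?s F" "Poly_Mapping.lookup f k"] single_in_polys[OF k] by auto
  qed (use assms(2) in auto)
  from this[of "Poly_Mapping.keys f"] show ?thesis by (simp add: sum_single)
qed

lemma single_power: "Poly_Mapping.single (Poly_Mapping.single i e) (1::'k::field) ^ d =
    Poly_Mapping.single (Poly_Mapping.single i (d * e)) 1"
  for e :: nat
  by (induction d) (simp_all add: mult_single single_add[symmetric] algebra_simps)

lemma polys_Suc:
  "polys (Suc n) = subring_in.adjoin (polys n)
     (Poly_Mapping.single (Poly_Mapping.single n 1) (1::'k::field))" (is "_ = subring_in.adjoin _ ?X")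
proof -
  interpret S: subring_in "polys n :: ((nat \<Rightarrow>\<^sub>0 nat) \<Rightarrow>\<^sub>0 'k) set" by (rule polys_subring)
  interpret T: subring_in "polys (Suc n) :: ((nat \<Rightarrow>\<^sub>0 nat) \<Rightarrow>\<^sub>0 'k) set" by (rule polys_subring)
  interpret R: subring_in "S.adjoin ?X" by (rule S.adjoin_subring)
  show ?thesis
  proof
    show "polys (Suc n) \<subseteq> S.adjoin ?X"
    proof
      fix f :: "(nat \<Rightarrow>\<^sub>0 nat) \<Rightarrow>\<^sub>0 'k" assume "f \<in> polys (Suc n)"
      then show "f \<in> S.adjoin ?X"
      proof (induction rule: polys_induct)
        case (single_add m c f)
        define m' where "m' = Poly_Mapping.update n 0 m"
        have m': "m' \<in> exponents n"
          using single_add(1) by (auto simp: exponents_def m'_def keys_update less_Suc_eq)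
        have "m = m' + Poly_Mapping.single n (Poly_Mapping.lookup m n)"
          by (rule poly_mapping_eqI) (auto simp: m'_def lookup_add lookup_update lookup_single when_def)
        then have "Poly_Mapping.single m c = Poly_Mapping.single m' c * ?X ^ Poly_Mapping.lookup m n"
          by (simp add: single_power[of _ 1, simplified] mult_single)
        then show ?case
          using S.adjoin_power[OF single_in_polys[OF m']] single_add(3) R.add_in by metis
      qed (rule R.zero_in)
    qed
    have X: "?X \<in> polys (Suc n)" by (simp add: polys_iff exponents_def)
    have "polys n \<subseteq> (polys (Suc n) :: ((nat \<Rightarrow>\<^sub>0 nat) \<Rightarrow>\<^sub>0 'k) set)"
      by (force simp: polys_iff exponents_def)
    then have "f \<in> polys (Suc n)" if "f \<in> S.polys_below ?X d" for d f
      using that X by (induction d arbitrary: f) auto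
    then show "S.adjoin ?X \<subseteq> polys (Suc n)" by (auto simp: S.adjoin_def)
  qed
qed

text \<open>Without variables the ring consists of constants over a field and has only two ideals;
  each further variable is one adjunction.\<close>

lemma polys_noetherian: "noetherian_in (polys n :: ((nat \<Rightarrow>\<^sub>0 nat) \<Rightarrow>\<^sub>0 'k::field) set)"
proof (induction n)
  case 0
  interpret subring_in "polys 0 :: ((nat \<Rightarrow>\<^sub>0 nat) \<Rightarrow>\<^sub>0 'k) set" by (rule polys_subring)
  have "K = {0} \<or> K = polys 0" if K: "ideal_in K" for K
  proof (cases "K = {0}")
    case False
    then obtain f where f: "f \<in> K" "f \<noteq> 0" using ideal_in_zero[OF K] by blast
    have "exponents 0 = {0}" by (auto simp: exponents_def)
    then have "Poly_Mapping.keys f \<subseteq> {0}" using f(1) ideal_in_sub[OF K] polys_iff by blast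
    then have keys: "Poly_Mapping.keys f = {0}" using f(2) keys_eq_empty by (metis subset_singletonD)
    define v where "v = Poly_Mapping.lookup f 0"
    have fv: "f = Poly_Mapping.single 0 v" using sum_single[of f] keys by (simp add: v_def)
    then have "v \<noteq> 0" using f(2) by auto
    have "Poly_Mapping.single 0 (inverse v) * f \<in> K"
      by (intro ideal_in_mult[OF K] f single_in_polys exponents_zero)
    then have "1 \<in> K" using \<open>v \<noteq> 0\<close> by (simp add: fv mult_single)
    then have "a \<in> K" if "a \<in> polys 0" for a using ideal_in_mult[OF K that, of 1] by simp
    then show ?thesis using ideal_in_sub[OF K] by blast
  qed simp
  note dich = this
  show ?case
  proof
    fix F :: "((nat \<Rightarrow>\<^sub>0 nat) \<Rightarrow>\<^sub>0 'k) set set" assume F: "F \<noteq> {}" "\<And>K. K \<in> F \<Longrightarrow> ideal_in K"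
    show "\<exists>M\<in>F. \<forall>K\<in>F. M \<subseteq> K \<longrightarrow> K = M"
    proof (cases "polys 0 \<in> F")
      case True then show ?thesis using F(2) ideal_in_sub by blast
    next
      case False
      then have "K = {0}" if "K \<in> F" for K using dich[OF F(2)[OF that]] that by auto
      then show ?thesis using F(1) by blast
    qed
  qed
next
  case (Suc n)
  interpret noetherian_in "polys n :: ((nat \<Rightarrow>\<^sub>0 nat) \<Rightarrow>\<^sub>0 'k) set" by (rule Suc)
  show ?case unfolding polys_Suc by (rule noetherian_adjoin)
qed


section \<open>Squaring a variable\<close>

definition double_exponent :: "nat \<Rightarrow> (nat \<Rightarrow>\<^sub>0 nat) \<Rightarrow> (nat \<Rightarrow>\<^sub>0 nat)" where
  "double_exponent i m = m + Poly_Mapping.single i (Poly_Mapping.lookup m i)"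

definition square_var :: "nat \<Rightarrow> ((nat \<Rightarrow>\<^sub>0 nat) \<Rightarrow>\<^sub>0 'k::field) \<Rightarrow> ((nat \<Rightarrow>\<^sub>0 nat) \<Rightarrow>\<^sub>0 'k)" where
  "square_var i f = (\<Sum>k\<in>Poly_Mapping.keys f. Poly_Mapping.single (double_exponent i k) (Poly_Mapping.lookup f k))"

text \<open>Pull-back along \<open>double_exponent i\<close>, where \<open>square_var i\<close> is
  push-forward. It discards the terms of odd degree in x_i and halves the even ones, which is
  reading off the coefficient of 1 in the basis 1, x_i.\<close>

definition halve_var :: "nat \<Rightarrow> ((nat \<Rightarrow>\<^sub>0 nat) \<Rightarrow>\<^sub>0 'k::field) \<Rightarrow> ((nat \<Rightarrow>\<^sub>0 nat) \<Rightarrow>\<^sub>0 'k)" where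
  "halve_var i = Poly_Mapping.map_key (double_exponent i)"

definition var :: "nat \<Rightarrow> ((nat \<Rightarrow>\<^sub>0 nat) \<Rightarrow>\<^sub>0 'k::field)" where
  "var i = Poly_Mapping.single (Poly_Mapping.single i 1) 1"

lemma lookup_double_exponent:
  "Poly_Mapping.lookup (double_exponent i m) k = (if k = i then 2 else 1) * Poly_Mapping.lookup m k"
  by (simp add: double_exponent_def lookup_add lookup_single when_def)

lemma inj_double_exponent: "inj (double_exponent i)"
proof (rule injI, rule poly_mapping_eqI)
  fix a b k assume "double_exponent i a = double_exponent i b"
  then have "Poly_Mapping.lookup (double_exponent i a) k = Poly_Mapping.lookup (double_exponent i b) k" by simp
  then show "Poly_Mapping.lookup a k = Poly_Mapping.lookup b k"
    by (simp add: lookup_double_exponent split: if_splits)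
qed

lemma double_exponent_add: "double_exponent i (a + b) = double_exponent i a + double_exponent i b"
  by (rule poly_mapping_eqI) (simp add: lookup_double_exponent lookup_add algebra_simps)

lemma double_exponent_zero: "double_exponent i 0 = 0"
  by (simp add: double_exponent_def)

lemma keys_double_exponent: "Poly_Mapping.keys (double_exponent i m) = Poly_Mapping.keys m"
  by (auto simp: in_keys_iff lookup_double_exponent)

lemma double_exponent_in: "double_exponent i m \<in> exponents n \<longleftrightarrow> m \<in> exponents n"
  by (simp add: exponents_def keys_double_exponent)

text \<open>Division of the i-th entry by 2; the remainder decides between the basis elements 1 and
  x_i.\<close>

lemma exponent_parity:
  assumes "m \<in> exponents n"
  obtains m' where "m' \<in> exponents n" "m = double_exponent i m' \<or> m = double_exponent i m' + Poly_Mapping.single i 1"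
proof
  let ?m = "Poly_Mapping.update i (Poly_Mapping.lookup m i div 2) m"
  have "Poly_Mapping.keys ?m \<subseteq> Poly_Mapping.keys m"
    by (auto simp: in_keys_iff lookup_update split: if_splits)
  then show "?m \<in> exponents n" using assms unfolding exponents_def by blast
  show "m = double_exponent i ?m \<or> m = double_exponent i ?m + Poly_Mapping.single i 1"
  proof (cases "even (Poly_Mapping.lookup m i)")
    case True
    then have "m = double_exponent i ?m"
      by (intro poly_mapping_eqI) (auto simp: lookup_double_exponent lookup_update)
    then show ?thesis ..
  next
    case False
    then have "m = double_exponent i ?m + Poly_Mapping.single i 1"
      by (intro poly_mapping_eqI)
        (auto simp: lookup_double_exponent lookup_update lookup_add lookup_single when_def)
    then show ?thesis ..
  qed
qed

lemma square_var_single [simp]: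
  "square_var i (Poly_Mapping.single m c) = Poly_Mapping.single (double_exponent i m) c"
  by (simp add: square_var_def)

lemma square_var_add: "square_var i (f + g) = square_var i f + square_var i g"
  unfolding square_var_def by (rule setsum_keys_plus_distrib) (simp_all add: single_add)

lemma square_var_zero [simp]: "square_var i 0 = 0"
  by (simp add: square_var_def)

lemma keys_square_var: "Poly_Mapping.keys (square_var i f) \<subseteq> double_exponent i ` Poly_Mapping.keys f"
  unfolding square_var_def by (rule order_trans[OF keys_sum]) auto

lemma square_var_in: "f \<in> polys n \<Longrightarrow> square_var i f \<in> polys n"
  unfolding polys_iff using keys_square_var[of i f] double_exponent_in by blast

lemma square_var_mult:
  assumes "f \<in> polys n" "g \<in> polys n"
  shows "square_var i (f * g) = square_var i f * square_var i g"
proof -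
  have single: "square_var i (Poly_Mapping.single m c * g) = Poly_Mapping.single (double_exponent i m) c * square_var i g" for m c
    using assms(2)
    by (induction rule: polys_induct)
      (simp_all add: distrib_left square_var_add mult_single double_exponent_add)
  show ?thesis
    using assms(1) by (induction rule: polys_induct) (simp_all add: distrib_right square_var_add single)
qed

lemma lookup_halve_var: "Poly_Mapping.lookup (halve_var i f) k = Poly_Mapping.lookup f (double_exponent i k)"
  by (simp add: halve_var_def map_key.rep_eq inj_double_exponent)

lemma halve_var_add: "halve_var i (f + g) = halve_var i f + halve_var i g"
  by (simp add: halve_var_def map_key_plus inj_double_exponent)

lemma halve_var_zero [simp]: "halve_var i 0 = 0"
  by (rule poly_mapping_eqI) (simp add: lookup_halve_var)

lemma halve_var_double [simp]:
  "halve_var i (Poly_Mapping.single (double_exponent i m) c) = Poly_Mapping.single m c"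
  by (simp add: halve_var_def inj_double_exponent)

lemma halve_var_odd [simp]:
  "halve_var i (Poly_Mapping.single (double_exponent i m + Poly_Mapping.single i 1) c) = 0"
proof (rule poly_mapping_eqI)
  fix k
  have "double_exponent i m + Poly_Mapping.single i 1 \<noteq> double_exponent i k"
  proof
    assume "double_exponent i m + Poly_Mapping.single i 1 = double_exponent i k"
    then have "Poly_Mapping.lookup (double_exponent i m + Poly_Mapping.single i 1) i
      = Poly_Mapping.lookup (double_exponent i k) i" by simp
    then show False by (simp add: lookup_double_exponent lookup_add) presburger
  qed
  then show "Poly_Mapping.lookup (halve_var i (Poly_Mapping.single (double_exponent i m + Poly_Mapping.single i 1) c)) k
    = Poly_Mapping.lookup 0 k"
    by (simp add: lookup_halve_var lookup_single when_def)
qed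

lemma halve_var_in: "f \<in> polys n \<Longrightarrow> halve_var i f \<in> polys n"
  using double_exponent_in[of i _ n]
  by (auto simp: polys_iff subset_iff in_keys_iff lookup_halve_var)

text \<open>Linearity of the projection over the image of the substitution. Multiplying by a doubled
  exponent preserves the parity of the i-th entry, so discarded terms stay discarded.\<close>

lemma halve_var_square_var_mult:
  assumes "f \<in> polys n" "g \<in> polys n"
  shows "halve_var i (square_var i f * g) = f * halve_var i g"
proof -
  have single2: "halve_var i (Poly_Mapping.single (double_exponent i m) c * Poly_Mapping.single m' d)
      = Poly_Mapping.single m c * halve_var i (Poly_Mapping.single m' d)"
    if m': "m' \<in> exponents n" for m c m' d
  proof -
    obtain p where "m' = double_exponent i p \<or> m' = double_exponent i p + Poly_Mapping.single i 1"
      using exponent_parity[OF m'] by blast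
    then show ?thesis
    proof
      assume "m' = double_exponent i p"
      then show ?thesis by (simp add: mult_single double_exponent_add[symmetric])
    next
      assume m: "m' = double_exponent i p + Poly_Mapping.single i 1"
      show ?thesis
        unfolding m mult_single add.assoc[symmetric] double_exponent_add[symmetric] halve_var_odd by simp
    qed
  qed
  have single: "halve_var i (Poly_Mapping.single (double_exponent i m) c * g) = Poly_Mapping.single m c * halve_var i g" for m c
    using assms(2)
    by (induction rule: polys_induct) (simp_all add: distrib_left halve_var_add single2)
  show ?thesis
    using assms(1)
    by (induction rule: polys_induct) (simp_all add: distrib_right square_var_add halve_var_add single)
qed

lemma square_var_one: "square_var i 1 = 1"
  using square_var_single[of i 0 1] by (simp add: double_exponent_zero)

lemma halve_var_one: "halve_var i 1 = 1"
  using halve_var_double[of i 0 1] by (simp add: double_exponent_zero)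

lemma var_in: "i < n \<Longrightarrow> var i \<in> polys n"
  by (simp add: var_def polys_iff exponents_def)

lemma square_var_var: "square_var i (var i) = var i * var i"
  by (simp add: var_def mult_single double_exponent_def)

lemma halve_var_var: "halve_var i (var i) = 0"
  using halve_var_odd[of i 0 1] by (simp add: var_def double_exponent_zero)

lemma square_var_decompose:
  assumes "f \<in> polys n"
  shows "\<exists>b\<in>polys n. \<exists>c\<in>polys n. f = square_var i b + var i * square_var i c"
  using assms
proof (induction rule: polys_induct)
  case zero
  show ?case by (intro bexI[of _ 0]) (simp_all add: polys_iff)
next
  case (single_add m c f)
  interpret subring_in "polys n :: ((nat \<Rightarrow>\<^sub>0 nat) \<Rightarrow>\<^sub>0 'a) set" by (rule polys_subring)
  obtain b d where bd: "b \<in> polys n" "d \<in> polys n" "f = square_var i b + var i * square_var i d"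
    using single_add by blast
  obtain m' where m': "m' \<in> exponents n"
    "m = double_exponent i m' \<or> m = double_exponent i m' + Poly_Mapping.single i 1"
    using exponent_parity[OF single_add(1)] by blast
  let ?s = "Poly_Mapping.single m' c"
  from m'(2) show ?case
  proof
    assume m: "m = double_exponent i m'"
    show ?thesis
      by (intro bexI[of _ "?s + b"] bexI[of _ d] add_in single_in_polys m' bd)
        (simp add: m bd square_var_add)
  next
    assume m: "m = double_exponent i m' + Poly_Mapping.single i 1"
    show ?thesis
      by (intro bexI[of _ b] bexI[of _ "?s + d"] add_in single_in_polys m' bd)
        (simp add: m bd square_var_add var_def mult_single algebra_simps)
  qed
qed

lemma square_extension_polys:
  assumes "i < n"
  shows "square_extension (polys n :: ((nat \<Rightarrow>\<^sub>0 nat) \<Rightarrow>\<^sub>0 'k::field) set) (square_var i) (halve_var i) (var i)"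
proof (intro square_extension.intro polys_noetherian square_extension_axioms.intro)
qed (use assms in \<open>simp_all add: square_var_in halve_var_in var_in square_var_add square_var_mult
    square_var_one square_var_var halve_var_add halve_var_square_var_mult halve_var_one halve_var_var
    square_var_decompose\<close>)


section \<open>Passage between the ring record and the type class operations\<close>

lemma poly_ring_simps:
  "monoid.mult (poly_ring n) = (*)" "one (poly_ring n) = 1" "zero (poly_ring n) = 0" "add (poly_ring n) = (+)"
  by (simp_all add: poly_ring_def)

lemma poly_ring_cring: "cring (poly_ring n :: ((nat \<Rightarrow>\<^sub>0 nat) \<Rightarrow>\<^sub>0 'k::field) ring)"
proof -
  interpret subring_in "polys n :: ((nat \<Rightarrow>\<^sub>0 nat) \<Rightarrow>\<^sub>0 'k) set" by (rule polys_subring)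
  show ?thesis
  proof (rule cringI)
    show "abelian_group (poly_ring n :: ((nat \<Rightarrow>\<^sub>0 nat) \<Rightarrow>\<^sub>0 'k) ring)"
    proof (rule abelian_groupI)
      show "\<exists>y\<in>polys n. y \<oplus>\<^bsub>poly_ring n\<^esub> x = \<zero>\<^bsub>poly_ring n\<^esub>"
        if "x \<in> polys n" for x :: "(nat \<Rightarrow>\<^sub>0 nat) \<Rightarrow>\<^sub>0 'k"
        using that by (intro bexI[of _ "- x"]) (simp_all add: poly_ring_simps)
    qed (simp_all add: poly_ring_simps add_ac)
    show "comm_monoid (poly_ring n :: ((nat \<Rightarrow>\<^sub>0 nat) \<Rightarrow>\<^sub>0 'k) ring)"
      by (rule comm_monoidI) (simp_all add: poly_ring_simps mult_ac)
  qed (simp add: poly_ring_simps distrib_right)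
qed

lemma poly_ring_a_inv:
  assumes "a \<in> polys n" shows "\<ominus>\<^bsub>poly_ring n\<^esub> a = - a"
proof -
  interpret cring "poly_ring n :: ((nat \<Rightarrow>\<^sub>0 nat) \<Rightarrow>\<^sub>0 'a) ring" by (rule poly_ring_cring)
  interpret subring_in "polys n :: ((nat \<Rightarrow>\<^sub>0 nat) \<Rightarrow>\<^sub>0 'a) set" by (rule polys_subring)
  show ?thesis using minus_equality[of "- a" a] assms by (simp add: poly_ring_simps)
qed

lemma poly_ring_pow: "a [^]\<^bsub>poly_ring n\<^esub> (k::nat) = a ^ k"
  by (induction k) (simp_all add: poly_ring_simps nat_pow_def mult.commute)

abbreviation ideal_of :: "nat \<Rightarrow> ((nat \<Rightarrow>\<^sub>0 nat) \<Rightarrow>\<^sub>0 'k::field) set \<Rightarrow> bool" where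
  "ideal_of n \<equiv> subring_in.ideal_in (polys n)"

lemma ideal_poly_ring_iff: "ideal K (poly_ring n) \<longleftrightarrow> ideal_of n K"
proof -
  interpret S: subring_in "polys n :: ((nat \<Rightarrow>\<^sub>0 nat) \<Rightarrow>\<^sub>0 'a) set" by (rule polys_subring)
  interpret R: cring "poly_ring n :: ((nat \<Rightarrow>\<^sub>0 nat) \<Rightarrow>\<^sub>0 'a) ring" by (rule poly_ring_cring)
  show ?thesis
  proof
    assume "ideal K (poly_ring n)"
    then interpret I: ideal K "poly_ring n" .
    show "S.ideal_in K"
    proof (rule S.ideal_inI)
      show "K \<subseteq> polys n" using I.a_subset .
      show "0 \<in> K" using I.zero_closed by (simp add: poly_ring_simps)
      show "a + b \<in> K" if "a \<in> K" "b \<in> K" for a b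
        using I.a_closed[OF that] by (simp add: poly_ring_simps)
      show "r * a \<in> K" if "r \<in> polys n" "a \<in> K" for r a
        using I.I_l_closed[OF that(2,1)] by (simp add: poly_ring_simps)
    qed
  next
    assume K: "S.ideal_in K"
    show "ideal K (poly_ring n)"
    proof (rule idealI[OF R.ring_axioms])
      show "subgroup K (add_monoid (poly_ring n))"
      proof (rule R.add.subgroupI)
        show "K \<subseteq> polys n" using S.ideal_in_sub[OF K] .
        show "K \<noteq> {}" using S.ideal_in_zero[OF K] by auto
        show "\<ominus>\<^bsub>poly_ring n\<^esub> a \<in> K" if "a \<in> K" for a
          using that S.ideal_in_uminus[OF K that] S.ideal_in_sub[OF K] by (auto simp: poly_ring_a_inv)
        show "a \<oplus>\<^bsub>poly_ring n\<^esub> b \<in> K" if "a \<in> K" "b \<in> K" for a b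
          using S.ideal_in_add[OF K that] by (simp add: poly_ring_simps)
      qed
      show "x \<otimes>\<^bsub>poly_ring n\<^esub> a \<in> K" "a \<otimes>\<^bsub>poly_ring n\<^esub> x \<in> K" if "a \<in> K" "x \<in> polys n" for a x
        using S.ideal_in_mult[OF K that(2,1)] S.ideal_in_mult2[OF K that(2,1)] by (simp_all add: poly_ring_simps)
    qed
  qed
qed

text \<open>Membership is tested term by term. In this form the property passes to contractions
  without any choice of generators.\<close>

definition monomial_in :: "nat \<Rightarrow> ((nat \<Rightarrow>\<^sub>0 nat) \<Rightarrow>\<^sub>0 'k::field) set \<Rightarrow> bool" where
  "monomial_in n J \<longleftrightarrow> ideal_of n J \<and> (\<forall>f\<in>J. \<forall>k\<in>Poly_Mapping.keys f. Poly_Mapping.single k 1 \<in> J)"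

lemma monomial_inD: "monomial_in n J \<Longrightarrow> f \<in> J \<Longrightarrow> k \<in> Poly_Mapping.keys f \<Longrightarrow> Poly_Mapping.single k 1 \<in> J"
  by (auto simp: monomial_in_def)

lemma single_in_ideal:
  assumes "ideal_of n J" "Poly_Mapping.single k 1 \<in> J"
  shows "Poly_Mapping.single k c \<in> J"
proof -
  interpret S: subring_in "polys n :: ((nat \<Rightarrow>\<^sub>0 nat) \<Rightarrow>\<^sub>0 'a) set" by (rule polys_subring)
  have "Poly_Mapping.single 0 c * Poly_Mapping.single k 1 \<in> J"
    by (rule S.ideal_in_mult[OF assms(1) single_in_polys[OF exponents_zero] assms(2)])
  then show ?thesis by (simp add: mult_single)
qed

lemma single_multiple_in_ideal:
  assumes "ideal_of n J" "Poly_Mapping.single k 1 \<in> J" "m \<in> exponents n"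
  shows "Poly_Mapping.single (k + m) 1 \<in> J"
proof -
  interpret S: subring_in "polys n :: ((nat \<Rightarrow>\<^sub>0 nat) \<Rightarrow>\<^sub>0 'a) set" by (rule polys_subring)
  have "Poly_Mapping.single m 1 * Poly_Mapping.single k 1 \<in> J"
    by (rule S.ideal_in_mult[OF assms(1) single_in_polys[OF assms(3)] assms(2)])
  then show ?thesis by (simp add: mult_single add.commute)
qed

lemma in_ideal_if_terms:
  assumes J: "ideal_of n J" and "\<And>k. k \<in> Poly_Mapping.keys f \<Longrightarrow> Poly_Mapping.single k 1 \<in> J"
  shows "f \<in> J"
proof -
  interpret S: subring_in "polys n :: ((nat \<Rightarrow>\<^sub>0 nat) \<Rightarrow>\<^sub>0 'a) set" by (rule polys_subring)
  have "(\<Sum>k\<in>F. Poly_Mapping.single k (Poly_Mapping.lookup f k)) \<in> J" if "finite F" "F \<subseteq> Poly_Mapping.keys f" for F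
    using that
  proof (induction F)
    case empty show ?case using S.ideal_in_zero[OF J] by simp
  next
    case (insert k F)
    then have "Poly_Mapping.single k (Poly_Mapping.lookup f k) \<in> J"
      using single_in_ideal[OF J assms(2)] by simp
    then show ?case using insert S.ideal_in_add[OF J] by simp
  qed
  from this[of "Poly_Mapping.keys f"] show ?thesis by (simp add: sum_single)
qed

text \<open>The polynomials all of whose terms lie in I form an ideal that contains the generating
  monomials, hence all of I.\<close>

lemma monomial_ideal_imp_monomial_in:
  fixes I :: "((nat \<Rightarrow>\<^sub>0 nat) \<Rightarrow>\<^sub>0 'k::field) set"
  assumes "monomial_ideal n I"
  shows "monomial_in n I"
proof -
  interpret S: subring_in "polys n :: ((nat \<Rightarrow>\<^sub>0 nat) \<Rightarrow>\<^sub>0 'k) set" by (rule polys_subring)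
  interpret R: cring "poly_ring n :: ((nat \<Rightarrow>\<^sub>0 nat) \<Rightarrow>\<^sub>0 'k) ring" by (rule poly_ring_cring)
  obtain M where M: "M \<subseteq> monomials n" "I = Idl\<^bsub>poly_ring n\<^esub> M"
    using assms by (auto simp: monomial_ideal_def)
  have MA: "M \<subseteq> polys n" using M(1) single_in_polys by (auto simp: monomials_def)
  have I: "S.ideal_in I" using R.genideal_ideal[OF MA] M(2) ideal_poly_ring_iff by blast
  let ?I = "{f \<in> polys n :: ((nat \<Rightarrow>\<^sub>0 nat) \<Rightarrow>\<^sub>0 'k) set. \<forall>k\<in>Poly_Mapping.keys f. Poly_Mapping.single k 1 \<in> I}"
  have "S.ideal_in ?I"
  proof (rule S.ideal_inI)
    show "a + b \<in> ?I" if "a \<in> ?I" "b \<in> ?I" for a b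
      using that keys_add[of a b] S.add_in[of a b] by blast
    show "r * a \<in> ?I" if r: "r \<in> polys n" and a: "a \<in> ?I" for r a
    proof -
      have "Poly_Mapping.single k 1 \<in> I" if k: "k \<in> Poly_Mapping.keys (r * a)" for k
      proof -
        obtain m m' where m: "k = m + m'" "m \<in> Poly_Mapping.keys r" "m' \<in> Poly_Mapping.keys a"
          using keys_mult[of r a] k by blast
        have "m \<in> exponents n" using m(2) r polys_iff by blast
        then show ?thesis using single_multiple_in_ideal[OF I, of m' m] m a by (simp add: add.commute)
      qed
      then show ?thesis using r a S.mult_in[of r a] by blast
    qed
  qed auto
  then have id: "ideal ?I (poly_ring n)" using ideal_poly_ring_iff by blast
  have "M \<subseteq> I" using R.genideal_self[OF MA] M(2) by simp
  have "M \<subseteq> ?I"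
  proof
    fix f assume f: "f \<in> M"
    then obtain e where "f = Poly_Mapping.single e 1" using M(1) by (auto simp: monomials_def)
    then show "f \<in> ?I" using f MA \<open>M \<subseteq> I\<close> by auto
  qed
  then have "I \<subseteq> ?I" using R.genideal_minimal[OF id] M(2) by simp
  then show ?thesis using I unfolding monomial_in_def by blast
qed


section \<open>Radicals of monomial ideals\<close>

context subring_in
begin

definition rad :: "'a set \<Rightarrow> 'a set" where
  "rad K = {a \<in> A. \<exists>k::nat. a ^ k \<in> K}"

lemma power_in_ideal_mono: "ideal_in K \<Longrightarrow> a \<in> A \<Longrightarrow> a ^ k \<in> K \<Longrightarrow> k \<le> m \<Longrightarrow> a ^ m \<in> K"
  using ideal_in_mult[of K "a ^ (m - k)" "a ^ k"] by (simp add: power_add[symmetric])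

lemma rad_sup: "ideal_in K \<Longrightarrow> K \<subseteq> rad K"
  using ideal_in_sub[of K] by (auto simp: rad_def intro: exI[of _ "1::nat"])

lemma rad_mono: "K \<subseteq> L \<Longrightarrow> rad K \<subseteq> rad L"
  by (auto simp: rad_def)

lemma ideal_in_sum: "ideal_in K \<Longrightarrow> (\<And>i. i \<in> F \<Longrightarrow> f i \<in> K) \<Longrightarrow> sum f F \<in> K"
  by (induction F rule: infinite_finite_induct) (auto simp: ideal_in_zero intro: ideal_in_add)

lemma of_nat_in: "of_nat k \<in> A"
  by (induction k) auto

lemma rad_ideal:
  assumes K: "ideal_in K"
  shows "ideal_in (rad K)"
proof (rule ideal_inI)
  show "rad K \<subseteq> A" by (auto simp: rad_def)
  show "0 \<in> rad K" using ideal_in_zero[OF K] by (auto simp: rad_def intro: exI[of _ "1::nat"])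
  fix a b assume "a \<in> rad K" "b \<in> rad K"
  then obtain k m where *: "a \<in> A" "b \<in> A" "a ^ k \<in> K" "b ^ m \<in> K" by (auto simp: rad_def)
  \<comment> \<open>In each summand either i is at least k or the complementary exponent is at least
    m.\<close>
  have "(a + b) ^ (k + m) = (\<Sum>i\<le>k + m. of_nat (k + m choose i) * a ^ i * b ^ (k + m - i))"
    by (rule binomial_ring)
  also have "\<dots> \<in> K"
  proof (rule ideal_in_sum[OF K])
    fix i assume "i \<in> {..k + m}"
    show "of_nat (k + m choose i) * a ^ i * b ^ (k + m - i) \<in> K"
    proof (cases "k \<le> i")
      case True
      then have "a ^ i \<in> K" using power_in_ideal_mono[OF K *(1,3)] by blast
      moreover have "of_nat (k + m choose i) * b ^ (k + m - i) \<in> A" using of_nat_in * by simp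
      ultimately have "of_nat (k + m choose i) * b ^ (k + m - i) * a ^ i \<in> K"
        by (intro ideal_in_mult[OF K])
      then show ?thesis by (simp add: mult_ac)
    next
      case False
      then have "b ^ (k + m - i) \<in> K" using power_in_ideal_mono[OF K *(2,4)] by auto
      moreover have "of_nat (k + m choose i) * a ^ i \<in> A" using of_nat_in * by simp
      ultimately show ?thesis by (intro ideal_in_mult[OF K])
    qed
  qed
  finally show "a + b \<in> rad K" using * by (auto simp: rad_def)
next
  fix r a assume r: "r \<in> A" and "a \<in> rad K"
  then obtain k where "a \<in> A" "a ^ k \<in> K" by (auto simp: rad_def)
  then show "r * a \<in> rad K"
    using r ideal_in_mult[OF K, of "r ^ k" "a ^ k"] by (auto simp: rad_def power_mult_distrib)
qed

lemma rad_rad: "ideal_in K \<Longrightarrow> rad (rad K) = rad K"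
  using rad_sup[OF rad_ideal] by (fastforce simp: rad_def power_mult[symmetric])

end

lemma radical_poly_ring: "radical (poly_ring n) I = subring_in.rad (polys n) I"
proof -
  interpret S: subring_in "polys n :: ((nat \<Rightarrow>\<^sub>0 nat) \<Rightarrow>\<^sub>0 'a) set" by (rule polys_subring)
  show ?thesis by (simp add: radical_def S.rad_def poly_ring_pow)
qed

lemma lookup_square_var: "Poly_Mapping.lookup (square_var i f) (double_exponent i k) = Poly_Mapping.lookup f k"
proof -
  have "Poly_Mapping.lookup (square_var i f) (double_exponent i k) =
    (\<Sum>m\<in>Poly_Mapping.keys f. (Poly_Mapping.lookup f m when m = k))"
    unfolding square_var_def lookup_sum lookup_single
    by (intro sum.cong) (auto simp: when_def dest: injD[OF inj_double_exponent])
  also have "\<dots> = Poly_Mapping.lookup f k" by (simp add: when_def in_keys_iff)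
  finally show ?thesis .
qed

context
  fixes n i :: nat and J :: "((nat \<Rightarrow>\<^sub>0 nat) \<Rightarrow>\<^sub>0 'k::field) set"
  assumes i: "i < n" and J: "monomial_in n J"
begin

interpretation square_extension "polys n :: ((nat \<Rightarrow>\<^sub>0 nat) \<Rightarrow>\<^sub>0 'k) set" "square_var i" "halve_var i" "var i"
  by (rule square_extension_polys[OF i])

lemma monomial_in_ideal: "ideal_in J"
  using J by (simp add: monomial_in_def)

lemma contract_monomial_term:
  assumes "f \<in> contract J" "k \<in> Poly_Mapping.keys f"
  shows "Poly_Mapping.single (double_exponent i k) 1 \<in> J"
proof -
  have "double_exponent i k \<in> Poly_Mapping.keys (square_var i f)"
    using assms(2) by (simp add: in_keys_iff lookup_square_var)
  moreover have "square_var i f \<in> J" using assms(1) by (simp add: contract_def)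
  ultimately show ?thesis using monomial_inD[OF J] by blast
qed

lemma contract_monomial: "monomial_in n (contract J)"
  unfolding monomial_in_def
proof (intro conjI ballI)
  show "ideal_in (contract J)" by (rule contract_ideal[OF monomial_in_ideal])
  fix f k assume f: "f \<in> contract J" "k \<in> Poly_Mapping.keys f"
  then have "k \<in> exponents n" using polys_iff by (auto simp: contract_def)
  then show "Poly_Mapping.single k 1 \<in> contract J"
    using contract_monomial_term[OF f] single_in_polys by (simp add: contract_def)
qed

text \<open>Doubling the exponent of x_i in a monomial multiplies it by a power of x_i, so the
  substitution maps J into itself.\<close>

lemma contract_monomial_sup: "J \<subseteq> contract J"
proof
  fix f assume f: "f \<in> J"
  have fA: "f \<in> polys n" using f ideal_in_sub[OF monomial_in_ideal] by blast
  have "square_var i f \<in> J"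
  proof (rule in_ideal_if_terms[OF monomial_in_ideal])
    fix m assume "m \<in> Poly_Mapping.keys (square_var i f)"
    then obtain k where k: "k \<in> Poly_Mapping.keys f" "m = double_exponent i k" using keys_square_var by blast
    have "Poly_Mapping.single i (Poly_Mapping.lookup k i) \<in> exponents n" using i by (auto simp: exponents_def)
    then show "Poly_Mapping.single m 1 \<in> J"
      using single_multiple_in_ideal[OF monomial_in_ideal monomial_inD[OF J f k(1)]]
      by (simp add: k(2) double_exponent_def)
  qed
  then show "f \<in> contract J" using fA by (simp add: contract_def)
qed

text \<open>This is the splitting hypothesis of the descent: the projection followed by the
  substitution merely drops terms of f, and a monomial ideal allows that.\<close>

lemma square_var_halve_var_in:
  assumes "f \<in> J"
  shows "square_var i (halve_var i f) \<in> J"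
proof (rule in_ideal_if_terms[OF monomial_in_ideal])
  fix m assume "m \<in> Poly_Mapping.keys (square_var i (halve_var i f))"
  then obtain k where k: "k \<in> Poly_Mapping.keys (halve_var i f)" "m = double_exponent i k"
    using keys_square_var by blast
  then have "m \<in> Poly_Mapping.keys f" by (simp add: in_keys_iff lookup_halve_var)
  then show "Poly_Mapping.single m 1 \<in> J" using monomial_inD[OF J assms] by blast
qed

lemma serre_in_contract_monomial: "serre_in l j J \<Longrightarrow> serre_in l j (contract J)"
  by (rule serre_in_contract[OF monomial_in_ideal square_var_halve_var_in])

lemma contract_monomial_rad: "contract J \<subseteq> rad J"
proof
  fix f assume f: "f \<in> contract J"
  have fA: "f \<in> polys n" using f by (simp add: contract_def)
  show "f \<in> rad J"
  proof (rule in_ideal_if_terms[OF rad_ideal[OF monomial_in_ideal]])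
    fix k assume k: "k \<in> Poly_Mapping.keys f"
    have kn: "k \<in> exponents n" using fA k polys_iff by blast
    \<comment> \<open>The complementary factor: with the i-th entry erased, m doubles the remaining
      entries, so that the substituted monomial becomes the full square.\<close>
    define m where "m = Poly_Mapping.update i 0 k"
    have "Poly_Mapping.keys m \<subseteq> Poly_Mapping.keys k"
      by (auto simp: m_def in_keys_iff lookup_update split: if_splits)
    then have "m \<in> exponents n" using kn unfolding exponents_def by blast
    moreover have "double_exponent i k + m = k + k"
      by (rule poly_mapping_eqI) (simp add: m_def lookup_add lookup_double_exponent lookup_update)
    ultimately have "Poly_Mapping.single (k + k) 1 \<in> J"
      using single_multiple_in_ideal[OF monomial_in_ideal contract_monomial_term[OF f k], of m] by simp
    then have "Poly_Mapping.single k (1::'k) ^ 2 \<in> J" by (simp add: power2_eq_square mult_single)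
    then show "Poly_Mapping.single k 1 \<in> rad J" using single_in_polys[OF kn] by (auto simp: rad_def)
  qed
qed

lemma contract_fixed_imp:
  assumes "contract J = J" "m \<in> exponents n" "Poly_Mapping.single (double_exponent i m) 1 \<in> J"
  shows "Poly_Mapping.single m 1 \<in> J"
proof -
  have "Poly_Mapping.single m 1 \<in> contract J"
    using assms(2,3) single_in_polys by (simp add: contract_def)
  then show ?thesis using assms(1) by simp
qed

lemma contract_monomial_le_rad_of: "J \<subseteq> rad I \<Longrightarrow> ideal_in I \<Longrightarrow> contract J \<subseteq> rad I"
  using contract_monomial_rad rad_mono[of J "rad I"] rad_rad[of I] by blast

end

text \<open>Doubles the entries below p one after the other. Invariance under each single
  substitution thereby accumulates to closure under square roots of monomials.\<close>

primrec double_exponents :: "nat \<Rightarrow> (nat \<Rightarrow>\<^sub>0 nat) \<Rightarrow> (nat \<Rightarrow>\<^sub>0 nat)" where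
  "double_exponents 0 m = m"
| "double_exponents (Suc p) m = double_exponent p (double_exponents p m)"

lemma lookup_double_exponents:
  "Poly_Mapping.lookup (double_exponents p m) k = (if k < p then 2 else 1) * Poly_Mapping.lookup m k"
  by (induction p) (auto simp: lookup_double_exponent less_Suc_eq)

lemma double_exponents_all: "m \<in> exponents n \<Longrightarrow> double_exponents n m = m + m"
  by (rule poly_mapping_eqI) (auto simp: lookup_double_exponents lookup_add exponents_def in_keys_iff subset_iff)

text \<open>The linear order on exponent vectors is compatible with addition, so the top terms
  multiply and their coefficient remains nonzero over a field. M is k times m, expressed through the
  power of the monomial.\<close>

lemma lookup_power_leading:
  fixes f :: "(nat \<Rightarrow>\<^sub>0 nat) \<Rightarrow>\<^sub>0 'k::field"
  assumes m: "m \<in> Poly_Mapping.keys f" and le: "\<And>a. a \<in> Poly_Mapping.keys f \<Longrightarrow> a \<le> m"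
  shows "\<exists>M \<in> Poly_Mapping.keys (f ^ k). Poly_Mapping.single M 1 = Poly_Mapping.single m (1::'k) ^ k"
proof -
  define c where "c = Poly_Mapping.lookup f m"
  have c: "c \<noteq> 0" using m by (simp add: c_def in_keys_iff)
  define f0 where "f0 = f - Poly_Mapping.single m c"
  have f: "f = Poly_Mapping.single m c + f0" by (simp add: f0_def)
  have f0: "a < m" if "a \<in> Poly_Mapping.keys f0" for a
  proof -
    have "a \<noteq> m" "a \<in> Poly_Mapping.keys f"
      using that by (auto simp: f0_def c_def in_keys_iff lookup_minus lookup_single when_def split: if_splits)
    then show ?thesis using le[of a] by simp
  qed
  have "\<exists>M d g. f ^ k = Poly_Mapping.single M d + g \<and> d \<noteq> 0 \<and> (\<forall>a\<in>Poly_Mapping.keys g. a < M)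
    \<and> Poly_Mapping.single M 1 = Poly_Mapping.single m (1::'k) ^ k"
  proof (induction k)
    case 0
    show ?case by (intro exI[of _ 0] exI[of _ 1] exI[of _ "0 :: (nat \<Rightarrow>\<^sub>0 nat) \<Rightarrow>\<^sub>0 'k"]) simp
  next
    case (Suc k)
    then obtain M d g where 1: "f ^ k = Poly_Mapping.single M d + g" "d \<noteq> 0"
      "\<forall>a\<in>Poly_Mapping.keys g. a < M" "Poly_Mapping.single M 1 = Poly_Mapping.single m (1::'k) ^ k" by blast
    let ?g = "Poly_Mapping.single m c * g + f0 * Poly_Mapping.single M d + f0 * g"
    have "f ^ Suc k = Poly_Mapping.single (m + M) (c * d) + ?g"
      unfolding power_Suc 1(1) by (subst f) (simp add: algebra_simps mult_single)
    moreover have "a < m + M" if a: "a \<in> Poly_Mapping.keys ?g" for a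
    proof -
      have "a \<in> Poly_Mapping.keys (Poly_Mapping.single m c * g) \<or>
        a \<in> Poly_Mapping.keys (f0 * Poly_Mapping.single M d) \<or> a \<in> Poly_Mapping.keys (f0 * g)"
        using a by (meson UnE keys_add subsetD)
      then show ?thesis
      proof (elim disjE)
        assume "a \<in> Poly_Mapping.keys (Poly_Mapping.single m c * g)"
        then obtain b where "a = m + b" "b \<in> Poly_Mapping.keys g"
          using keys_mult[of "Poly_Mapping.single m c" g] by (auto split: if_splits)
        then show ?thesis using 1(3) by (simp add: add_strict_left_mono)
      next
        assume "a \<in> Poly_Mapping.keys (f0 * Poly_Mapping.single M d)"
        then obtain b where "a = b + M" "b \<in> Poly_Mapping.keys f0"
          using keys_mult[of f0 "Poly_Mapping.single M d"] by (auto split: if_splits)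
        then show ?thesis using f0 by (simp add: add_strict_right_mono)
      next
        assume "a \<in> Poly_Mapping.keys (f0 * g)"
        then obtain b b' where "a = b + b'" "b \<in> Poly_Mapping.keys f0" "b' \<in> Poly_Mapping.keys g"
          using keys_mult[of f0 g] by blast
        then show ?thesis using f0 1(3) by (simp add: add_strict_mono)
      qed
    qed
    moreover have "Poly_Mapping.single (m + M) 1 = Poly_Mapping.single m (1::'k) ^ Suc k"
      by (simp add: 1(4)[symmetric] mult_single)
    ultimately show ?case using c 1(2)
      by (intro exI[of _ "m + M"] exI[of _ "c * d"] exI[of _ ?g]) simp
  qed
  then obtain M d g where 1: "f ^ k = Poly_Mapping.single M d + g" "d \<noteq> 0"
    "\<forall>a\<in>Poly_Mapping.keys g. a < M" "Poly_Mapping.single M 1 = Poly_Mapping.single m (1::'k) ^ k" by blast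
  have "Poly_Mapping.lookup g M = 0" using 1(3) by (auto simp: in_keys_iff)
  then have "M \<in> Poly_Mapping.keys (f ^ k)" by (simp add: 1(1,2) in_keys_iff lookup_add)
  then show ?thesis using 1(4) by blast
qed

text \<open>For f in the radical, a power of its leading monomial occurs in a power of f and so lies
  in J. Repeated square roots bring the leading monomial itself into J. Removing the leading term
  leaves an element of the radical with fewer terms.\<close>

lemma rad_monomial_sub:
  fixes J :: "((nat \<Rightarrow>\<^sub>0 nat) \<Rightarrow>\<^sub>0 'k::field) set"
  assumes J: "monomial_in n J"
    and fixed: "\<And>i. i < n \<Longrightarrow> square_extension.contract (polys n) (square_var i) J = J"
  shows "subring_in.rad (polys n) J \<subseteq> J"
proof -
  interpret S: subring_in "polys n :: ((nat \<Rightarrow>\<^sub>0 nat) \<Rightarrow>\<^sub>0 'k) set" by (rule polys_subring)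
  have Jid: "S.ideal_in J" using J by (simp add: monomial_in_def)
  have double_in: "double_exponents p m \<in> exponents n" if "m \<in> exponents n" for p m
    using that by (induction p) (simp_all add: double_exponent_in)
  have halve: "Poly_Mapping.single m 1 \<in> J" if "p \<le> n" "m \<in> exponents n" "Poly_Mapping.single (double_exponents p m) 1 \<in> J" for p m
    using that
  proof (induction p)
    case (Suc p)
    then have p: "p < n" by simp
    have "Poly_Mapping.single (double_exponents p m) 1 \<in> J"
      using contract_fixed_imp[OF p J fixed[OF p] double_in[OF Suc.prems(2)]] Suc.prems(3) by simp
    then show ?case using Suc by simp
  qed simp
  have sqrt: "Poly_Mapping.single m 1 \<in> J" if "m \<in> exponents n" "Poly_Mapping.single (m + m) 1 \<in> J" for m
    using halve[of n m] that by (simp add: double_exponents_all)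
  have power: "Poly_Mapping.single m 1 \<in> J" if "m \<in> exponents n" "Poly_Mapping.single m (1::'k) ^ 2 ^ r \<in> J" for m r
    using that
  proof (induction r arbitrary: m)
    case (Suc r)
    have "Poly_Mapping.single (m + m) (1::'k) ^ 2 ^ r \<in> J"
      using Suc.prems(2) by (simp add: power_mult power2_eq_square mult_single)
    then have "Poly_Mapping.single (m + m) 1 \<in> J" using Suc.IH Suc.prems(1) exponents_add by blast
    then show ?case using sqrt Suc.prems(1) by blast
  qed simp
  have "f \<in> J" if "f \<in> S.rad J" for f
    using that
  proof (induction "card (Poly_Mapping.keys f)" arbitrary: f rule: less_induct)
    case less
    show ?case
    proof (cases "f = 0")
      case True then show ?thesis using S.ideal_in_zero[OF Jid] by simp
    next
      case False
      then have ne: "Poly_Mapping.keys f \<noteq> {}" by simp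
      obtain k where f: "f \<in> polys n" "f ^ k \<in> J" using less.prems by (auto simp: S.rad_def)
      define m where "m = Max (Poly_Mapping.keys f)"
      have m: "m \<in> Poly_Mapping.keys f" using ne by (simp add: m_def)
      have mn: "m \<in> exponents n" using m f(1) polys_iff by blast
      obtain M where M: "M \<in> Poly_Mapping.keys (f ^ k)" "Poly_Mapping.single M 1 = Poly_Mapping.single m (1::'k) ^ k"
        using lookup_power_leading[OF m] by (auto simp: m_def)
      have "Poly_Mapping.single m (1::'k) ^ k \<in> J"
        using monomial_inD[OF J f(2) M(1)] M(2) by simp
      \<comment> \<open>The exponent k is raised to a power of 2, since only square roots are
        available.\<close>
      then have "Poly_Mapping.single m (1::'k) ^ 2 ^ k \<in> J"
        by (rule S.power_in_ideal_mono[OF Jid single_in_polys[OF mn]]) (simp add: less_imp_le)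
      then have mJ: "Poly_Mapping.single m 1 \<in> J" using power[OF mn] by blast
      let ?t = "Poly_Mapping.single m (Poly_Mapping.lookup f m)"
      have t: "?t \<in> J" by (rule single_in_ideal[OF Jid mJ])
      have "f - ?t \<in> S.rad J"
        using S.ideal_in_diff[OF S.rad_ideal[OF Jid] less.prems] S.rad_sup[OF Jid] t by blast
      moreover have "Poly_Mapping.keys (f - ?t) \<subseteq> Poly_Mapping.keys f - {m}"
        by (auto simp: in_keys_iff lookup_minus lookup_single when_def split: if_splits)
      then have "card (Poly_Mapping.keys (f - ?t)) < card (Poly_Mapping.keys f)"
        using m by (intro psubset_card_mono) auto
      ultimately have "f - ?t \<in> J" using less.hyps by blast
      then show ?thesis using S.ideal_in_add[OF Jid _ t, of "f - ?t"] by simp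
    qed
  qed
  then show ?thesis by blast
qed

lemma serre_in_radical:
  fixes I :: "((nat \<Rightarrow>\<^sub>0 nat) \<Rightarrow>\<^sub>0 'k::field) set"
  assumes I: "monomial_in n I" and S: "subring_in.serre_in (polys n) l j I"
  shows "subring_in.serre_in (polys n) l j (radical (poly_ring n) I)"
proof -
  interpret noetherian_in "polys n :: ((nat \<Rightarrow>\<^sub>0 nat) \<Rightarrow>\<^sub>0 'k) set" by (rule polys_noetherian)
  have Iid: "ideal_in I" using I by (simp add: monomial_in_def)
  let ?F = "{J. monomial_in n J \<and> I \<subseteq> J \<and> J \<subseteq> rad I \<and> serre_in l j J}"
  have "I \<in> ?F" using I S rad_sup[OF Iid] by simp
  then have "?F \<noteq> {}" by blast
  then have "\<exists>M\<in>?F. \<forall>J\<in>?F. M \<subseteq> J \<longrightarrow> J = M"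
    by (rule noetherian) (simp add: monomial_in_def)
  then obtain M where MF: "M \<in> ?F" and max: "\<forall>J\<in>?F. M \<subseteq> J \<longrightarrow> J = M" by (rule bexE)
  have M: "monomial_in n M" "I \<subseteq> M" "M \<subseteq> rad I" "serre_in l j M" using MF by auto
  have "square_extension.contract (polys n) (square_var i) M = M" if i: "i < n" for i
  proof -
    have "square_extension.contract (polys n) (square_var i) M \<in> ?F"
      using contract_monomial[OF i M(1)] contract_monomial_sup[OF i M(1)] M(2)
        contract_monomial_le_rad_of[OF i M(1) M(3) Iid] serre_in_contract_monomial[OF i M(1) M(4)] by blast
    then show ?thesis using max contract_monomial_sup[OF i M(1)] by simp
  qed
  then have "rad M \<subseteq> M" by (rule rad_monomial_sub[OF M(1)])
  then have "rad I = M" using rad_mono[OF M(2)] M(3) by blast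
  then show ?thesis using M(4) by (simp add: radical_poly_ring)
qed


section \<open>Depth and dimension of a local quotient\<close>

lemma (in cring) genideal_insert_mono:
  assumes "G \<subseteq> carrier R" "x \<in> carrier R"
  shows "Idl G \<subseteq> Idl (insert x G)"
  using genideal_minimal[OF genideal_ideal[of "insert x G"], of G] genideal_self[of "insert x G"] assms by auto

text \<open>Regularity modulo the ideal generated by G, with the elements already used collected in
  G. The recursion matches that of \<open>depth_ge\<close>; properness of the generated ideal is
  handled apart.\<close>

primrec regular_over :: "('a, 'm) ring_scheme \<Rightarrow> 'a set \<Rightarrow> 'a list \<Rightarrow> bool" where
  "regular_over R G [] \<longleftrightarrow> True"
| "regular_over R G (x # xs) \<longleftrightarrow>
     (\<forall>y\<in>carrier R. x \<otimes>\<^bsub>R\<^esub> y \<in> Idl\<^bsub>R\<^esub> G \<longrightarrow> y \<in> Idl\<^bsub>R\<^esub> G) \<and> regular_over R (insert x G) xs"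

lemma regular_over_iff:
  "regular_over R G xs \<longleftrightarrow>
     (\<forall>i<length xs. \<forall>y\<in>carrier R. xs ! i \<otimes>\<^bsub>R\<^esub> y \<in> Idl\<^bsub>R\<^esub> (G \<union> set (take i xs)) \<longrightarrow>
       y \<in> Idl\<^bsub>R\<^esub> (G \<union> set (take i xs)))"
  by (induction xs arbitrary: G) (simp_all add: All_less_Suc2)

lemma regular_over_take: "regular_over R G xs \<Longrightarrow> regular_over R G (take t xs)"
  by (auto simp: regular_over_iff min_def)

lemma (in cring) m_interchange:
  "x \<in> carrier R \<Longrightarrow> y \<in> carrier R \<Longrightarrow> u \<in> carrier R \<Longrightarrow> v \<in> carrier R \<Longrightarrow>
    (x \<otimes> y) \<otimes> (u \<otimes> v) = (x \<otimes> u) \<otimes> (y \<otimes> v)"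
  by (simp add: m_ac)

lemma (in cring) coset_eq_ideal_iff:
  assumes "ideal J R" "a \<in> carrier R"
  shows "J +> a = J \<longleftrightarrow> a \<in> J"
  using ideal.rcos_const_imp_mem[OF assms(1)] a_rcos_zero[OF assms(1)] assms(2) by auto

lemma (in cring) nonzerodivisor_quot_iff:
  assumes J: "ideal J R" and x: "x \<in> carrier R"
  shows "nonzerodivisor (R Quot J) (J +> x) \<longleftrightarrow> (\<forall>y\<in>carrier R. x \<otimes> y \<in> J \<longrightarrow> y \<in> J)"
proof -
  have car: "carrier (R Quot J) = (\<lambda>a. J +> a) ` carrier R"
    by (auto simp: FactRing_def A_RCOSETS_def' )
  have mult: "(J +> x) \<otimes>\<^bsub>R Quot J\<^esub> (J +> y) = J +> (x \<otimes> y)" if "y \<in> carrier R" for y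
    using ideal.rcoset_mult_add[OF J x that] by (simp add: FactRing_def)
  have "\<zero>\<^bsub>R Quot J\<^esub> = J" by (simp add: FactRing_def)
  then show ?thesis
    unfolding nonzerodivisor_def car using x by (auto simp: mult coset_eq_ideal_iff[OF J])
qed

lemma (in cring) regular_sequence_iff:
  assumes xs: "set xs \<subseteq> carrier R"
  shows "regular_sequence R xs \<longleftrightarrow> regular_over R {} xs \<and> Idl (set xs) \<noteq> carrier R"
proof -
  have "nonzerodivisor (R Quot Idl (set (take i xs))) (Idl (set (take i xs)) +> xs ! i) \<longleftrightarrow>
     (\<forall>y\<in>carrier R. xs ! i \<otimes> y \<in> Idl (set (take i xs)) \<longrightarrow> y \<in> Idl (set (take i xs)))"
    if "i < length xs" for i
    using that xs set_take_subset[of i xs] nth_mem[OF that]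
    by (intro nonzerodivisor_quot_iff genideal_ideal) auto
  then show ?thesis using xs by (auto simp: regular_sequence_def regular_over_iff Let_def)
qed

text \<open>\<open>L\<close> is the localization at \<open>q\<close> of \<open>A\<close> modulo \<open>I\<close>.\<close>

locale local_quotient = subring_in A + cring L for A :: "'a::comm_ring_1 set" and L (structure) +
  fixes \<eta> :: "'a \<Rightarrow> 'b" and q I :: "'a set"
  assumes prime_q: "prime_in q" and ideal_I: "ideal_in I" and I_sub: "I \<subseteq> q"
    and eta_in [simp]: "a \<in> A \<Longrightarrow> \<eta> a \<in> carrier L"
    and eta_add: "a \<in> A \<Longrightarrow> b \<in> A \<Longrightarrow> \<eta> (a + b) = \<eta> a \<oplus> \<eta> b"
    and eta_mult: "a \<in> A \<Longrightarrow> b \<in> A \<Longrightarrow> \<eta> (a * b) = \<eta> a \<otimes> \<eta> b"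
    and eta_one: "\<eta> 1 = \<one>"
    and eta_unit: "s \<in> A - q \<Longrightarrow> \<eta> s \<in> Units L"
    and eta_surj: "y \<in> carrier L \<Longrightarrow> \<exists>a\<in>A. \<exists>s\<in>A - q. y \<otimes> \<eta> s = \<eta> a"
    and eta_zero: "a \<in> A \<Longrightarrow> \<eta> a = \<zero> \<longleftrightarrow> a \<in> sat q I"
begin

lemma fraction:
  assumes "y \<in> carrier L" obtains a s where "a \<in> A" "s \<in> A" "s \<notin> q" "y \<otimes> \<eta> s = \<eta> a"
  using eta_surj[OF assms] by auto

lemma eta_of_zero: "\<eta> 0 = \<zero>"
  using eta_zero[of 0] ideal_in_zero[OF sat_ideal[OF prime_q ideal_I]] by simp

lemma eta_uminus: "a \<in> A \<Longrightarrow> \<eta> (- a) = \<ominus> \<eta> a"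
  using eta_add[of "- a" a] eta_of_zero minus_equality[of "\<eta> (- a)" "\<eta> a"] by simp

lemma eta_eq_iff:
  assumes "a \<in> A" "b \<in> A"
  shows "\<eta> a = \<eta> b \<longleftrightarrow> a - b \<in> sat q I"
proof -
  have "\<eta> (a - b) = \<eta> a \<ominus> \<eta> b"
    using eta_add[of a "- b"] eta_uminus assms by (simp add: a_minus_def)
  moreover have "\<eta> a \<ominus> \<eta> b = \<zero> \<longleftrightarrow> \<eta> a = \<eta> b"
    using assms minus_equality[of "\<eta> a" "\<ominus> \<eta> b"] by (auto simp: a_minus_def r_neg)
  ultimately show ?thesis using eta_zero[of "a - b"] assms by simp
qed

text \<open>The extension of K to L: for an ideal K, a common denominator brings every element of
  the generated ideal to a single fraction with numerator in K.\<close>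

definition ext :: "'a set \<Rightarrow> 'b set" where
  "ext K = {y \<in> carrier L. \<exists>a\<in>K. \<exists>s\<in>A - q. y \<otimes> \<eta> s = \<eta> a}"

text \<open>Extension followed by contraction is saturation. The kernel of \<eta>, the saturation of
  I, is absorbed because K contains I.\<close>

lemma eta_in_ext_iff:
  assumes K: "ideal_in K" "I \<subseteq> K" and a: "a \<in> A"
  shows "\<eta> a \<in> ext K \<longleftrightarrow> a \<in> sat q K"
proof
  assume "\<eta> a \<in> ext K"
  then obtain b s where 1: "b \<in> K" "s \<in> A" "s \<notin> q" "\<eta> a \<otimes> \<eta> s = \<eta> b" by (auto simp: ext_def)
  have b: "b \<in> A" using 1(1) ideal_in_sub[OF K(1)] by auto
  have "\<eta> (a * s) = \<eta> b" using 1 a by (simp add: eta_mult)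
  then have "a * s - b \<in> sat q I" using eta_eq_iff[of "a * s" b] a b 1 by simp
  then obtain u where u: "u \<in> A - q" "u * (a * s - b) \<in> I" by (auto elim: satE)
  have "u * (a * s - b) + u * b \<in> K"
    using u K ideal_in_add[OF K(1)] ideal_in_mult[OF K(1), of u b] 1 by blast
  then have "(u * s) * a \<in> K" by (simp add: algebra_simps)
  then show "a \<in> sat q K" using satI[OF a prime_in_compl_mult[OF prime_q u(1), of s]] 1 by simp
next
  assume "a \<in> sat q K"
  then obtain s where "s \<in> A - q" "s * a \<in> K" by (auto elim: satE)
  moreover from this have "\<eta> a \<otimes> \<eta> s = \<eta> (s * a)" using a eta_mult[of a s] by (simp add: mult.commute)
  ultimately show "\<eta> a \<in> ext K" using eta_in[OF a] unfolding ext_def by blast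
qed

lemma ext_ideal:
  assumes K: "ideal_in K"
  shows "ideal (ext K) L"
proof (rule idealI)
  show "ring L" by (rule ring_axioms)
  have mult: "x \<otimes> y \<in> ext K" if "y \<in> ext K" "x \<in> carrier L" for x y
  proof -
    obtain b t where 1: "y \<in> carrier L" "b \<in> K" "t \<in> A - q" "y \<otimes> \<eta> t = \<eta> b" using \<open>y \<in> ext K\<close> by (auto simp: ext_def)
    obtain a s where 2: "a \<in> A" "s \<in> A - q" "x \<otimes> \<eta> s = \<eta> a" using eta_surj[OF \<open>x \<in> carrier L\<close>] by auto
    have b: "b \<in> A" using 1 ideal_in_sub[OF K] by auto
    have st: "s * t \<in> A - q" using prime_in_compl_mult[OF prime_q] 1 2 by auto
    have "(x \<otimes> y) \<otimes> \<eta> (s * t) = (x \<otimes> \<eta> s) \<otimes> (y \<otimes> \<eta> t)"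
      using 1(1,3) 2(2) \<open>x \<in> carrier L\<close> by (simp add: eta_mult m_interchange)
    also have "\<dots> = \<eta> (a * b)" using 1 2 b by (simp add: eta_mult)
    finally show ?thesis
      using st ideal_in_mult[OF K 2(1) 1(2)] 1(1) \<open>x \<in> carrier L\<close> unfolding ext_def by blast
  qed
  then show "x \<otimes> y \<in> ext K" "y \<otimes> x \<in> ext K" if "y \<in> ext K" "x \<in> carrier L" for x y
    using that mult[OF that] m_comm[of y x] by (auto simp: ext_def)
  show "subgroup (ext K) (add_monoid L)"
  proof (rule add.subgroupI)
    show "ext K \<subseteq> carrier L" by (auto simp: ext_def)
    have "\<zero> \<otimes> \<eta> 1 = \<eta> 0" by (simp add: eta_of_zero)
    then show "ext K \<noteq> {}"
      using ideal_in_zero[OF K] prime_in_one[OF prime_q] unfolding ext_def by blast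
    show "\<ominus> x \<in> ext K" if x: "x \<in> ext K" for x
    proof -
      have "x \<in> carrier L" using x by (auto simp: ext_def)
      then have "\<ominus> x = \<ominus> \<one> \<otimes> x" by (simp add: l_minus)
      then show ?thesis using mult[OF x, of "\<ominus> \<one>"] by simp
    qed
    show "x \<oplus> y \<in> ext K" if xy: "x \<in> ext K" "y \<in> ext K" for x y
    proof -
      obtain a s where 1: "x \<in> carrier L" "a \<in> K" "s \<in> A - q" "x \<otimes> \<eta> s = \<eta> a" using xy by (auto simp: ext_def)
      obtain b t where 2: "y \<in> carrier L" "b \<in> K" "t \<in> A - q" "y \<otimes> \<eta> t = \<eta> b" using xy by (auto simp: ext_def)
      have ab: "a \<in> A" "b \<in> A" using 1 2 ideal_in_sub[OF K] by auto
      have st: "s * t \<in> A - q" using prime_in_compl_mult[OF prime_q] 1 2 by auto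
      have "(x \<oplus> y) \<otimes> \<eta> (s * t) = \<eta> t \<otimes> (x \<otimes> \<eta> s) \<oplus> \<eta> s \<otimes> (y \<otimes> \<eta> t)"
        using 1(1,3) 2(1,3) by (simp add: eta_mult l_distr r_distr m_ac)
      also have "\<dots> = \<eta> (t * a + s * b)" using 1 2 ab by (simp add: eta_mult eta_add)
      finally have "(x \<oplus> y) \<otimes> \<eta> (s * t) = \<eta> (t * a + s * b)" .
      moreover have "t * a + s * b \<in> K"
        using 1 2 by (intro ideal_in_add[OF K] ideal_in_mult[OF K]) auto
      ultimately show ?thesis using st 1(1) 2(1) unfolding ext_def by blast
    qed
  qed
qed

lemma ideal_unit_cancel:
  assumes "ideal J L" "u \<in> Units L" "y \<in> carrier L"
  shows "y \<otimes> u \<in> J \<longleftrightarrow> y \<in> J"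
proof
  assume "y \<otimes> u \<in> J"
  then have "(y \<otimes> u) \<otimes> inv u \<in> J" using ideal.I_r_closed[OF assms(1)] assms(2) by simp
  then show "y \<in> J" using assms(2,3) by (simp add: m_assoc Units_closed)
qed (use ideal.I_r_closed[OF assms(1)] assms(2) in auto)

lemma in_ext_iff:
  assumes K: "ideal_in K" "I \<subseteq> K" and y: "y \<in> carrier L" "a \<in> A" "s \<in> A" "s \<notin> q" "y \<otimes> \<eta> s = \<eta> a"
  shows "y \<in> ext K \<longleftrightarrow> a \<in> sat q K"
  using ideal_unit_cancel[OF ext_ideal[OF K(1)] eta_unit[of s] y(1)] y eta_in_ext_iff[OF K y(2)] by simp

lemma ext_mono: "K \<subseteq> K' \<Longrightarrow> ext K \<subseteq> ext K'"
  by (auto simp: ext_def)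

lemma sat_prime: "prime_in P \<Longrightarrow> P \<subseteq> q \<Longrightarrow> sat q P = P"
  using sat_sup[OF prime_q prime_in_ideal] prime_in_mult[of P] by (fastforce elim!: satE)

lemma ext_prime:
  assumes P: "prime_in P" "I \<subseteq> P" "P \<subseteq> q"
  shows "primeideal (ext P) L"
proof (rule primeidealI)
  note Pid = prime_in_ideal[OF P(1)]
  show "ideal (ext P) L" by (rule ext_ideal[OF Pid])
  show "cring L" by (rule cring_axioms)
  have "\<one> \<notin> ext P"
    using eta_in_ext_iff[OF Pid P(2), of 1] sat_prime[OF P(1,3)] prime_in_one[OF P(1)] by (simp add: eta_one)
  then show "carrier L \<noteq> ext P" by auto
  fix x y assume xy: "x \<in> carrier L" "y \<in> carrier L" "x \<otimes> y \<in> ext P"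
  obtain a s where 1: "a \<in> A" "s \<in> A" "s \<notin> q" "x \<otimes> \<eta> s = \<eta> a" using xy(1) by (rule fraction)
  obtain b t where 2: "b \<in> A" "t \<in> A" "t \<notin> q" "y \<otimes> \<eta> t = \<eta> b" using xy(2) by (rule fraction)
  have "(x \<otimes> y) \<otimes> \<eta> (s * t) = (x \<otimes> \<eta> s) \<otimes> (y \<otimes> \<eta> t)"
    using 1(2) 2(2) xy(1,2) by (simp add: eta_mult m_interchange)
  also have "\<dots> = \<eta> (a * b)" using 1 2 by (simp add: eta_mult)
  finally have "a * b \<in> sat q P"
    using in_ext_iff[OF Pid P(2), of "x \<otimes> y" "a * b" "s * t"] prime_in_compl_mult[OF prime_q, of s t] 1 2 xy by simp
  then have "a \<in> P \<or> b \<in> P" using sat_prime[OF P(1,3)] prime_in_mult[OF P(1)] 1 2 by simp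
  then show "x \<in> ext P \<or> y \<in> ext P"
    using in_ext_iff[OF Pid P(2) xy(1) 1] in_ext_iff[OF Pid P(2) xy(2) 2] sat_prime[OF P(1,3)] by simp
qed

definition preimage :: "'b set \<Rightarrow> 'a set" where
  "preimage Q = {a \<in> A. \<eta> a \<in> Q}"

lemma preimage_ext: "prime_in P \<Longrightarrow> I \<subseteq> P \<Longrightarrow> P \<subseteq> q \<Longrightarrow> preimage (ext P) = P"
  using eta_in_ext_iff[OF prime_in_ideal, of P] sat_prime[of P] ideal_in_sub[OF prime_in_ideal, of P]
  by (auto simp: preimage_def)

lemma preimage_prime:
  assumes "primeideal Q L"
  shows "prime_in (preimage Q)" "I \<subseteq> preimage Q" "preimage Q \<subseteq> q"
proof -
  interpret Q: primeideal Q L by fact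
  have one: "\<one> \<notin> Q" using Q.I_notcarr Q.one_imp_carrier by blast
  show "prime_in (preimage Q)"
    unfolding prime_in_def
  proof (intro conjI ballI impI)
    show "ideal_in (preimage Q)"
      by (rule ideal_inI) (auto simp: preimage_def eta_of_zero eta_add eta_mult intro: Q.I_l_closed)
    show "1 \<notin> preimage Q" using one by (simp add: preimage_def eta_one)
    show "a \<in> preimage Q \<or> b \<in> preimage Q" if "a \<in> A" "b \<in> A" "a * b \<in> preimage Q" for a b
      using that Q.I_prime[of "\<eta> a" "\<eta> b"] by (auto simp: preimage_def eta_mult)
  qed
  show "I \<subseteq> preimage Q"
  proof
    fix a assume "a \<in> I"
    then have "a \<in> A" "a \<in> sat q I" using ideal_in_sub[OF ideal_I] sat_sup[OF prime_q ideal_I] by auto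
    then show "a \<in> preimage Q" using eta_zero[of a] by (simp add: preimage_def)
  qed
  show "preimage Q \<subseteq> q"
  proof
    fix a assume a: "a \<in> preimage Q"
    show "a \<in> q"
    proof (rule ccontr)
      assume "a \<notin> q"
      then have "\<eta> a \<in> Units L" using a by (intro eta_unit) (simp add: preimage_def)
      then have "\<one> \<in> Q" using a Q.I_r_closed[of "\<eta> a" "inv \<eta> a"] by (simp add: preimage_def)
      then show False using one by simp
    qed
  qed
qed

lemma preimage_strict:
  assumes "primeideal Q L" "primeideal Q' L" "Q \<subset> Q'"
  shows "preimage Q \<subset> preimage Q'"
proof -
  interpret Q: primeideal Q L by fact
  interpret Q': primeideal Q' L by fact
  obtain y where y: "y \<in> Q'" "y \<notin> Q" using assms(3) by auto
  have yL: "y \<in> carrier L" using y Q'.a_subset by auto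
  obtain a s where 1: "a \<in> A" "s \<in> A" "s \<notin> q" "y \<otimes> \<eta> s = \<eta> a" using yL by (rule fraction)
  have "a \<in> preimage Q'" "a \<notin> preimage Q"
    using ideal_unit_cancel[OF Q'.ideal_axioms eta_unit[of s] yL]
      ideal_unit_cancel[OF Q.ideal_axioms eta_unit[of s] yL] 1 y by (auto simp: preimage_def)
  then show ?thesis using assms(3) by (auto simp: preimage_def)
qed

text \<open>Primes of L correspond to primes between I and q through \<open>preimage\<close> and
  \<open>ext\<close>, and strict inclusions are kept in both directions.\<close>

lemma chain_iff:
  "(\<exists>P. (\<forall>i\<le>k. P i \<in> Spec L) \<and> (\<forall>i<k. P i \<subset> P (Suc i))) \<longleftrightarrow> (\<exists>P. prime_chain I k P q)"
proof
  assume "\<exists>P. (\<forall>i\<le>k. P i \<in> Spec L) \<and> (\<forall>i<k. P i \<subset> P (Suc i))"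
  then obtain P where P: "\<forall>i\<le>k. primeideal (P i) L" "\<forall>i<k. P i \<subset> P (Suc i)" by (auto simp: Spec_def)
  have "prime_chain I k (\<lambda>i. preimage (P i)) q"
    unfolding prime_chain_def using P preimage_prime preimage_strict by simp
  then show "\<exists>P. prime_chain I k P q" by blast
next
  assume "\<exists>P. prime_chain I k P q"
  then obtain P where P: "\<forall>i\<le>k. prime_in (P i)" "I \<subseteq> P 0" "\<forall>i<k. P i \<subset> P (Suc i)" "P k \<subseteq> q"
    by (auto simp: prime_chain_def)
  have low: "I \<subseteq> P i" if "i \<le> k" for i
    using that
  proof (induction i)
    case (Suc i)
    then have "P i \<subset> P (Suc i)" "I \<subseteq> P i" using P(3) by simp_all
    then show ?case by blast
  qed (use P(2) in simp)
  have high: "P i \<subseteq> q" if "i \<le> k" for i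
    using that
  proof (induction rule: inc_induct)
    case (step i)
    then have "P i \<subset> P (Suc i)" using P(3) by simp
    then show ?case using step by blast
  qed (use P(4) in simp)
  have pre: "preimage (ext (P i)) = P i" if "i \<le> k" for i
    using preimage_ext P(1) low[OF that] high[OF that] that by blast
  have "primeideal (ext (P i)) L" if "i \<le> k" for i using ext_prime P(1) low high that by blast
  moreover have "ext (P i) \<subset> ext (P (Suc i))" if "i < k" for i
  proof -
    have *: "P i \<subset> P (Suc i)" using P(3) that by simp
    have "ext (P i) \<subseteq> ext (P (Suc i))" by (rule ext_mono[OF psubset_imp_subset[OF *]])
    moreover have "ext (P i) \<noteq> ext (P (Suc i))"
    proof
      assume "ext (P i) = ext (P (Suc i))"
      then have "preimage (ext (P i)) = preimage (ext (P (Suc i)))" by (rule arg_cong)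
      then show False using * unfolding pre[OF less_imp_le[OF that]] pre[OF Suc_leI[OF that]] by simp
    qed
    ultimately show ?thesis by (rule psubsetI)
  qed
  ultimately show "\<exists>P. (\<forall>i\<le>k. P i \<in> Spec L) \<and> (\<forall>i<k. P i \<subset> P (Suc i))"
    by (intro exI[of _ "\<lambda>i. ext (P i)"]) (simp add: Spec_def)
qed

lemma krull_dim_eq: "krull_dim L = Sup {enat k | k. \<exists>P. prime_chain I k P q}"
  unfolding krull_dim_def chain_iff ..

text \<open>Everything outside \<open>ext q\<close> is a unit, so every proper ideal lies inside it.
  Uniqueness matters because \<open>max_ideal\<close> is a definite description.\<close>

lemma max_ideal_eq: "max_ideal L = ext q"
proof -
  note qid = prime_in_ideal[OF prime_q]
  have satq: "sat q q = q" by (rule sat_prime[OF prime_q]) simp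
  interpret M: primeideal "ext q" L by (rule ext_prime[OF prime_q I_sub]) simp
  have unit: "y \<in> Units L" if y: "y \<in> carrier L" "y \<notin> ext q" for y
  proof -
    obtain a s where 1: "a \<in> A" "s \<in> A" "s \<notin> q" "y \<otimes> \<eta> s = \<eta> a" using y(1) by (rule fraction)
    have "a \<notin> q" using in_ext_iff[OF qid I_sub y(1) 1] y(2) satq by simp
    then have u: "\<eta> a \<in> Units L" using 1 eta_unit by simp
    have "y \<otimes> (\<eta> s \<otimes> inv \<eta> a) = \<one>"
      using u 1 y by (simp add: m_assoc[symmetric])
    moreover have "\<eta> s \<otimes> inv \<eta> a \<in> carrier L" using u 1 by simp
    ultimately show ?thesis
      using y(1) m_comm[of y "\<eta> s \<otimes> inv \<eta> a"] unfolding Units_def by auto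
  qed
  have sub: "J \<subseteq> ext q" if J: "ideal J L" "J \<noteq> carrier L" for J
  proof
    interpret J: ideal J L by fact
    fix y assume y: "y \<in> J"
    show "y \<in> ext q"
    proof (rule ccontr)
      assume "y \<notin> ext q"
      then have "y \<in> Units L" using unit y J.a_subset by auto
      then have "\<one> \<in> J" using J.I_r_closed[OF y, of "inv y"] by simp
      then show False using J.one_imp_carrier J(2) by simp
    qed
  qed
  have "maximalideal (ext q) L"
  proof (rule maximalidealI[OF M.ideal_axioms M.I_notcarr])
    show "J = ext q \<or> J = carrier L" if "ideal J L" "ext q \<subseteq> J" "J \<subseteq> carrier L" for J
      using that sub by blast
  qed
  moreover have "J = ext q" if "maximalideal J L" for J
  proof -
    interpret J: maximalideal J L by fact
    have "J \<subseteq> ext q" using sub[OF J.ideal_axioms] J.I_notcarr by auto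
    then show ?thesis using J.I_maximal[OF M.ideal_axioms _ M.a_subset] M.I_notcarr by auto
  qed
  ultimately show ?thesis unfolding max_ideal_def by (rule the_equality)
qed

lemma genideal_empty: "Idl {} = ext I"
proof -
  have "ext I \<subseteq> {\<zero>}"
  proof
    fix y assume "y \<in> ext I"
    then obtain a s where 1: "y \<in> carrier L" "a \<in> I" "s \<in> A - q" "y \<otimes> \<eta> s = \<eta> a" by (auto simp: ext_def)
    have "\<eta> a = \<zero>"
      using eta_zero[of a] 1(2) sat_sup[OF prime_q ideal_I] ideal_in_sub[OF ideal_I] by auto
    then have "y \<otimes> \<eta> s \<in> {\<zero>}" using 1 by simp
    then show "y \<in> {\<zero>}" using ideal_unit_cancel[OF zeroideal eta_unit[OF 1(3)] 1(1)] by simp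
  qed
  moreover have "\<zero> \<in> ext I"
    by (rule additive_subgroup.zero_closed[OF ideal.axioms(1)[OF ext_ideal[OF ideal_I]]])
  moreover have "Idl {} \<subseteq> {\<zero>}" by (rule genideal_minimal[OF zeroideal]) simp
  moreover have "\<zero> \<in> Idl {}"
    by (rule additive_subgroup.zero_closed[OF ideal.axioms(1)[OF genideal_ideal]]) simp
  ultimately show ?thesis by blast
qed

text \<open>Adding a generator in L corresponds to adding its numerator in A, since the two differ
  by a unit factor.\<close>

lemma genideal_insert:
  assumes K: "ideal_in K" "I \<subseteq> K" and G: "G \<subseteq> carrier L" "Idl G = ext K"
    and x: "x \<in> carrier L" "a \<in> A" "s \<in> A" "s \<notin> q" "x \<otimes> \<eta> s = \<eta> a"
  shows "Idl (insert x G) = ext (plus_principal K a)"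
proof
  let ?K = "plus_principal K a"
  have K': "ideal_in ?K" "I \<subseteq> ?K" using plus_principal_ideal[OF K(1) x(2)] K(2) plus_principal_sup by auto
  have "a \<in> sat q ?K" using sat_sup[OF prime_q K'(1)] plus_principal_gen[OF K(1)] by auto
  then have "x \<in> ext ?K" using in_ext_iff[OF K' x] by simp
  moreover have "G \<subseteq> ext ?K" using genideal_self[OF G(1)] G(2) ext_mono[OF plus_principal_sup, of K a] by auto
  ultimately show "Idl (insert x G) \<subseteq> ext ?K" by (intro genideal_minimal[OF ext_ideal[OF K'(1)]]) simp
  have xG: "insert x G \<subseteq> carrier L" using x G by simp
  interpret J: ideal "Idl (insert x G)" L by (rule genideal_ideal[OF xG])
  show "ext ?K \<subseteq> Idl (insert x G)"
  proof
    fix y assume "y \<in> ext ?K"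
    then obtain f t where 1: "y \<in> carrier L" "f \<in> ?K" "t \<in> A - q" "y \<otimes> \<eta> t = \<eta> f" by (auto simp: ext_def)
    obtain k b where 2: "k \<in> K" "b \<in> A" "f = k + a * b" using 1(2) by (rule plus_principalE)
    have kA: "k \<in> A" using 2(1) ideal_in_sub[OF K(1)] by auto
    have "k \<in> sat q K" using 2(1) sat_sup[OF prime_q K(1)] by auto
    then have "\<eta> k \<in> Idl (insert x G)"
      using eta_in_ext_iff[OF K kA] G(2) genideal_insert_mono[OF G(1) x(1)] by auto
    moreover have "\<eta> a \<in> Idl (insert x G)"
      using J.I_r_closed[of x "\<eta> s"] genideal_self[OF xG] x by auto
    then have "\<eta> a \<otimes> \<eta> b \<in> Idl (insert x G)" using J.I_r_closed 2 by simp
    moreover have "y \<otimes> \<eta> t = \<eta> k \<oplus> \<eta> a \<otimes> \<eta> b" using 1(4) 2 kA x(2) by (simp add: eta_add eta_mult)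
    ultimately have "y \<otimes> \<eta> t \<in> Idl (insert x G)" using J.a_closed by simp
    then show "y \<in> Idl (insert x G)"
      using ideal_unit_cancel[OF J.ideal_axioms eta_unit[OF 1(3)] 1(1)] by simp
  qed
qed

text \<open>Both x and the test element y may be multiplied by unit denominators, which turns the
  condition in L into one about numerators.\<close>

lemma regular_at_iff:
  assumes K: "ideal_in K" "I \<subseteq> K" and x: "x \<in> carrier L" "a \<in> A" "s \<in> A" "s \<notin> q" "x \<otimes> \<eta> s = \<eta> a"
  shows "(\<forall>y\<in>carrier L. x \<otimes> y \<in> ext K \<longrightarrow> y \<in> ext K) \<longleftrightarrow> regular_at q K a"
proof -
  have key: "x \<otimes> y \<in> ext K \<longleftrightarrow> a * f \<in> sat q K"
    if y: "y \<in> carrier L" "f \<in> A" "u \<in> A" "u \<notin> q" "y \<otimes> \<eta> u = \<eta> f" for y f u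
  proof (rule in_ext_iff[OF K])
    have "(x \<otimes> y) \<otimes> \<eta> (s * u) = (x \<otimes> \<eta> s) \<otimes> (y \<otimes> \<eta> u)"
      using x(1,3) y(1,3) by (simp add: eta_mult m_interchange)
    also have "\<dots> = \<eta> (a * f)" using x y by (simp add: eta_mult)
    finally show "(x \<otimes> y) \<otimes> \<eta> (s * u) = \<eta> (a * f)" .
    show "s * u \<notin> q" using prime_in_compl_mult[OF prime_q, of s u] x y by simp
  qed (use x y in auto)
  show ?thesis
  proof
    assume L: "\<forall>y\<in>carrier L. x \<otimes> y \<in> ext K \<longrightarrow> y \<in> ext K"
    show "regular_at q K a"
      unfolding regular_at_def
    proof safe
      fix f assume f: "f \<in> A" "a * f \<in> sat q K"
      have "\<eta> f \<otimes> \<eta> 1 = \<eta> f" using f by (simp add: eta_one)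
      then have "x \<otimes> \<eta> f \<in> ext K"
        using key[of "\<eta> f" f 1] f prime_in_one[OF prime_q] by simp
      then show "f \<in> sat q K" using L f eta_in_ext_iff[OF K f(1)] by simp
    qed
  next
    assume R: "regular_at q K a"
    show "\<forall>y\<in>carrier L. x \<otimes> y \<in> ext K \<longrightarrow> y \<in> ext K"
    proof safe
      fix y assume y: "y \<in> carrier L" "x \<otimes> y \<in> ext K"
      obtain f u where f: "f \<in> A" "u \<in> A" "u \<notin> q" "y \<otimes> \<eta> u = \<eta> f" using y(1) by (rule fraction)
      have "a * f \<in> sat q K" using key[OF y(1) f] y(2) by simp
      then have "f \<in> sat q K" using regular_atD[OF R f(1)] by blast
      then show "y \<in> ext K" using in_ext_iff[OF K y(1) f] by simp
    qed
  qed
qed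

lemma regular_over_iff_depth_ge:
  assumes "ideal_in K" "I \<subseteq> K" "G \<subseteq> carrier L" "Idl G = ext K"
  shows "(\<exists>xs. length xs = t \<and> set xs \<subseteq> ext q \<and> regular_over L G xs) \<longleftrightarrow> depth_ge t q K"
  using assms
proof (induction t arbitrary: K G)
  case 0 show ?case by simp
next
  case (Suc t)
  note K = Suc.prems(1,2) and G = Suc.prems(3,4)
  have qA: "q \<subseteq> A" using ideal_in_sub[OF prime_in_ideal[OF prime_q]] .
  have satq: "sat q q = q" by (rule sat_prime[OF prime_q]) simp
  have step: "(\<exists>xs. length xs = t \<and> set xs \<subseteq> ext q \<and> regular_over L (insert x G) xs) \<longleftrightarrow> depth_ge t q (plus_principal K a)"
    if x: "x \<in> carrier L" "a \<in> A" "s \<in> A" "s \<notin> q" "x \<otimes> \<eta> s = \<eta> a" for x a s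
    by (rule Suc.IH[OF plus_principal_ideal[OF K(1) x(2)] order_trans[OF K(2) plus_principal_sup] _ genideal_insert[OF K G x]])
      (use x G in simp)
  show ?case
  proof
    assume "\<exists>xs. length xs = Suc t \<and> set xs \<subseteq> ext q \<and> regular_over L G xs"
    then obtain x xs where xs: "x \<in> ext q" "length xs = t" "set xs \<subseteq> ext q" "regular_over L (insert x G) xs"
      "\<forall>y\<in>carrier L. x \<otimes> y \<in> ext K \<longrightarrow> y \<in> ext K"
      unfolding length_Suc_conv by (auto simp: G(2))
    have xL: "x \<in> carrier L" using xs(1) by (simp add: ext_def)
    obtain a s where 1: "a \<in> A" "s \<in> A" "s \<notin> q" "x \<otimes> \<eta> s = \<eta> a" using xL by (rule fraction)
    have "a \<in> q" using in_ext_iff[OF prime_in_ideal[OF prime_q] I_sub xL 1] xs(1) satq by simp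
    moreover have "regular_at q K a" using regular_at_iff[OF K xL 1] xs(5) by simp
    moreover have "depth_ge t q (plus_principal K a)" using step[OF xL 1] xs by blast
    ultimately show "depth_ge (Suc t) q K" by auto
  next
    assume "depth_ge (Suc t) q K"
    then obtain a where a: "a \<in> q" "regular_at q K a" "depth_ge t q (plus_principal K a)" by auto
    have aA: "a \<in> A" using a qA by auto
    have 1: "\<eta> a \<in> carrier L" "a \<in> A" "1 \<in> A" "1 \<notin> q" "\<eta> a \<otimes> \<eta> 1 = \<eta> a"
      using aA prime_in_one[OF prime_q] by (simp_all add: eta_one)
    obtain xs where xs: "length xs = t" "set xs \<subseteq> ext q" "regular_over L (insert (\<eta> a) G) xs"
      using step[OF 1] a(3) by blast
    have "\<eta> a \<in> ext q" using eta_in_ext_iff[OF prime_in_ideal[OF prime_q] I_sub aA] satq a(1) by simp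
    then show "\<exists>xs. length xs = Suc t \<and> set xs \<subseteq> ext q \<and> regular_over L G xs"
      using xs regular_at_iff[OF K 1] a(2) by (intro exI[of _ "\<eta> a # xs"]) (simp add: G(2))
  qed
qed

text \<open>A sequence inside the maximal ideal generates a proper ideal, so the last clause of
  \<open>regular_sequence\<close> holds automatically and \<open>regular_over\<close> alone
  decides.\<close>

lemma enat_le_depth_iff: "enat t \<le> depth L \<longleftrightarrow> depth_ge t q I"
proof -
  interpret M: primeideal "ext q" L by (rule ext_prime[OF prime_q I_sub]) simp
  have reg: "regular_sequence L xs \<longleftrightarrow> regular_over L {} xs" if "set xs \<subseteq> ext q" for xs
  proof -
    have "Idl (set xs) \<subseteq> ext q" by (rule genideal_minimal[OF M.ideal_axioms that])
    then have "Idl (set xs) \<noteq> carrier L" using M.I_notcarr M.a_subset by blast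
    then show ?thesis using regular_sequence_iff[of xs] that M.a_subset by auto
  qed
  let ?S = "{enat (length xs) | xs. regular_sequence L xs \<and> set xs \<subseteq> ext q}"
  have "enat t \<le> Sup ?S \<longleftrightarrow> (\<exists>xs. length xs = t \<and> set xs \<subseteq> ext q \<and> regular_over L {} xs)"
  proof
    assume le: "enat t \<le> Sup ?S"
    show "\<exists>xs. length xs = t \<and> set xs \<subseteq> ext q \<and> regular_over L {} xs"
    proof (cases t)
      case 0 then show ?thesis by simp
    next
      case (Suc t')
      \<comment> \<open>A strict bound is below some member of the set, so a sequence of length at
        least t exists and can be cut to length t; this also covers an infinite supremum.\<close>
      have "enat t' < Sup ?S" using le unfolding Suc Suc_ile_eq .
      then obtain xs where xs: "enat t' < enat (length xs)" "regular_sequence L xs" "set xs \<subseteq> ext q"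
        unfolding less_Sup_iff by blast
      have "regular_over L {} (take t xs)" using reg[OF xs(3)] xs(2) regular_over_take by blast
      moreover have "length (take t xs) = t" using xs(1) Suc by simp
      moreover have "set (take t xs) \<subseteq> ext q" using xs(3) set_take_subset[of t xs] by blast
      ultimately show ?thesis by blast
    qed
  next
    assume "\<exists>xs. length xs = t \<and> set xs \<subseteq> ext q \<and> regular_over L {} xs"
    then have "enat t \<in> ?S" using reg by blast
    then show "enat t \<le> Sup ?S" by (rule Sup_upper)
  qed
  also have "\<dots> \<longleftrightarrow> depth_ge t q I"
    by (rule regular_over_iff_depth_ge[OF ideal_I subset_refl _ genideal_empty]) simp
  finally show ?thesis by (simp add: depth_def max_ideal_eq)
qed

end


section \<open>Localization of quotients of polynomial rings\<close>

lemma (in ring) minus_eq_zero_iff: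
  "x \<in> carrier R \<Longrightarrow> y \<in> carrier R \<Longrightarrow> x \<ominus> y = \<zero> \<longleftrightarrow> x = y"
  using minus_equality[of x "\<ominus> y"] by (auto simp: a_minus_def r_neg)

text \<open>The operations on fractions are unions over all representatives; independence of the
  representatives collapses such a union to one class.\<close>

lemma UN_pairs_const:
  assumes "X \<noteq> {}" "Y \<noteq> {}" "\<And>a s b t. (a, s) \<in> X \<Longrightarrow> (b, t) \<in> Y \<Longrightarrow> g a s b t = c"
  shows "(\<Union>(a, s)\<in>X. \<Union>(b, t)\<in>Y. g a s b t) = c"
  using assms by fastforce

section \<open>The ring of fractions\<close>

locale localizing = cring R for R (structure) +
  fixes S
  assumes S_sub: "S \<subseteq> carrier R" and one_S [simp]: "\<one> \<in> S"
    and mult_S [simp]: "s \<in> S \<Longrightarrow> t \<in> S \<Longrightarrow> s \<otimes> t \<in> S"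
begin

lemma S_carrier [simp]: "s \<in> S \<Longrightarrow> s \<in> carrier R"
  using S_sub by auto

definition frac where
  "frac a s = frac_rel R S `` {(a, s)}"

lemma frac_rel_iff:
  "((a, s), (b, t)) \<in> frac_rel R S \<longleftrightarrow>
     a \<in> carrier R \<and> s \<in> S \<and> b \<in> carrier R \<and> t \<in> S \<and> (\<exists>u\<in>S. u \<otimes> (t \<otimes> a) = u \<otimes> (s \<otimes> b))"
proof -
  have "u \<otimes> (t \<otimes> a \<ominus> s \<otimes> b) = \<zero> \<longleftrightarrow> u \<otimes> (t \<otimes> a) = u \<otimes> (s \<otimes> b)"
    if "a \<in> carrier R" "s \<in> S" "b \<in> carrier R" "t \<in> S" "u \<in> S" for u
  proof -
    have "u \<otimes> (t \<otimes> a \<ominus> s \<otimes> b) = u \<otimes> (t \<otimes> a) \<ominus> u \<otimes> (s \<otimes> b)"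
      using that by (simp add: a_minus_def r_distr r_minus)
    then show ?thesis using minus_eq_zero_iff that by simp
  qed
  then show ?thesis by (auto simp: frac_rel_def)
qed

lemma equiv_frac_rel: "equiv (carrier R \<times> S) (frac_rel R S)"
proof (rule equivI)
  show "frac_rel R S \<subseteq> (carrier R \<times> S) \<times> (carrier R \<times> S)" by (auto simp: frac_rel_def)
  show "refl_on (carrier R \<times> S) (frac_rel R S)"
    by (rule refl_onI) (auto simp: frac_rel_iff)
  show "sym (frac_rel R S)"
  proof (rule symI)
    fix x y assume "(x, y) \<in> frac_rel R S"
    then show "(y, x) \<in> frac_rel R S" by (cases x, cases y) (auto simp: frac_rel_iff intro: sym)
  qed
  show "trans (frac_rel R S)"
  proof (rule transI)
    fix x y z assume xyz: "(x, y) \<in> frac_rel R S" "(y, z) \<in> frac_rel R S"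
    obtain a s b t c w where eqs: "x = (a, s)" "y = (b, t)" "z = (c, w)" by (cases x, cases y, cases z)
    obtain u v where 1: "a \<in> carrier R" "s \<in> S" "b \<in> carrier R" "t \<in> S" "c \<in> carrier R" "w \<in> S" "u \<in> S" "v \<in> S"
      and u: "u \<otimes> (t \<otimes> a) = u \<otimes> (s \<otimes> b)" and v: "v \<otimes> (w \<otimes> b) = v \<otimes> (t \<otimes> c)"
      using xyz unfolding eqs frac_rel_iff by auto
    \<comment> \<open>Besides u and v, the witness contains the middle denominator t, which both
      given relations share.\<close>
    have "(u \<otimes> v \<otimes> t) \<otimes> (w \<otimes> a) = (v \<otimes> w) \<otimes> (u \<otimes> (t \<otimes> a))" using 1 by (simp add: m_ac)
    also have "\<dots> = (u \<otimes> s) \<otimes> (v \<otimes> (w \<otimes> b))" unfolding u using 1 by (simp add: m_ac)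
    also have "\<dots> = (u \<otimes> v \<otimes> t) \<otimes> (s \<otimes> c)" unfolding v using 1 by (simp add: m_ac)
    finally show "(x, z) \<in> frac_rel R S"
      unfolding eqs frac_rel_iff using 1 by (auto intro!: bexI[of _ "u \<otimes> v \<otimes> t"])
  qed
qed

lemma frac_eq_iff:
  assumes "a \<in> carrier R" "s \<in> S" "b \<in> carrier R" "t \<in> S"
  shows "frac a s = frac b t \<longleftrightarrow> (\<exists>u\<in>S. u \<otimes> (t \<otimes> a) = u \<otimes> (s \<otimes> b))"
  unfolding frac_def using eq_equiv_class_iff[OF equiv_frac_rel, of "(a, s)" "(b, t)"] assms
  by (simp add: frac_rel_iff)

lemma frac_eqI:
  assumes "a \<in> carrier R" "s \<in> S" "b \<in> carrier R" "t \<in> S" "t \<otimes> a = s \<otimes> b"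
  shows "frac a s = frac b t"
  using assms frac_eq_iff by (auto intro!: bexI[of _ \<one>])

abbreviation L where "L \<equiv> localization R S"

lemma frac_in [simp]: "a \<in> carrier R \<Longrightarrow> s \<in> S \<Longrightarrow> frac a s \<in> carrier L"
  by (auto simp: localization_def frac_def quotient_def)

lemma frac_cases:
  assumes "x \<in> carrier L" obtains a s where "a \<in> carrier R" "s \<in> S" "x = frac a s"
  using assms by (auto simp: localization_def frac_def elim!: quotientE)

lemma frac_one: "\<one>\<^bsub>L\<^esub> = frac \<one> \<one>" and frac_zero: "\<zero>\<^bsub>L\<^esub> = frac \<zero> \<one>"
  by (simp_all add: localization_def frac_def)

lemma frac_self: "a \<in> carrier R \<Longrightarrow> s \<in> S \<Longrightarrow> (a, s) \<in> frac a s"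
  unfolding frac_def by (rule equiv_class_self[OF equiv_frac_rel]) simp

lemma in_frac_iff: "(b, t) \<in> frac a s \<longleftrightarrow> ((a, s), (b, t)) \<in> frac_rel R S"
  by (simp add: frac_def)

lemma frac_mult:
  assumes "a \<in> carrier R" "s \<in> S" "b \<in> carrier R" "t \<in> S"
  shows "frac a s \<otimes>\<^bsub>L\<^esub> frac b t = frac (a \<otimes> b) (s \<otimes> t)"
proof -
  have "frac (a' \<otimes> b') (s' \<otimes> t') = frac (a \<otimes> b) (s \<otimes> t)"
    if "(a', s') \<in> frac a s" "(b', t') \<in> frac b t" for a' s' b' t'
  proof -
    obtain u v where 1: "a' \<in> carrier R" "s' \<in> S" "b' \<in> carrier R" "t' \<in> S" "u \<in> S" "v \<in> S"
      and u: "u \<otimes> (s' \<otimes> a) = u \<otimes> (s \<otimes> a')" and v: "v \<otimes> (t' \<otimes> b) = v \<otimes> (t \<otimes> b')"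
      using \<open>(a', s') \<in> frac a s\<close> \<open>(b', t') \<in> frac b t\<close> unfolding in_frac_iff frac_rel_iff by auto
    have "(u \<otimes> v) \<otimes> ((s \<otimes> t) \<otimes> (a' \<otimes> b')) = (u \<otimes> (s \<otimes> a')) \<otimes> (v \<otimes> (t \<otimes> b'))"
      using 1 assms by (simp add: m_ac)
    also have "\<dots> = (u \<otimes> v) \<otimes> ((s' \<otimes> t') \<otimes> (a \<otimes> b))"
      unfolding u[symmetric] v[symmetric] using 1 assms by (simp add: m_ac)
    finally show ?thesis using 1 assms by (subst frac_eq_iff) (auto intro!: bexI[of _ "u \<otimes> v"])
  qed
  note const = this
  have ne: "frac a s \<noteq> {}" "frac b t \<noteq> {}"
    using frac_self[OF assms(1,2)] frac_self[OF assms(3,4)] by (metis empty_iff)+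
  have "frac a s \<otimes>\<^bsub>L\<^esub> frac b t = (\<Union>(a', s')\<in>frac a s. \<Union>(b', t')\<in>frac b t. frac (a' \<otimes> b') (s' \<otimes> t'))"
    by (simp add: localization_def frac_def)
  also have "\<dots> = frac (a \<otimes> b) (s \<otimes> t)"
    by (rule UN_pairs_const[OF ne const])
  finally show ?thesis .
qed

lemma frac_add:
  assumes "a \<in> carrier R" "s \<in> S" "b \<in> carrier R" "t \<in> S"
  shows "frac a s \<oplus>\<^bsub>L\<^esub> frac b t = frac (a \<otimes> t \<oplus> b \<otimes> s) (s \<otimes> t)"
proof -
  have "frac (a' \<otimes> t' \<oplus> b' \<otimes> s') (s' \<otimes> t') = frac (a \<otimes> t \<oplus> b \<otimes> s) (s \<otimes> t)"
    if "(a', s') \<in> frac a s" "(b', t') \<in> frac b t" for a' s' b' t'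
  proof -
    obtain u v where 1: "a' \<in> carrier R" "s' \<in> S" "b' \<in> carrier R" "t' \<in> S" "u \<in> S" "v \<in> S"
      and u: "u \<otimes> (s' \<otimes> a) = u \<otimes> (s \<otimes> a')" and v: "v \<otimes> (t' \<otimes> b) = v \<otimes> (t \<otimes> b')"
      using \<open>(a', s') \<in> frac a s\<close> \<open>(b', t') \<in> frac b t\<close> unfolding in_frac_iff frac_rel_iff by auto
    have "(u \<otimes> v) \<otimes> ((s \<otimes> t) \<otimes> (a' \<otimes> t' \<oplus> b' \<otimes> s'))
      = (v \<otimes> t \<otimes> t') \<otimes> (u \<otimes> (s \<otimes> a')) \<oplus> (u \<otimes> s \<otimes> s') \<otimes> (v \<otimes> (t \<otimes> b'))"
      using 1 assms by (simp add: r_distr m_ac)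
    also have "\<dots> = (u \<otimes> v) \<otimes> ((s' \<otimes> t') \<otimes> (a \<otimes> t \<oplus> b \<otimes> s))"
      unfolding u[symmetric] v[symmetric] using 1 assms by (simp add: r_distr m_ac)
    finally show ?thesis using 1 assms by (subst frac_eq_iff) (auto intro!: bexI[of _ "u \<otimes> v"])
  qed
  note const = this
  have ne: "frac a s \<noteq> {}" "frac b t \<noteq> {}"
    using frac_self[OF assms(1,2)] frac_self[OF assms(3,4)] by (metis empty_iff)+
  have "frac a s \<oplus>\<^bsub>L\<^esub> frac b t = (\<Union>(a', s')\<in>frac a s. \<Union>(b', t')\<in>frac b t. frac (a' \<otimes> t' \<oplus> b' \<otimes> s') (s' \<otimes> t'))"
    by (simp add: localization_def frac_def)
  also have "\<dots> = frac (a \<otimes> t \<oplus> b \<otimes> s) (s \<otimes> t)"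
    by (rule UN_pairs_const[OF ne const])
  finally show ?thesis .
qed

lemma localization_cring: "cring L"
proof (rule cringI)
  show "abelian_group L"
  proof (rule abelian_groupI)
    fix x y assume "x \<in> carrier L" "y \<in> carrier L"
    then obtain a s b t where 1: "a \<in> carrier R" "s \<in> S" "b \<in> carrier R" "t \<in> S" "x = frac a s" "y = frac b t"
      by (metis frac_cases)
    then show "x \<oplus>\<^bsub>L\<^esub> y \<in> carrier L" by (simp add: frac_add)
    show "x \<oplus>\<^bsub>L\<^esub> y = y \<oplus>\<^bsub>L\<^esub> x" using 1 by (simp add: frac_add m_comm a_comm)
  next
    show "\<zero>\<^bsub>L\<^esub> \<in> carrier L" by (simp add: frac_zero)
  next
    fix x y z assume "x \<in> carrier L" "y \<in> carrier L" "z \<in> carrier L"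
    then obtain a s b t c w where 1: "a \<in> carrier R" "s \<in> S" "b \<in> carrier R" "t \<in> S" "c \<in> carrier R" "w \<in> S"
      "x = frac a s" "y = frac b t" "z = frac c w" by (metis frac_cases)
    then show "x \<oplus>\<^bsub>L\<^esub> y \<oplus>\<^bsub>L\<^esub> z = x \<oplus>\<^bsub>L\<^esub> (y \<oplus>\<^bsub>L\<^esub> z)"
      by (simp add: frac_add l_distr r_distr m_ac a_ac)
  next
    fix x assume "x \<in> carrier L"
    then obtain a s where 1: "a \<in> carrier R" "s \<in> S" "x = frac a s" by (metis frac_cases)
    then show "\<zero>\<^bsub>L\<^esub> \<oplus>\<^bsub>L\<^esub> x = x" by (simp add: frac_zero frac_add)
    have "frac (\<ominus> a) s \<oplus>\<^bsub>L\<^esub> x = frac ((\<ominus> a \<oplus> a) \<otimes> s) (s \<otimes> s)"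
      using 1 by (simp add: frac_add l_distr del: r_neg l_neg)
    also have "\<dots> = \<zero>\<^bsub>L\<^esub>" unfolding frac_zero using 1 by (intro frac_eqI) (simp_all add: l_neg)
    finally show "\<exists>y\<in>carrier L. y \<oplus>\<^bsub>L\<^esub> x = \<zero>\<^bsub>L\<^esub>" using 1 by (intro bexI[of _ "frac (\<ominus> a) s"]) simp_all
  qed
  show "comm_monoid L"
  proof (rule comm_monoidI)
    fix x y assume "x \<in> carrier L" "y \<in> carrier L"
    then obtain a s b t where 1: "a \<in> carrier R" "s \<in> S" "b \<in> carrier R" "t \<in> S" "x = frac a s" "y = frac b t"
      by (metis frac_cases)
    then show "x \<otimes>\<^bsub>L\<^esub> y \<in> carrier L" by (simp add: frac_mult)
    show "x \<otimes>\<^bsub>L\<^esub> y = y \<otimes>\<^bsub>L\<^esub> x" using 1 by (simp add: frac_mult m_comm)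
  next
    show "\<one>\<^bsub>L\<^esub> \<in> carrier L" by (simp add: frac_one)
  next
    fix x y z assume "x \<in> carrier L" "y \<in> carrier L" "z \<in> carrier L"
    then obtain a s b t c w where 1: "a \<in> carrier R" "s \<in> S" "b \<in> carrier R" "t \<in> S" "c \<in> carrier R" "w \<in> S"
      "x = frac a s" "y = frac b t" "z = frac c w" by (metis frac_cases)
    then show "x \<otimes>\<^bsub>L\<^esub> y \<otimes>\<^bsub>L\<^esub> z = x \<otimes>\<^bsub>L\<^esub> (y \<otimes>\<^bsub>L\<^esub> z)" by (simp add: frac_mult m_assoc)
  next
    fix x assume "x \<in> carrier L"
    then obtain a s where "a \<in> carrier R" "s \<in> S" "x = frac a s" by (metis frac_cases)
    then show "\<one>\<^bsub>L\<^esub> \<otimes>\<^bsub>L\<^esub> x = x" by (simp add: frac_one frac_mult)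
  qed
  fix x y z assume "x \<in> carrier L" "y \<in> carrier L" "z \<in> carrier L"
  then obtain a s b t c w where 1: "a \<in> carrier R" "s \<in> S" "b \<in> carrier R" "t \<in> S" "c \<in> carrier R" "w \<in> S"
    "x = frac a s" "y = frac b t" "z = frac c w" by (metis frac_cases)
  \<comment> \<open>The right-hand fraction is the left-hand one expanded by w.\<close>
  have "frac ((a \<otimes> t \<oplus> b \<otimes> s) \<otimes> c) (s \<otimes> t \<otimes> w) =
    frac (a \<otimes> c \<otimes> (t \<otimes> w) \<oplus> b \<otimes> c \<otimes> (s \<otimes> w)) (s \<otimes> w \<otimes> (t \<otimes> w))"
    using 1(1-6) by (intro frac_eqI) (simp_all add: l_distr r_distr m_ac)
  then show "(x \<oplus>\<^bsub>L\<^esub> y) \<otimes>\<^bsub>L\<^esub> z = x \<otimes>\<^bsub>L\<^esub> z \<oplus>\<^bsub>L\<^esub> y \<otimes>\<^bsub>L\<^esub> z"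
    using 1 by (simp add: frac_mult frac_add)
qed

lemma frac_unit: "s \<in> S \<Longrightarrow> frac s \<one> \<in> Units L"
proof -
  assume s: "s \<in> S"
  have "frac s s = frac \<one> \<one>" using s by (intro frac_eqI) simp_all
  then have "frac \<one> s \<otimes>\<^bsub>L\<^esub> frac s \<one> = \<one>\<^bsub>L\<^esub>" "frac s \<one> \<otimes>\<^bsub>L\<^esub> frac \<one> s = \<one>\<^bsub>L\<^esub>"
    using s by (simp_all add: frac_mult frac_one)
  then show ?thesis using s unfolding Units_def by (auto intro!: bexI[of _ "frac \<one> s"])
qed

end

text \<open>The map \<eta> is the residue class followed by the fraction with denominator one. An
  element dies under it iff some s outside the preimage of the prime multiplies it into I, which is
  saturation.\<close>

lemma local_quotient_localization_at:
  fixes I :: "((nat \<Rightarrow>\<^sub>0 nat) \<Rightarrow>\<^sub>0 'k::field) set"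
  assumes I: "ideal_of n I" and \<pp>: "\<pp> \<in> Spec (poly_ring n Quot I)"
  shows "\<exists>\<eta>. local_quotient (polys n) (localization_at (poly_ring n Quot I) \<pp>) \<eta>
    {a \<in> polys n. I +>\<^bsub>poly_ring n\<^esub> a \<in> \<pp>} I"
proof -
  interpret A: subring_in "polys n :: ((nat \<Rightarrow>\<^sub>0 nat) \<Rightarrow>\<^sub>0 'k) set" by (rule polys_subring)
  interpret P: cring "poly_ring n :: ((nat \<Rightarrow>\<^sub>0 nat) \<Rightarrow>\<^sub>0 'k) ring" by (rule poly_ring_cring)
  interpret I: ideal I "poly_ring n" using I ideal_poly_ring_iff by blast
  let ?R = "poly_ring n Quot I"
  interpret R: cring ?R by (rule I.quotient_is_cring[OF P.cring_axioms])
  interpret \<pp>: primeideal \<pp> ?R using \<pp> by (simp add: Spec_def)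
  let ?c = "\<lambda>a. I +>\<^bsub>poly_ring n\<^esub> a"
  have c: "?c \<in> ring_hom (poly_ring n) ?R" by (rule I.rcos_ring_hom)
  have c_in: "?c a \<in> carrier ?R" if "a \<in> polys n" for a using ring_hom_closed[OF c that] .
  have c_mult: "?c (a * b) = ?c a \<otimes>\<^bsub>?R\<^esub> ?c b" if "a \<in> polys n" "b \<in> polys n" for a b
    using ring_hom_mult[OF c that] by (simp add: poly_ring_simps)
  have c_add: "?c (a + b) = ?c a \<oplus>\<^bsub>?R\<^esub> ?c b" if "a \<in> polys n" "b \<in> polys n" for a b
    using ring_hom_add[OF c that] by (simp add: poly_ring_simps)
  have c_one: "?c 1 = \<one>\<^bsub>?R\<^esub>" using ring_hom_one[OF c] by (simp add: poly_ring_simps)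
  have zero: "\<zero>\<^bsub>?R\<^esub> = I" by (simp add: FactRing_def)
  have c_zero: "?c a = \<zero>\<^bsub>?R\<^esub> \<longleftrightarrow> a \<in> I" if "a \<in> polys n" for a
    unfolding zero by (rule P.coset_eq_ideal_iff[OF I.ideal_axioms that])
  have c_surj: "\<exists>a\<in>polys n. x = ?c a" if "x \<in> carrier ?R" for x
    using that by (auto simp: FactRing_def A_RCOSETS_def')
  have one: "\<one>\<^bsub>?R\<^esub> \<notin> \<pp>" using \<pp>.I_notcarr \<pp>.one_imp_carrier by blast
  let ?S = "carrier ?R - \<pp>"
  interpret Z: localizing ?R ?S
  proof
    show "\<one>\<^bsub>?R\<^esub> \<in> ?S" using one by simp
    show "s \<otimes>\<^bsub>?R\<^esub> t \<in> ?S" if "s \<in> ?S" "t \<in> ?S" for s t using that \<pp>.I_prime[of s t] by auto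
  qed auto
  interpret L: cring "localization ?R ?S" by (rule Z.localization_cring)
  let ?q = "{a \<in> polys n. ?c a \<in> \<pp>}"
  have c_S: "?c s \<in> ?S" if "s \<in> polys n - ?q" for s using that c_in by auto
  define \<eta> where "\<eta> a = Z.frac (?c a) \<one>\<^bsub>?R\<^esub>" for a
  have IA: "I \<subseteq> polys n" using A.ideal_in_sub[OF I] .
  have "local_quotient (polys n) (localization ?R ?S) \<eta> ?q I"
  proof
    have qid: "A.ideal_in ?q"
    proof (rule A.ideal_inI)
      show "0 \<in> ?q" using c_zero[of 0] A.ideal_in_zero[OF I] \<pp>.zero_closed by simp
      show "a + b \<in> ?q" if "a \<in> ?q" "b \<in> ?q" for a b
        using that c_add[of a b] \<pp>.a_closed[of "?c a" "?c b"] by simp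
      show "r * a \<in> ?q" if "r \<in> polys n" "a \<in> ?q" for r a
        using that c_mult[of r a] \<pp>.I_l_closed[of "?c a" "?c r"] c_in by simp
    qed auto
    show "A.prime_in ?q"
      unfolding A.prime_in_def
    proof (intro conjI ballI impI qid)
      show "1 \<notin> ?q" using one c_one by simp
      show "a \<in> ?q \<or> b \<in> ?q" if "a \<in> polys n" "b \<in> polys n" "a * b \<in> ?q" for a b
        using that c_mult[of a b] \<pp>.I_prime[of "?c a" "?c b"] c_in by simp
    qed
    show "A.ideal_in I" by (rule I)
    show "I \<subseteq> ?q"
    proof
      fix a assume "a \<in> I"
      then have "a \<in> polys n" "?c a = \<zero>\<^bsub>?R\<^esub>" using IA c_zero[of a] by auto
      then show "a \<in> ?q" using \<pp>.zero_closed by simp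
    qed
    show "\<eta> a \<in> carrier (localization ?R ?S)" if "a \<in> polys n" for a
      using that c_in by (simp add: \<eta>_def one)
    show "\<eta> (a + b) = \<eta> a \<oplus>\<^bsub>localization ?R ?S\<^esub> \<eta> b" if "a \<in> polys n" "b \<in> polys n" for a b
      using that c_in by (simp add: \<eta>_def Z.frac_add c_add one)
    show "\<eta> (a * b) = \<eta> a \<otimes>\<^bsub>localization ?R ?S\<^esub> \<eta> b" if "a \<in> polys n" "b \<in> polys n" for a b
      using that c_in by (simp add: \<eta>_def Z.frac_mult c_mult one)
    show "\<eta> 1 = \<one>\<^bsub>localization ?R ?S\<^esub>" by (simp add: \<eta>_def c_one Z.frac_one)
    show "\<eta> s \<in> Units (localization ?R ?S)" if "s \<in> polys n - ?q" for s
      unfolding \<eta>_def by (rule Z.frac_unit[OF c_S[OF that]])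
    show "\<exists>a\<in>polys n. \<exists>s\<in>polys n - ?q. y \<otimes>\<^bsub>localization ?R ?S\<^esub> \<eta> s = \<eta> a"
      if y: "y \<in> carrier (localization ?R ?S)" for y
    proof -
      obtain r t where 1: "r \<in> carrier ?R" "t \<in> ?S" "y = Z.frac r t" using y by (rule Z.frac_cases)
      obtain a where a: "a \<in> polys n" "r = ?c a" using c_surj[OF 1(1)] by blast
      obtain s where s: "s \<in> polys n" "t = ?c s" using c_surj[of t] 1(2) by blast
      have "Z.frac r t \<otimes>\<^bsub>localization ?R ?S\<^esub> Z.frac t \<one>\<^bsub>?R\<^esub> = Z.frac (r \<otimes>\<^bsub>?R\<^esub> t) (t \<otimes>\<^bsub>?R\<^esub> \<one>\<^bsub>?R\<^esub>)"
        using 1 Z.one_S by (intro Z.frac_mult) auto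
      also have "\<dots> = Z.frac r \<one>\<^bsub>?R\<^esub>"
        using 1 Z.one_S by (intro Z.frac_eqI) (auto simp: R.m_comm)
      finally have "y \<otimes>\<^bsub>localization ?R ?S\<^esub> \<eta> s = \<eta> a" unfolding \<eta>_def 1(3) a(2) s(2) .
      moreover have "s \<in> polys n - ?q" using s 1(2) by simp
      ultimately show ?thesis using a(1) by blast
    qed
    show "\<eta> a = \<zero>\<^bsub>localization ?R ?S\<^esub> \<longleftrightarrow> a \<in> A.sat ?q I" if a: "a \<in> polys n" for a
    proof -
      have "\<eta> a = \<zero>\<^bsub>localization ?R ?S\<^esub> \<longleftrightarrow> (\<exists>u\<in>?S. u \<otimes>\<^bsub>?R\<^esub> ?c a = \<zero>\<^bsub>?R\<^esub>)"
        unfolding \<eta>_def Z.frac_zero using c_in[OF a] Z.one_S by (subst Z.frac_eq_iff) auto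
      also have "\<dots> \<longleftrightarrow> (\<exists>s\<in>polys n - ?q. ?c (s * a) = \<zero>\<^bsub>?R\<^esub>)"
      proof
        assume "\<exists>u\<in>?S. u \<otimes>\<^bsub>?R\<^esub> ?c a = \<zero>\<^bsub>?R\<^esub>"
        then obtain u where u: "u \<in> ?S" "u \<otimes>\<^bsub>?R\<^esub> ?c a = \<zero>\<^bsub>?R\<^esub>" by blast
        obtain s where s: "s \<in> polys n" "u = ?c s" using c_surj[of u] u(1) by blast
        then have "s \<in> polys n - ?q" "?c (s * a) = \<zero>\<^bsub>?R\<^esub>" using u c_mult[OF s(1) a] by auto
        then show "\<exists>s\<in>polys n - ?q. ?c (s * a) = \<zero>\<^bsub>?R\<^esub>" by blast
      next
        assume "\<exists>s\<in>polys n - ?q. ?c (s * a) = \<zero>\<^bsub>?R\<^esub>"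
        then obtain s where s: "s \<in> polys n - ?q" "?c (s * a) = \<zero>\<^bsub>?R\<^esub>" by blast
        then show "\<exists>u\<in>?S. u \<otimes>\<^bsub>?R\<^esub> ?c a = \<zero>\<^bsub>?R\<^esub>"
          using c_S[OF s(1)] c_mult[of s a] a by (intro bexI[of _ "?c s"]) auto
      qed
      also have "\<dots> \<longleftrightarrow> a \<in> A.sat ?q I" using a c_zero by (auto simp: A.sat_def)
      finally show ?thesis .
    qed
  qed
  then show ?thesis by blast
qed

text \<open>Matches the primes over which \<open>serre_in\<close> ranges with the spectrum of the
  quotient. The image of q is saturated with respect to cosets because I lies in q.\<close>

lemma Spec_quotient_of_prime:
  fixes I :: "((nat \<Rightarrow>\<^sub>0 nat) \<Rightarrow>\<^sub>0 'k::field) set"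
  assumes I: "ideal_of n I" and q: "subring_in.prime_in (polys n) q" and Iq: "I \<subseteq> q"
  shows "\<exists>\<pp>\<in>Spec (poly_ring n Quot I). {a \<in> polys n. I +>\<^bsub>poly_ring n\<^esub> a \<in> \<pp>} = q"
proof -
  interpret A: subring_in "polys n :: ((nat \<Rightarrow>\<^sub>0 nat) \<Rightarrow>\<^sub>0 'k) set" by (rule polys_subring)
  interpret P: cring "poly_ring n :: ((nat \<Rightarrow>\<^sub>0 nat) \<Rightarrow>\<^sub>0 'k) ring" by (rule poly_ring_cring)
  interpret I: ideal I "poly_ring n" using I ideal_poly_ring_iff by blast
  let ?R = "poly_ring n Quot I"
  interpret R: cring ?R by (rule I.quotient_is_cring[OF P.cring_axioms])
  let ?c = "\<lambda>a. I +>\<^bsub>poly_ring n\<^esub> a"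
  note qid = A.prime_in_ideal[OF q]
  have qA: "q \<subseteq> polys n" using A.ideal_in_sub[OF qid] .
  have id: "ideal q (poly_ring n)" using qid ideal_poly_ring_iff by blast
  have c_q: "?c a \<in> ?c ` q \<longleftrightarrow> a \<in> q" if a: "a \<in> polys n" for a
  proof
    assume "?c a \<in> ?c ` q"
    then obtain b where b: "b \<in> q" "?c a = ?c b" by blast
    have "a \<in> ?c a" by (rule I.a_rcos_self[OF a])
    then obtain i where "i \<in> I" "a = i + b"
      unfolding b(2) by (auto simp: a_r_coset_def' poly_ring_simps)
    then show "a \<in> q" using A.ideal_in_add[OF qid] b(1) Iq by blast
  qed simp
  have c_surj: "\<exists>a\<in>polys n. x = ?c a" if "x \<in> carrier ?R" for x
    using that by (auto simp: FactRing_def A_RCOSETS_def')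
  have c: "?c \<in> ring_hom (poly_ring n) ?R" by (rule I.rcos_ring_hom)
  have "primeideal (?c ` q) ?R"
  proof (rule primeidealI)
    show "ideal (?c ` q) ?R" by (rule P.ring_ideal_imp_quot_ideal[OF I.ideal_axioms id])
    show "cring ?R" by (rule R.cring_axioms)
    have "?c 1 \<notin> ?c ` q" using c_q A.prime_in_one[OF q] by simp
    then show "carrier ?R \<noteq> ?c ` q" using ring_hom_closed[OF c, of 1] by auto
    fix x y assume xy: "x \<in> carrier ?R" "y \<in> carrier ?R" "x \<otimes>\<^bsub>?R\<^esub> y \<in> ?c ` q"
    obtain a b where ab: "a \<in> polys n" "x = ?c a" "b \<in> polys n" "y = ?c b"
      using c_surj[OF xy(1)] c_surj[OF xy(2)] by blast
    have "?c (a * b) \<in> ?c ` q"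
      using xy(3) ring_hom_mult[OF c ab(1,3)] unfolding ab(2,4) by (simp add: poly_ring_simps)
    then have "a * b \<in> q" using c_q ab by simp
    then show "x \<in> ?c ` q \<or> y \<in> ?c ` q" using A.prime_in_mult[OF q ab(1,3)] ab by blast
  qed
  moreover have "{a \<in> polys n. ?c a \<in> ?c ` q} = q" using c_q qA by blast
  ultimately show ?thesis by (auto simp: Spec_def)
qed

text \<open>Removes the extended reals. A negative value of dim - j is exceeded by every depth, just
  as truncated subtraction yields the bound 0.\<close>

lemma serre_inequality_iff:
  fixes D d :: enat
  shows "ereal_of_enat d \<ge> min (ereal (real l)) (ereal_of_enat D - ereal (real j)) \<longleftrightarrow>
    (\<forall>k. enat k \<le> D \<longrightarrow> enat (min l (k - j)) \<le> d)"
proof (cases d)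
  case infinity then show ?thesis by simp
next
  case d: (enat d')
  show ?thesis
  proof (cases D)
    case D: (enat m)
    have "min (ereal (real l)) (ereal_of_enat D - ereal (real j)) \<le> ereal_of_enat d \<longleftrightarrow>
      l \<le> d' \<or> m \<le> d' + j"
      unfolding d D by (simp add: min_le_iff_disj) linarith
    also have "\<dots> \<longleftrightarrow> min l (m - j) \<le> d'" by auto
    also have "\<dots> \<longleftrightarrow> (\<forall>k\<le>m. min l (k - j) \<le> d')"
      by (auto simp: min_le_iff_disj intro: order_trans[OF diff_le_mono])
    finally show ?thesis by (simp add: d D)
  next
    case infinity
    \<comment> \<open>In infinite dimension the minimum is l, and k = l + j already forces this
      bound.\<close>
    have "l \<le> d'" if "\<forall>k. min l (k - j) \<le> d'" using that[rule_format, of "l + j"] by simp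
    then show ?thesis by (auto simp: d infinity)
  qed
qed

text \<open>Since \<open>Q\<close> passes to smaller numbers, a bound up to the supremum can be
  checked on the members; \<open>Q 0\<close> settles k = 0, where no member need be found.\<close>

lemma all_le_Sup_enat_iff:
  assumes "Q 0" and anti: "\<And>k m. k \<le> m \<Longrightarrow> Q m \<Longrightarrow> Q k"
  shows "(\<forall>k. enat k \<le> Sup {enat k | k. C k} \<longrightarrow> Q k) \<longleftrightarrow> (\<forall>k. C k \<longrightarrow> Q k)"
proof
  assume "\<forall>k. enat k \<le> Sup {enat k | k. C k} \<longrightarrow> Q k"
  moreover have "enat k \<le> Sup {enat k | k. C k}" if "C k" for k using that by (intro Sup_upper) blast
  ultimately show "\<forall>k. C k \<longrightarrow> Q k" by blast
next
  assume Q: "\<forall>k. C k \<longrightarrow> Q k"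
  show "\<forall>k. enat k \<le> Sup {enat k | k. C k} \<longrightarrow> Q k"
  proof (intro allI impI)
    fix k assume le: "enat k \<le> Sup {enat k | k. C k}"
    show "Q k"
    proof (cases k)
      case 0 then show ?thesis using assms(1) by simp
    next
      case (Suc k')
      have "enat k' < Sup {enat k | k. C k}" using le unfolding Suc Suc_ile_eq .
      then obtain m where "enat k' < enat m" "C m" unfolding less_Sup_iff by blast
      then show ?thesis using Q anti[of k m] Suc by simp
    qed
  qed
qed

text \<open>Ties the condition on localized quotient rings to the one on ideals of A: depth and
  dimension are translated at each prime, and the primes of the quotient are exactly those of A
  above I.\<close>

lemma serre_cond_iff_serre_in:
  fixes I :: "((nat \<Rightarrow>\<^sub>0 nat) \<Rightarrow>\<^sub>0 'k::field) set"
  assumes I: "ideal_of n I"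
  shows "serre_cond l j (poly_ring n Quot I) \<longleftrightarrow> subring_in.serre_in (polys n) l j I"
proof -
  interpret A: subring_in "polys n :: ((nat \<Rightarrow>\<^sub>0 nat) \<Rightarrow>\<^sub>0 'k) set" by (rule polys_subring)
  let ?R = "poly_ring n Quot I"
  let ?good = "\<lambda>q. \<forall>k. (\<exists>P. A.prime_chain I k P q) \<longrightarrow> A.depth_ge (min l (k - j)) q I"
  have local: "min (ereal (real l)) (ereal_of_enat (krull_dim (localization_at ?R \<pp>)) - ereal (real j))
      \<le> ereal_of_enat (depth (localization_at ?R \<pp>)) \<longleftrightarrow> ?good {a \<in> polys n. I +>\<^bsub>poly_ring n\<^esub> a \<in> \<pp>}"
    and prime: "A.prime_in {a \<in> polys n. I +>\<^bsub>poly_ring n\<^esub> a \<in> \<pp>}"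
    if \<pp>: "\<pp> \<in> Spec ?R" for \<pp>
  proof -
    obtain \<eta> where "local_quotient (polys n) (localization_at ?R \<pp>) \<eta> {a \<in> polys n. I +>\<^bsub>poly_ring n\<^esub> a \<in> \<pp>} I"
      using local_quotient_localization_at[OF I \<pp>] by blast
    then interpret L: local_quotient "polys n" "localization_at ?R \<pp>" \<eta> "{a \<in> polys n. I +>\<^bsub>poly_ring n\<^esub> a \<in> \<pp>}" I .
    show "A.prime_in {a \<in> polys n. I +>\<^bsub>poly_ring n\<^esub> a \<in> \<pp>}" by (rule L.prime_q)
    let ?d = "depth (localization_at ?R \<pp>)"
    have "min (ereal (real l)) (ereal_of_enat (krull_dim (localization_at ?R \<pp>)) - ereal (real j)) \<le> ereal_of_enat ?d
      \<longleftrightarrow> (\<forall>k. (\<exists>P. A.prime_chain I k P {a \<in> polys n. I +>\<^bsub>poly_ring n\<^esub> a \<in> \<pp>}) \<longrightarrow> enat (min l (k - j)) \<le> ?d)"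
      unfolding serre_inequality_iff L.krull_dim_eq
    proof (rule all_le_Sup_enat_iff)
      show "enat (min l (0 - j)) \<le> ?d" by (simp add: zero_enat_def[symmetric])
      show "enat (min l (k - j)) \<le> ?d" if "k \<le> m" "enat (min l (m - j)) \<le> ?d" for k m
      proof -
        have "min l (k - j) \<le> min l (m - j)" using that(1) by auto
        then have "enat (min l (k - j)) \<le> enat (min l (m - j))" by simp
        then show ?thesis using that(2) by (rule order_trans)
      qed
    qed
    then show "min (ereal (real l)) (ereal_of_enat (krull_dim (localization_at ?R \<pp>)) - ereal (real j))
      \<le> ereal_of_enat ?d \<longleftrightarrow> ?good {a \<in> polys n. I +>\<^bsub>poly_ring n\<^esub> a \<in> \<pp>}"
      unfolding L.enat_le_depth_iff .
  qed
  have sub: "I \<subseteq> q" if "A.prime_chain I k P q" for k P q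
  proof -
    have "I \<subseteq> P i" if "i \<le> k" for i
      using that
    proof (induction i)
      case (Suc i)
      then have "P i \<subset> P (Suc i)" "I \<subseteq> P i" using \<open>A.prime_chain I k P q\<close> by (simp_all add: A.prime_chain_def)
      then show ?case by blast
    qed (use \<open>A.prime_chain I k P q\<close> in \<open>simp add: A.prime_chain_def\<close>)
    from this[of k] show ?thesis using that unfolding A.prime_chain_def by blast
  qed
  show ?thesis
  proof
    assume S: "serre_cond l j ?R"
    show "A.serre_in l j I"
      unfolding A.serre_in_def
    proof (intro allI impI)
      fix q k P assume q: "A.prime_in q" and ch: "A.prime_chain I k P q"
      obtain \<pp> where \<pp>: "\<pp> \<in> Spec ?R" "{a \<in> polys n. I +>\<^bsub>poly_ring n\<^esub> a \<in> \<pp>} = q"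
        using Spec_quotient_of_prime[OF I q sub[OF ch]] by blast
      have "?good q" using S local[OF \<pp>(1)] \<pp> unfolding serre_cond_def by simp
      then show "A.depth_ge (min l (k - j)) q I" using ch by blast
    qed
  next
    assume S: "A.serre_in l j I"
    show "serre_cond l j ?R"
      unfolding serre_cond_def
    proof
      fix \<pp> assume \<pp>: "\<pp> \<in> Spec ?R"
      show "min (ereal (real l)) (ereal_of_enat (krull_dim (localization_at ?R \<pp>)) - ereal (real j))
        \<le> ereal_of_enat (depth (localization_at ?R \<pp>))"
        unfolding local[OF \<pp>] using S prime[OF \<pp>] unfolding A.serre_in_def by blast
    qed
  qed
qed

theorem theorem7p6:
  fixes n l j :: nat
    and I :: "((nat \<Rightarrow>\<^sub>0 nat) \<Rightarrow>\<^sub>0 'k::field) set"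
  assumes "monomial_ideal n I"
    and "serre_cond l j (poly_ring n Quot I)"
  shows "serre_cond l j (poly_ring n Quot (radical (poly_ring n) I))"
proof -
  interpret A: subring_in "polys n :: ((nat \<Rightarrow>\<^sub>0 nat) \<Rightarrow>\<^sub>0 'k) set" by (rule polys_subring)
  have I: "monomial_in n I" by (rule monomial_ideal_imp_monomial_in[OF assms(1)])
  then have id: "ideal_of n I" by (simp add: monomial_in_def)
  then have "A.serre_in l j I" using assms(2) serre_cond_iff_serre_in by blast
  then have "A.serre_in l j (radical (poly_ring n) I)" by (rule serre_in_radical[OF I])
  moreover have "ideal_of n (radical (poly_ring n) I)"
    unfolding radical_poly_ring by (rule A.rad_ideal[OF id])
  ultimately show ?thesis using serre_cond_iff_serre_in by blast
qed

end
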